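(* Let $R$ be a solid Cu-semiring. Then the evaluation map $\mathrm e_{R,R}\colon[\![R,R]\!]\otimes R\to R$ is an isomorphism in each of the following cases: (1) the unit of $R$ is compact; (2) $R$ satisfies (O5) and (O6). In particular, a Cu-semiring $R$ with compact unit is solid if and only if the evaluation map $\mathrm e_{R,R}\colon[\![R,R]\!]\otimes R\to R$ is an isomorphism.
   Context: A positively ordered semigroup is a commutative monoid $(S,+,0)$ with a partial order $\le$ compatible with addition such that $0\le a$ for all $a$. For $a,b\in S$, $a\ll b$ (way-below) means: whenever $(c_n)_n$ is an increasing sequence in $S$ whose supremum exists and satisfies $b\le\sup_n c_n$, there is $k$ with $a\le c_k$. An element $a$ is compact if $a\ll a$. A Cu-semigroup is a positively ordered semigroup satisfying: (O1) every increasing sequence has a supremum; (O2) every $a$ is the supremum of a sequence $(a_n)_n$ with $a_n\ll a_{n+1}$ for all $n$; (O3) $a'\ll a$ and $b'\ll b$ imply $a'+b'\ll a+b$; (O4) $\sup_n(a_n+b_n)=\sup_n a_n+\sup_n b_n$ for increasing sequences. A generalized Cu-morphism is a map between Cu-semigroups preserving addition, zero, order and suprema of increasing sequences; a Cu-morphism additionally preserves $\ll$. $\mathrm{Cu}[S,T]$ and $\mathrm{Cu}(S,T)$ denote the sets of generalized Cu-morphisms and of Cu-morphisms $S\to T$, with pointwise order and addition. An isomorphism is a bijective additive order-isomorphism. Additional axioms for a Cu-semigroup $S$: (O5) for all $a',a,b',b,c\in S$ with $a+b\le c$, $a'\ll a$, $b'\ll b$ there is $x\in S$ with $a'+x\le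 c\le a+x$ and $b'\le x$. (O6) for all $a',a,b,c\in S$ with $a'\ll a\le b+c$ there are $e,f\in S$ with $a'\le e+f$, $e\le a$, $e\le b$, $f\le a$, $f\le c$. A Cu-bimorphism $\varphi\colon S\times T\to P$ is a map that is additive, zero- and order-preserving in each variable, satisfies $\sup_k\varphi(a_k,b_k)=\varphi(\sup_k a_k,\sup_k b_k)$ for increasing sequences, and satisfies $\varphi(a',b')\ll\varphi(a,b)$ whenever $a'\ll a$ and $b'\ll b$. $S\otimes T$ denotes the Cu-semigroup with universal Cu-bimorphism $S\times T\to S\otimes T$, $(a,b)\mapsto a\otimes b$: every Cu-bimorphism $S\times T\to P$ factors through a unique Cu-morphism $S\otimes T\to P$, and Cu-morphisms $\alpha_1,\alpha_2\colon S\otimes T\to P$ satisfy $\alpha_1\le\alpha_2$ iff $\alpha_1(a\otimes b)\le\alpha_2(a\otimes b)$ for all $a,b$. Let $I_{\mathbb Q}=\mathbb Q\cap(0,1)$. For $\varphi,\psi\in\mathrm{Cu}[S,T]$ write $\varphi\prec\psi$ if $\varphi(a')\ll\psi(a)$ whenever $a'\ll a$ in $S$. A path in $\mathrm{Cu}[S,T]$ is a family $\mathbf f=(f_\lambda)_{\lambda\in I_{\mathbb Q}}$ with $f_{\lambda'}\prec f_\lambda$ whenever $\lambda'<\lambda$. Write $\mathbf f\lesssim\mathbf g$ if for every $\lambda$ there is $\mu$ with $f_\lambda\prec g_\mu$. The internal hom $[\![S,T]\!]$ is the set of classes $[\mathbf f]$ of paths modulo ($\mathbf f\lesssim\mathbf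 g$ and $\mathbf g\lesssim\mathbf f$), with $[\mathbf f]+[\mathbf g]=[(f_\lambda+g_\lambda)_\lambda]$ and $[\mathbf f]\le[\mathbf g]$ iff $\mathbf f\lesssim\mathbf g$; it is a Cu-semigroup. The endpoint map $\sigma_{S,T}\colon[\![S,T]\!]\to\mathrm{Cu}[S,T]$ is $\sigma_{S,T}([\mathbf f])(a)=\sup_\lambda f_\lambda(a)$. It is known that for Cu-semigroups $S,T,P$ there is a bijection $\mathrm{Cu}(S,[\![T,P]\!])\cong\mathrm{Cu}(S\otimes T,P)$ sending $\alpha$ to the Cu-morphism $a\otimes b\mapsto\sigma_{T,P}(\alpha(a))(b)$. The evaluation (counit) map $\mathrm e_{S,T}\colon[\![S,T]\!]\otimes S\to T$ is the Cu-morphism corresponding to $\mathrm{id}_{[\![S,T]\!]}$. A Cu-semiring is a Cu-semigroup $R$ with a Cu-bimorphism $R\times R\to R$, $(r,s)\mapsto rs$, that is associative, and an element $1\in R$ with $r1=r=1r$ for all $r$ (commutativity is not assumed). $R$ is solid if the Cu-morphism $\mu_R\colon R\otimes R\to R$ induced by multiplication is an isomorphism. *)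

theory Defs
  imports Complex_Main "HOL-Library.Multiset" "HOL-Library.Nat_Bijection" "HOL-Algebra.Ring"
begin

section \<open>Cu-semigroups\<close>

text \<open>As for modules in HOL-Algebra, the underlying record is that of rings: the additive structure
  is written \<open>\<oplus>\<close>, \<open>\<zero>\<close>, and the fields \<open>\<otimes>\<close>, \<open>\<one>\<close> are only used for Cu-semirings.\<close>

record 'a cu = "'a ring" +
  leq :: "'a \<Rightarrow> 'a \<Rightarrow> bool" (infix \<open>\<preceq>\<index>\<close> 50)

definition is_sup :: "('a, 'm) cu_scheme \<Rightarrow> 'a set \<Rightarrow> 'a \<Rightarrow> bool" where
  "is_sup S A s \<longleftrightarrow> s \<in> carrier S \<and> (\<forall>x\<in>A. x \<preceq>\<^bsub>S\<^esub> s) \<and>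
     (\<forall>u\<in>carrier S. (\<forall>x\<in>A. x \<preceq>\<^bsub>S\<^esub> u) \<longrightarrow> s \<preceq>\<^bsub>S\<^esub> u)"

definition increasing :: "('a, 'm) cu_scheme \<Rightarrow> (nat \<Rightarrow> 'a) \<Rightarrow> bool" where
  "increasing S c \<longleftrightarrow> (\<forall>n. c n \<in> carrier S \<and> c n \<preceq>\<^bsub>S\<^esub> c (Suc n))"

definition way_below :: "('a, 'm) cu_scheme \<Rightarrow> 'a \<Rightarrow> 'a \<Rightarrow> bool" (infix \<open>\<lless>\<index>\<close> 50) where
  "a \<lless>\<^bsub>S\<^esub> b \<longleftrightarrow> a \<in> carrier S \<and> b \<in> carrier S \<and>
     (\<forall>c s. increasing S c \<longrightarrow> is_sup S (range c) s \<longrightarrow> b \<preceq>\<^bsub>S\<^esub> s \<longrightarrow> (\<exists>k. a \<preceq>\<^bsub>S\<^esub> c k))"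

definition cu_compact :: "('a, 'm) cu_scheme \<Rightarrow> 'a \<Rightarrow> bool" where
  "cu_compact S a \<longleftrightarrow> a \<lless>\<^bsub>S\<^esub> a"

locale positively_ordered_semigroup = abelian_monoid S for S (structure) +
  assumes le_refl [simp, intro]: "a \<in> carrier S \<Longrightarrow> a \<preceq> a"
    and le_antisym: "\<lbrakk>a \<in> carrier S; b \<in> carrier S; a \<preceq> b; b \<preceq> a\<rbrakk> \<Longrightarrow> a = b"
    and le_trans: "\<lbrakk>a \<in> carrier S; b \<in> carrier S; c \<in> carrier S; a \<preceq> b; b \<preceq> c\<rbrakk> \<Longrightarrow> a \<preceq> c"
    and add_right_mono: "\<lbrakk>a \<in> carrier S; b \<in> carrier S; c \<in> carrier S; a \<preceq> b\<rbrakk> \<Longrightarrow> a \<oplus> c \<preceq> b \<oplus> c"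
    and zero_le [simp]: "a \<in> carrier S \<Longrightarrow> \<zero> \<preceq> a"

locale cu_semigroup = positively_ordered_semigroup +
  assumes O1: "increasing S c \<Longrightarrow> \<exists>s. is_sup S (range c) s"
    and O2: "a \<in> carrier S \<Longrightarrow> \<exists>c. (\<forall>n. c n \<lless> c (Suc n)) \<and> is_sup S (range c) a"
    and O3: "\<lbrakk>a' \<lless> a; b' \<lless> b\<rbrakk> \<Longrightarrow> a' \<oplus> b' \<lless> a \<oplus> b"
    and O4: "\<lbrakk>increasing S c; increasing S d; is_sup S (range c) s; is_sup S (range d) t\<rbrakk>
              \<Longrightarrow> is_sup S (range (\<lambda>n. c n \<oplus> d n)) (s \<oplus> t)"

definition cu_O5 :: "('a, 'm) cu_scheme \<Rightarrow> bool" where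
  "cu_O5 S \<longleftrightarrow> (\<forall>a'\<in>carrier S. \<forall>a\<in>carrier S. \<forall>b'\<in>carrier S. \<forall>b\<in>carrier S. \<forall>c\<in>carrier S.
     a \<oplus>\<^bsub>S\<^esub> b \<preceq>\<^bsub>S\<^esub> c \<and> a' \<lless>\<^bsub>S\<^esub> a \<and> b' \<lless>\<^bsub>S\<^esub> b \<longrightarrow>
     (\<exists>x\<in>carrier S. a' \<oplus>\<^bsub>S\<^esub> x \<preceq>\<^bsub>S\<^esub> c \<and> c \<preceq>\<^bsub>S\<^esub> a \<oplus>\<^bsub>S\<^esub> x \<and> b' \<preceq>\<^bsub>S\<^esub> x))"

definition cu_O6 :: "('a, 'm) cu_scheme \<Rightarrow> bool" where
  "cu_O6 S \<longleftrightarrow> (\<forall>a'\<in>carrier S. \<forall>a\<in>carrier S. \<forall>b\<in>carrier S. \<forall>c\<in>carrier S.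
     a' \<lless>\<^bsub>S\<^esub> a \<and> a \<preceq>\<^bsub>S\<^esub> b \<oplus>\<^bsub>S\<^esub> c \<longrightarrow>
     (\<exists>e\<in>carrier S. \<exists>f\<in>carrier S. a' \<preceq>\<^bsub>S\<^esub> e \<oplus>\<^bsub>S\<^esub> f \<and>
        e \<preceq>\<^bsub>S\<^esub> a \<and> e \<preceq>\<^bsub>S\<^esub> b \<and> f \<preceq>\<^bsub>S\<^esub> a \<and> f \<preceq>\<^bsub>S\<^esub> c))"


section \<open>Morphisms and bimorphisms\<close>

definition gen_cu_morphism ::
    "('a, 'm) cu_scheme \<Rightarrow> ('b, 'n) cu_scheme \<Rightarrow> ('a \<Rightarrow> 'b) \<Rightarrow> bool" where
  "gen_cu_morphism S T f \<longleftrightarrow>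
     f \<in> carrier S \<rightarrow> carrier T \<and>
     (\<forall>a\<in>carrier S. \<forall>b\<in>carrier S. f (a \<oplus>\<^bsub>S\<^esub> b) = f a \<oplus>\<^bsub>T\<^esub> f b) \<and>
     f \<zero>\<^bsub>S\<^esub> = \<zero>\<^bsub>T\<^esub> \<and>
     (\<forall>a\<in>carrier S. \<forall>b\<in>carrier S. a \<preceq>\<^bsub>S\<^esub> b \<longrightarrow> f a \<preceq>\<^bsub>T\<^esub> f b) \<and>
     (\<forall>c s. increasing S c \<longrightarrow> is_sup S (range c) s \<longrightarrow> is_sup T (range (\<lambda>n. f (c n))) (f s))"

definition cu_morphism ::
    "('a, 'm) cu_scheme \<Rightarrow> ('b, 'n) cu_scheme \<Rightarrow> ('a \<Rightarrow> 'b) \<Rightarrow> bool" where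
  "cu_morphism S T f \<longleftrightarrow> gen_cu_morphism S T f \<and>
     (\<forall>a b. a \<lless>\<^bsub>S\<^esub> b \<longrightarrow> f a \<lless>\<^bsub>T\<^esub> f b)"

definition cu_iso ::
    "('a, 'm) cu_scheme \<Rightarrow> ('b, 'n) cu_scheme \<Rightarrow> ('a \<Rightarrow> 'b) \<Rightarrow> bool" where
  "cu_iso S T f \<longleftrightarrow>
     bij_betw f (carrier S) (carrier T) \<and>
     (\<forall>a\<in>carrier S. \<forall>b\<in>carrier S. f (a \<oplus>\<^bsub>S\<^esub> b) = f a \<oplus>\<^bsub>T\<^esub> f b) \<and>
     (\<forall>a\<in>carrier S. \<forall>b\<in>carrier S. a \<preceq>\<^bsub>S\<^esub> b \<longleftrightarrow> f a \<preceq>\<^bsub>T\<^esub> f b)"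

definition cu_bimorphism ::
    "('a, 'm) cu_scheme \<Rightarrow> ('b, 'n) cu_scheme \<Rightarrow> ('c, 'k) cu_scheme \<Rightarrow> ('a \<Rightarrow> 'b \<Rightarrow> 'c) \<Rightarrow> bool" where
  "cu_bimorphism S T P \<phi> \<longleftrightarrow>
     (\<forall>a\<in>carrier S. \<forall>b\<in>carrier T. \<phi> a b \<in> carrier P) \<and>
     (\<forall>a1\<in>carrier S. \<forall>a2\<in>carrier S. \<forall>b\<in>carrier T.
        \<phi> (a1 \<oplus>\<^bsub>S\<^esub> a2) b = \<phi> a1 b \<oplus>\<^bsub>P\<^esub> \<phi> a2 b) \<and>
     (\<forall>a\<in>carrier S. \<forall>b1\<in>carrier T. \<forall>b2\<in>carrier T.
        \<phi> a (b1 \<oplus>\<^bsub>T\<^esub> b2) = \<phi> a b1 \<oplus>\<^bsub>P\<^esub> \<phi> a b2) \<and>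
     (\<forall>b\<in>carrier T. \<phi> \<zero>\<^bsub>S\<^esub> b = \<zero>\<^bsub>P\<^esub>) \<and>
     (\<forall>a\<in>carrier S. \<phi> a \<zero>\<^bsub>T\<^esub> = \<zero>\<^bsub>P\<^esub>) \<and>
     (\<forall>a1\<in>carrier S. \<forall>a2\<in>carrier S. \<forall>b\<in>carrier T. a1 \<preceq>\<^bsub>S\<^esub> a2 \<longrightarrow> \<phi> a1 b \<preceq>\<^bsub>P\<^esub> \<phi> a2 b) \<and>
     (\<forall>a\<in>carrier S. \<forall>b1\<in>carrier T. \<forall>b2\<in>carrier T. b1 \<preceq>\<^bsub>T\<^esub> b2 \<longrightarrow> \<phi> a b1 \<preceq>\<^bsub>P\<^esub> \<phi> a b2) \<and>
     (\<forall>a b s t. increasing S a \<longrightarrow> increasing T b \<longrightarrow> is_sup S (range a) s \<longrightarrow> is_sup T (range b) t \<longrightarrow>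
        is_sup P (range (\<lambda>k. \<phi> (a k) (b k))) (\<phi> s t)) \<and>
     (\<forall>a' a b' b. a' \<lless>\<^bsub>S\<^esub> a \<longrightarrow> b' \<lless>\<^bsub>T\<^esub> b \<longrightarrow> \<phi> a' b' \<lless>\<^bsub>P\<^esub> \<phi> a b)"


section \<open>Tensor products\<close>

text \<open>The tensor product is constructed as the completion of the algebraic tensor product.
  A multiset over \<open>S \<times> T\<close> stands for a formal sum of elementary tensors, and \<open>tensor_le\<close> is the least
  preorder on formal sums that is compatible with addition and makes elementary tensors biadditive
  and monotone in each variable. The elements of \<open>cu_tensor S T\<close> are the countably generated rounded
  ideals for the relation \<open>tensor_below\<close>. The universal property is established in
  \<open>cu_semigroup_cu_tensor\<close>, \<open>cu_bimorphism_pure_tensor\<close>, \<open>cu_tensor_universal\<close> and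
  \<open>cu_tensor_morphism_le_iff\<close> below.\<close>

inductive tensor_le :: "('a, 'm) cu_scheme \<Rightarrow> ('b, 'n) cu_scheme \<Rightarrow>
    ('a \<times> 'b) multiset \<Rightarrow> ('a \<times> 'b) multiset \<Rightarrow> bool" for S T where
  refl: "set_mset x \<subseteq> carrier S \<times> carrier T \<Longrightarrow> tensor_le S T x x"
| trans: "\<lbrakk>tensor_le S T x y; tensor_le S T y z\<rbrakk> \<Longrightarrow> tensor_le S T x z"
| add: "\<lbrakk>tensor_le S T x y; set_mset z \<subseteq> carrier S \<times> carrier T\<rbrakk> \<Longrightarrow> tensor_le S T (x + z) (y + z)"
| mono: "\<lbrakk>a' \<in> carrier S; a \<in> carrier S; b' \<in> carrier T; b \<in> carrier T; a' \<preceq>\<^bsub>S\<^esub> a; b' \<preceq>\<^bsub>T\<^esub> b\<rbrakk>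
    \<Longrightarrow> tensor_le S T {#(a', b')#} {#(a, b)#}"
| split_left: "\<lbrakk>a1 \<in> carrier S; a2 \<in> carrier S; b \<in> carrier T\<rbrakk>
    \<Longrightarrow> tensor_le S T {#(a1 \<oplus>\<^bsub>S\<^esub> a2, b)#} {#(a1, b), (a2, b)#}"
| join_left: "\<lbrakk>a1 \<in> carrier S; a2 \<in> carrier S; b \<in> carrier T\<rbrakk>
    \<Longrightarrow> tensor_le S T {#(a1, b), (a2, b)#} {#(a1 \<oplus>\<^bsub>S\<^esub> a2, b)#}"
| split_right: "\<lbrakk>a \<in> carrier S; b1 \<in> carrier T; b2 \<in> carrier T\<rbrakk>
    \<Longrightarrow> tensor_le S T {#(a, b1 \<oplus>\<^bsub>T\<^esub> b2)#} {#(a, b1), (a, b2)#}"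
| join_right: "\<lbrakk>a \<in> carrier S; b1 \<in> carrier T; b2 \<in> carrier T\<rbrakk>
    \<Longrightarrow> tensor_le S T {#(a, b1), (a, b2)#} {#(a, b1 \<oplus>\<^bsub>T\<^esub> b2)#}"
| zero_left: "b \<in> carrier T \<Longrightarrow> tensor_le S T {#(\<zero>\<^bsub>S\<^esub>, b)#} {#}"
| zero_right: "a \<in> carrier S \<Longrightarrow> tensor_le S T {#(a, \<zero>\<^bsub>T\<^esub>)#} {#}"
| empty: "\<lbrakk>a \<in> carrier S; b \<in> carrier T\<rbrakk> \<Longrightarrow> tensor_le S T {#} {#(a, b)#}"

definition tensor_below :: "('a, 'm) cu_scheme \<Rightarrow> ('b, 'n) cu_scheme \<Rightarrow>
    ('a \<times> 'b) multiset \<Rightarrow> ('a \<times> 'b) multiset \<Rightarrow> bool" where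
  "tensor_below S T x y \<longleftrightarrow>
     (\<exists>x'. tensor_le S T x x' \<and> rel_mset (rel_prod (way_below S) (way_below T)) x' y)"

definition cu_tensor :: "('a, 'm) cu_scheme \<Rightarrow> ('b, 'n) cu_scheme \<Rightarrow> ('a \<times> 'b) multiset set cu" where
  "cu_tensor S T =
     \<lparr>carrier = {I. \<exists>c :: nat \<Rightarrow> ('a \<times> 'b) multiset.
                 (\<forall>n. tensor_below S T (c n) (c (Suc n))) \<and> I = {z. \<exists>n. tensor_below S T z (c n)}},
      mult = undefined, one = undefined,
      zero = {z. tensor_below S T z {#}},
      add = (\<lambda>I J. {z. \<exists>x\<in>I. \<exists>y\<in>J. tensor_below S T z (x + y)}),
      leq = (\<subseteq>)\<rparr>"

definition pure_tensor :: "('a, 'm) cu_scheme \<Rightarrow> ('b, 'n) cu_scheme \<Rightarrow> 'a \<Rightarrow> 'b \<Rightarrow>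
    ('a \<times> 'b) multiset set" where
  "pure_tensor S T a b = {z. tensor_below S T z {#(a, b)#}}"

definition tensor_lift :: "('a, 'm) cu_scheme \<Rightarrow> ('b, 'n) cu_scheme \<Rightarrow> ('c, 'k) cu_scheme \<Rightarrow>
    ('a \<Rightarrow> 'b \<Rightarrow> 'c) \<Rightarrow> ('a \<times> 'b) multiset set \<Rightarrow> 'c" where
  "tensor_lift S T P \<phi> = (THE \<alpha>. \<alpha> \<in> extensional (carrier (cu_tensor S T)) \<and>
     cu_morphism (cu_tensor S T) P \<alpha> \<and>
     (\<forall>a\<in>carrier S. \<forall>b\<in>carrier T. \<alpha> (pure_tensor S T a b) = \<phi> a b))"


section \<open>Paths, the internal hom, and evaluation\<close>

definition unit_rats :: "rat set" where
  "unit_rats = {0<..<1}"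

definition morph_below :: "('a, 'm) cu_scheme \<Rightarrow> ('b, 'n) cu_scheme \<Rightarrow>
    ('a \<Rightarrow> 'b) \<Rightarrow> ('a \<Rightarrow> 'b) \<Rightarrow> bool" where
  "morph_below S T \<phi> \<psi> \<longleftrightarrow> (\<forall>a' a. a' \<lless>\<^bsub>S\<^esub> a \<longrightarrow> \<phi> a' \<lless>\<^bsub>T\<^esub> \<psi> a)"

definition paths :: "('a, 'm) cu_scheme \<Rightarrow> ('b, 'n) cu_scheme \<Rightarrow> (rat \<Rightarrow> 'a \<Rightarrow> 'b) set" where
  "paths S T = {f. (\<forall>l\<in>unit_rats. gen_cu_morphism S T (f l)) \<and>
     (\<forall>l'\<in>unit_rats. \<forall>l\<in>unit_rats. l' < l \<longrightarrow> morph_below S T (f l') (f l))}"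

definition path_le :: "('a, 'm) cu_scheme \<Rightarrow> ('b, 'n) cu_scheme \<Rightarrow>
    (rat \<Rightarrow> 'a \<Rightarrow> 'b) \<Rightarrow> (rat \<Rightarrow> 'a \<Rightarrow> 'b) \<Rightarrow> bool" where
  "path_le S T f g \<longleftrightarrow> (\<forall>l\<in>unit_rats. \<exists>m\<in>unit_rats. morph_below S T (f l) (g m))"

text \<open>Values of a path outside \<open>unit_rats\<close> or outside \<open>carrier S\<close> do not matter for \<open>path_le\<close>,
  so paths that differ only there are identified in the quotient. The operations below are compatible
  with the quotient by \<open>cu_hom_leq\<close>, \<open>cu_hom_add\<close> and \<open>endpoint_path_class\<close>.\<close>

definition path_rel :: "('a, 'm) cu_scheme \<Rightarrow> ('b, 'n) cu_scheme \<Rightarrow>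
    ((rat \<Rightarrow> 'a \<Rightarrow> 'b) \<times> (rat \<Rightarrow> 'a \<Rightarrow> 'b)) set" where
  "path_rel S T = {(f, g). f \<in> paths S T \<and> g \<in> paths S T \<and> path_le S T f g \<and> path_le S T g f}"

definition cu_hom :: "('a, 'm) cu_scheme \<Rightarrow> ('b, 'n) cu_scheme \<Rightarrow> (rat \<Rightarrow> 'a \<Rightarrow> 'b) set cu" where
  "cu_hom S T =
     \<lparr>carrier = paths S T // path_rel S T,
      mult = undefined, one = undefined,
      zero = path_rel S T `` {\<lambda>l a. \<zero>\<^bsub>T\<^esub>},
      add = (\<lambda>F G. \<Union>f\<in>F. \<Union>g\<in>G. path_rel S T `` {\<lambda>l a. f l a \<oplus>\<^bsub>T\<^esub> g l a}),
      leq = (\<lambda>F G. \<exists>f\<in>F. \<exists>g\<in>G. path_le S T f g)\<rparr>"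

definition endpoint :: "('a, 'm) cu_scheme \<Rightarrow> ('b, 'n) cu_scheme \<Rightarrow>
    (rat \<Rightarrow> 'a \<Rightarrow> 'b) set \<Rightarrow> 'a \<Rightarrow> 'b" where
  "endpoint S T F a = (THE s. \<forall>f\<in>F. is_sup T ((\<lambda>l. f l a) ` unit_rats) s)"

definition evaluation :: "('a, 'm) cu_scheme \<Rightarrow> ('b, 'n) cu_scheme \<Rightarrow>
    ((rat \<Rightarrow> 'a \<Rightarrow> 'b) set \<times> 'a) multiset set \<Rightarrow> 'b" where
  "evaluation S T = tensor_lift (cu_hom S T) S T (endpoint S T)"


section \<open>Cu-semirings\<close>

locale cu_semiring = cu_semigroup R + monoid R for R (structure) +
  assumes mult_bimorphism: "cu_bimorphism R R R (\<otimes>)"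

definition mult_map :: "('a, 'm) cu_scheme \<Rightarrow> ('a \<times> 'a) multiset set \<Rightarrow> 'a" where
  "mult_map R = tensor_lift R R R (mult R)"

definition solid :: "('a, 'm) cu_scheme \<Rightarrow> bool" where
  "solid R \<longleftrightarrow> cu_semiring R \<and> cu_iso (cu_tensor R R) R (mult_map R)"


section \<open>The universal property of the tensor product\<close>

subsection \<open>Elementary facts\<close>

lemma is_sup_unique:
  assumes "positively_ordered_semigroup S" "is_sup S A s" "is_sup S A t"
  shows "s = t"
proof -
  interpret positively_ordered_semigroup S by fact
  show ?thesis using assms(2,3) unfolding is_sup_def by (intro le_antisym) auto
qed

lemma way_belowD: "a \<lless>\<^bsub>S\<^esub> b \<Longrightarrow> a \<in> carrier S \<and> b \<in> carrier S"
  by (simp add: way_below_def)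

lemma is_sup_carrier: "is_sup S A s \<Longrightarrow> s \<in> carrier S"
  by (simp add: is_sup_def)

context cu_semigroup
begin

lemma posgp: "positively_ordered_semigroup S"
  by (rule positively_ordered_semigroup_axioms)

lemma way_below_imp_le: assumes "a \<lless> b" shows "a \<preceq> b"
proof -
  have b: "b \<in> carrier S" using assms by (simp add: way_below_def)
  have "increasing S (\<lambda>_. b)" "is_sup S (range (\<lambda>_::nat. b)) b"
    using b by (auto simp: increasing_def is_sup_def)
  then show ?thesis using assms b unfolding way_below_def by blast
qed

lemma le_way_below:
  assumes "a \<in> carrier S" "a \<preceq> b" "b \<lless> c" shows "a \<lless> c"
  unfolding way_below_def
proof (intro conjI allI impI)
  show "a \<in> carrier S" "c \<in> carrier S" using assms by (auto simp: way_below_def)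
  fix d s assume d: "increasing S d" "is_sup S (range d) s" "c \<preceq> s"
  then obtain k where k: "b \<preceq> d k" using assms(3) unfolding way_below_def by blast
  have "b \<in> carrier S" "d k \<in> carrier S" using assms d by (auto simp: way_below_def increasing_def)
  with k assms show "\<exists>k. a \<preceq> d k" by (blast intro: le_trans)
qed

lemma way_below_le:
  assumes "c \<in> carrier S" "a \<lless> b" "b \<preceq> c" shows "a \<lless> c"
  unfolding way_below_def
proof (intro conjI allI impI)
  show "a \<in> carrier S" "c \<in> carrier S" using assms by (auto simp: way_below_def)
  fix d s assume d: "increasing S d" "is_sup S (range d) s" "c \<preceq> s"
  have "b \<preceq> s"
    using assms d by (intro le_trans[of b c s]) (auto simp: way_below_def is_sup_def)
  with d assms show "\<exists>k. a \<preceq> d k" unfolding way_below_def by blast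
qed

lemma increasing_le: 
  assumes "increasing S c" "n \<le> m" shows "c n \<preceq> c m"
  using assms(2)
proof (induction m rule: dec_induct)
  case base
  then show ?case using assms(1) by (auto simp: increasing_def)
next
  case (step m)
  then show ?case using assms(1) by (meson increasing_def le_trans)
qed

lemma way_below_increasing: "\<forall>n. c n \<lless> c (Suc n) \<Longrightarrow> increasing S c"
  unfolding increasing_def by (auto simp: way_below_imp_le dest: way_belowD)

lemma way_below_interpolate:
  assumes "a \<lless> b" obtains c where "a \<lless> c" "c \<lless> b"
proof -
  have b: "b \<in> carrier S" "a \<in> carrier S" using assms by (auto dest: way_belowD)
  obtain c where c: "\<And>n. c n \<lless> c (Suc n)" "is_sup S (range c) b" using O2[OF b(1)] by blast
  have "increasing S c" using c(1) by (auto intro: way_below_increasing)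
  then obtain k where k: "a \<preceq> c k" using assms c(2) b unfolding way_below_def by blast
  have "a \<lless> c (Suc k)" using le_way_below[OF b(2) k c(1)] .
  moreover have "c (Suc (Suc k)) \<preceq> b" using c(2) by (auto simp: is_sup_def)
  then have "c (Suc k) \<lless> b" using way_below_le[OF b(1) c(1)] by blast
  ultimately show ?thesis using that by blast
qed

lemma way_below_directed:
  assumes "a \<lless> b" "a' \<lless> b" obtains c where "a \<lless> c" "a' \<lless> c" "c \<lless> b"
proof -
  have b: "b \<in> carrier S" "a \<in> carrier S" "a' \<in> carrier S" using assms by (auto dest: way_belowD)
  obtain c where c: "\<And>n. c n \<lless> c (Suc n)" "is_sup S (range c) b" using O2[OF b(1)] by blast
  have inc: "increasing S c" using c(1) by (auto intro: way_below_increasing)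
  then obtain k k' where k: "a \<preceq> c k" "a' \<preceq> c k'"
    using assms c(2) b unfolding way_below_def by blast
  let ?m = "max k k'"
  have cc: "\<And>n. c n \<in> carrier S" using inc by (auto simp: increasing_def)
  have "a \<preceq> c ?m" "a' \<preceq> c ?m"
    using k increasing_le[OF inc, of k ?m] increasing_le[OF inc, of k' ?m] b cc
    by (meson le_trans max.cobounded1 max.cobounded2)+
  then have "a \<lless> c (Suc ?m)" "a' \<lless> c (Suc ?m)" using b c(1) le_way_below by blast+
  moreover have "c (Suc (Suc ?m)) \<preceq> b" using c(2) by (auto simp: is_sup_def)
  then have "c (Suc ?m) \<lless> b" using way_below_le[OF b(1) c(1)] by blast
  ultimately show ?thesis using that by blast
qed

lemma add_mono:
  assumes "a \<in> carrier S" "a' \<in> carrier S" "b \<in> carrier S" "b' \<in> carrier S" "a \<preceq> a'" "b \<preceq> b'"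
  shows "a \<oplus> b \<preceq> a' \<oplus> b'"
proof -
  have "a \<oplus> b \<preceq> a' \<oplus> b" using assms by (intro add_right_mono)
  moreover have "a' \<oplus> b \<preceq> a' \<oplus> b'"
    using add_right_mono[of b b' a'] assms by (simp add: a_comm)
  ultimately show ?thesis using assms le_trans[of "a \<oplus> b" "a' \<oplus> b" "a' \<oplus> b'"] by simp
qed

lemma zero_way_below [simp]: "a \<in> carrier S \<Longrightarrow> \<zero> \<lless> a"
  unfolding way_below_def increasing_def by auto

lemma way_below_add:
  assumes "c \<lless> a \<oplus> b" "a \<in> carrier S" "b \<in> carrier S"
  obtains a' b' where "a' \<lless> a" "b' \<lless> b" "c \<preceq> a' \<oplus> b'"
proof -
  obtain x where x: "\<And>n. x n \<lless> x (Suc n)" "is_sup S (range x) a" using O2[OF assms(2)] by blast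
  obtain y where y: "\<And>n. y n \<lless> y (Suc n)" "is_sup S (range y) b" using O2[OF assms(3)] by blast
  have incx: "increasing S x" "increasing S y" using x(1) y(1) by (auto intro: way_below_increasing)
  have xy: "is_sup S (range (\<lambda>n. x n \<oplus> y n)) (a \<oplus> b)" by (rule O4) fact+
  have "increasing S (\<lambda>n. x n \<oplus> y n)"
    using incx unfolding increasing_def by (auto intro: add_mono)
  then obtain k where "c \<preceq> x k \<oplus> y k"
    using assms(1) xy le_refl[of "a \<oplus> b"] assms unfolding way_below_def by blast
  moreover have "x k \<lless> a" "y k \<lless> b"
    using way_below_le[OF assms(2) x(1)] way_below_le[OF assms(3) y(1)] x(2) y(2)
    by (auto simp: is_sup_def)
  ultimately show ?thesis using that by blast
qed

lemma is_sup_below: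
  assumes "\<forall>n. c n \<lless> c (Suc n)" "is_sup S (range c) a"
  shows "c n \<lless> a"
  using assms way_below_le[of a "c n" "c (Suc n)"] by (auto simp: is_sup_def)

end

locale cu_pair = S: cu_semigroup S + T: cu_semigroup T
  for S :: "('a, 'm) cu_scheme" and T :: "('b, 'n) cu_scheme"
begin

abbreviation C where "C \<equiv> carrier S \<times> carrier T"
abbreviation tle (infix \<open>\<lesssim>\<close> 50) where "x \<lesssim> y \<equiv> tensor_le S T x y"
abbreviation twb (infix \<open>\<prec>\<close> 50) where "x \<prec> y \<equiv> tensor_below S T x y"
abbreviation mwb (infix \<open>\<prec>\<^sub>0\<close> 50) where
  "x \<prec>\<^sub>0 y \<equiv> rel_mset (rel_prod (way_below S) (way_below T)) x y"

lemma tle_carrier: "x \<lesssim> y \<Longrightarrow> set_mset x \<subseteq> C \<and> set_mset y \<subseteq> C"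
  by (induction rule: tensor_le.induct) (auto)

lemma tle_trans: "x \<lesssim> y \<Longrightarrow> y \<lesssim> z \<Longrightarrow> x \<lesssim> z"
  by (rule tensor_le.trans)

lemma tle_add: assumes "x \<lesssim> y" "x' \<lesssim> y'" shows "x + x' \<lesssim> y + y'"
proof -
  have "x + x' \<lesssim> y + x'" using assms tle_carrier by (intro tensor_le.add) auto
  moreover have "x' + y \<lesssim> y' + y" using assms tle_carrier by (intro tensor_le.add) auto
  ultimately show ?thesis by (metis tle_trans add.commute)
qed

lemma mwb_induct [consumes 1, case_names empty add]:
  assumes "x \<prec>\<^sub>0 y" "P {#} {#}"
    and "\<And>a' a b' b M N. \<lbrakk>a' \<lless>\<^bsub>S\<^esub> a; b' \<lless>\<^bsub>T\<^esub> b; M \<prec>\<^sub>0 N; P M N\<rbrakk>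
           \<Longrightarrow> P (add_mset (a', b') M) (add_mset (a, b) N)"
  shows "P x y"
  using assms(1)
proof (induction y arbitrary: x rule: multiset_induct)
  case empty
  have "x = {#}" using empty.prems by simp
  then show ?case using assms(2) by simp
next
  case (add p N)
  from msed_rel_invR[OF add.prems] obtain M q where
    "x = add_mset q M" "rel_prod (way_below S) (way_below T) q p" "M \<prec>\<^sub>0 N" by blast
  then show ?case using add.IH[of M] assms(3)[of "fst q" "fst p" "snd q" "snd p" M N]
    by (cases p; cases q) auto
qed

lemma mwb_carrier: "x \<prec>\<^sub>0 y \<Longrightarrow> set_mset x \<subseteq> C \<and> set_mset y \<subseteq> C"
  by (induction rule: mwb_induct) (auto dest: way_belowD)

lemma mwb_add: "x \<prec>\<^sub>0 y \<Longrightarrow> x' \<prec>\<^sub>0 y' \<Longrightarrow> x + x' \<prec>\<^sub>0 y + y'"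
  by (induction rule: mwb_induct) (auto intro: rel_mset_Plus)

lemma mwb_single [simp]: "{#(a', b')#} \<prec>\<^sub>0 {#(a, b)#} \<longleftrightarrow> a' \<lless>\<^bsub>S\<^esub> a \<and> b' \<lless>\<^bsub>T\<^esub> b"
proof
  assume "{#(a', b')#} \<prec>\<^sub>0 {#(a, b)#}"
  then show "a' \<lless>\<^bsub>S\<^esub> a \<and> b' \<lless>\<^bsub>T\<^esub> b" by (auto dest!: msed_rel_invR)
next
  assume "a' \<lless>\<^bsub>S\<^esub> a \<and> b' \<lless>\<^bsub>T\<^esub> b"
  then show "{#(a', b')#} \<prec>\<^sub>0 {#(a, b)#}" by (auto intro!: rel_mset_Plus rel_mset_Zero)
qed

lemma mwb_splitR: "x \<prec>\<^sub>0 y + z \<Longrightarrow> \<exists>x1 x2. x = x1 + x2 \<and> x1 \<prec>\<^sub>0 y \<and> x2 \<prec>\<^sub>0 z"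
proof (induction y arbitrary: x rule: multiset_induct)
  case empty
  then show ?case by (auto intro: exI[of _ "{#}"] simp: rel_mset_Zero)
next
  case (add p y)
  then have "x \<prec>\<^sub>0 add_mset p (y + z)" by simp
  from msed_rel_invR[OF this] obtain x' q where
    q: "x = add_mset q x'" "rel_prod (way_below S) (way_below T) q p" "x' \<prec>\<^sub>0 y + z" by blast
  from add.IH[OF q(3)] obtain x1 x2 where x: "x' = x1 + x2" "x1 \<prec>\<^sub>0 y" "x2 \<prec>\<^sub>0 z" by blast
  show ?case
    by (rule exI[of _ "add_mset q x1"], rule exI[of _ x2])
      (use x q in \<open>auto intro: rel_mset_Plus\<close>)
qed

lemma mwb_single_invR: 
  assumes "x \<prec>\<^sub>0 {#(a, b)#}"
  obtains a' b' where "x = {#(a', b')#}" "a' \<lless>\<^bsub>S\<^esub> a" "b' \<lless>\<^bsub>T\<^esub> b"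
  using assms by (auto dest!: msed_rel_invR)

lemma mwb_empty_invR [simp]: "x \<prec>\<^sub>0 {#} \<longleftrightarrow> x = {#}"
  using rel_mset_size by (auto simp: rel_mset_Zero)

lemma mwb_imp_tle: "x \<prec>\<^sub>0 y \<Longrightarrow> x \<lesssim> y"
proof (induction rule: mwb_induct)
  case empty
  then show ?case by (auto intro: tensor_le.refl)
next
  case (add a' a b' b M N)
  then have "{#(a', b')#} \<lesssim> {#(a, b)#}"
    by (auto intro!: tensor_le.mono S.way_below_imp_le T.way_below_imp_le dest: way_belowD)
  from tle_add[OF this add.IH] show ?case by simp
qed

lemma twb_imp_tle: "x \<prec> y \<Longrightarrow> x \<lesssim> y"
  unfolding tensor_below_def using mwb_imp_tle tle_trans by blast

lemma mwb_imp_twb: "x \<prec>\<^sub>0 y \<Longrightarrow> x \<prec> y"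
  unfolding tensor_below_def using mwb_carrier tensor_le.refl by metis

lemma twb_carrier: "x \<prec> y \<Longrightarrow> set_mset x \<subseteq> C \<and> set_mset y \<subseteq> C"
  using twb_imp_tle tle_carrier by blast

lemma tle_twb: "x \<lesssim> y \<Longrightarrow> y \<prec> z \<Longrightarrow> x \<prec> z"
  unfolding tensor_below_def using tle_trans by blast

lemma tle_empty: "set_mset x \<subseteq> C \<Longrightarrow> {#} \<lesssim> x"
proof (induction x)
  case empty
  then show ?case by (auto intro: tensor_le.refl)
next
  case (add p x)
  obtain a b where "p = (a, b)" by force
  then have "{#} \<lesssim> {#p#}" using add by (auto intro: tensor_le.empty)
  from tle_add[OF this add.IH] add.prems show ?case by simp
qed

lemma twb_add: "x \<prec> y \<Longrightarrow> x' \<prec> y' \<Longrightarrow> x + x' \<prec> y + y'"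
  unfolding tensor_below_def using tle_add mwb_add by blast

lemma mwb_tle: "y \<lesssim> z \<Longrightarrow> x \<prec>\<^sub>0 y \<Longrightarrow> \<exists>x'. x \<lesssim> x' \<and> x' \<prec>\<^sub>0 z"
proof (induction arbitrary: x rule: tensor_le.induct)
  case (refl y)
  then show ?case using mwb_carrier tensor_le.refl by blast
next
  case (trans y z w)
  then show ?case by (meson tle_trans)
next
  case (add y z w)
  from mwb_splitR[OF add.prems] obtain x1 x2 where x: "x = x1 + x2" "x1 \<prec>\<^sub>0 y" "x2 \<prec>\<^sub>0 w" by blast
  from add.IH[OF x(2)] obtain x' where x': "x1 \<lesssim> x'" "x' \<prec>\<^sub>0 z" by blast
  have "x2 \<lesssim> x2" using x(3) mwb_carrier tensor_le.refl by blast
  then show ?case using x x' tle_add mwb_add by blast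
next
  case (mono a' a b' b)
  from mono.prems obtain p q where x: "x = {#(p, q)#}" "p \<lless>\<^bsub>S\<^esub> a'" "q \<lless>\<^bsub>T\<^esub> b'"
    by (rule mwb_single_invR)
  have "p \<lless>\<^bsub>S\<^esub> a" "q \<lless>\<^bsub>T\<^esub> b" using x mono by (auto intro: S.way_below_le T.way_below_le)
  then have "x \<prec>\<^sub>0 {#(a, b)#}" using x by simp
  then show ?case using mwb_carrier tensor_le.refl by blast
next
  case (split_left a1 a2 b)
  from split_left.prems obtain p q where x: "x = {#(p, q)#}" "p \<lless>\<^bsub>S\<^esub> a1 \<oplus>\<^bsub>S\<^esub> a2" "q \<lless>\<^bsub>T\<^esub> b"
    by (rule mwb_single_invR)
  obtain p1 p2 where p: "p1 \<lless>\<^bsub>S\<^esub> a1" "p2 \<lless>\<^bsub>S\<^esub> a2" "p \<preceq>\<^bsub>S\<^esub> p1 \<oplus>\<^bsub>S\<^esub> p2"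
    using S.way_below_add[OF x(2)] split_left by blast
  have c: "p \<in> carrier S" "p1 \<in> carrier S" "p2 \<in> carrier S" "q \<in> carrier T"
    using x p by (auto dest: way_belowD)
  have "x \<lesssim> {#(p1 \<oplus>\<^bsub>S\<^esub> p2, q)#}" unfolding x using c p by (intro tensor_le.mono) auto
  also have "{#(p1 \<oplus>\<^bsub>S\<^esub> p2, q)#} \<lesssim> {#(p1, q)#} + {#(p2, q)#}"
    using tensor_le.split_left[of p1 S p2 q T] c by (simp add: add_mset_commute)
  finally (tle_trans) have "x \<lesssim> {#(p1, q)#} + {#(p2, q)#}" .
  moreover have "{#(p1, q)#} + {#(p2, q)#} \<prec>\<^sub>0 {#(a1, b)#} + {#(a2, b)#}"
    using p x by (intro mwb_add) auto
  ultimately show ?case by (auto simp: add_mset_commute)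
next
  case (join_left a1 a2 b)
  from join_left.prems have "x \<prec>\<^sub>0 {#(a1, b)#} + {#(a2, b)#}" by (simp add: add_mset_commute)
  from mwb_splitR[OF this] obtain x1 x2 where
    x: "x = x1 + x2" "x1 \<prec>\<^sub>0 {#(a1, b)#}" "x2 \<prec>\<^sub>0 {#(a2, b)#}" by blast
  from x(2) obtain p1 q1 where 1: "x1 = {#(p1, q1)#}" "p1 \<lless>\<^bsub>S\<^esub> a1" "q1 \<lless>\<^bsub>T\<^esub> b"
    by (rule mwb_single_invR)
  from x(3) obtain p2 q2 where 2: "x2 = {#(p2, q2)#}" "p2 \<lless>\<^bsub>S\<^esub> a2" "q2 \<lless>\<^bsub>T\<^esub> b"
    by (rule mwb_single_invR)
  obtain q where q: "q1 \<lless>\<^bsub>T\<^esub> q" "q2 \<lless>\<^bsub>T\<^esub> q" "q \<lless>\<^bsub>T\<^esub> b"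
    using T.way_below_directed[OF 1(3) 2(3)] .
  have c: "p1 \<in> carrier S" "p2 \<in> carrier S" "q1 \<in> carrier T" "q2 \<in> carrier T" "q \<in> carrier T"
    using 1 2 q by (auto dest: way_belowD)
  have "x \<lesssim> {#(p1, q)#} + {#(p2, q)#}" unfolding x 1 2
    using c q by (intro tle_add tensor_le.mono T.way_below_imp_le) auto
  also have "{#(p1, q)#} + {#(p2, q)#} \<lesssim> {#(p1 \<oplus>\<^bsub>S\<^esub> p2, q)#}"
    using tensor_le.join_left[of p1 S p2 q T] c by (simp add: add_mset_commute)
  finally (tle_trans) have "x \<lesssim> {#(p1 \<oplus>\<^bsub>S\<^esub> p2, q)#}" .
  moreover have "{#(p1 \<oplus>\<^bsub>S\<^esub> p2, q)#} \<prec>\<^sub>0 {#(a1 \<oplus>\<^bsub>S\<^esub> a2, b)#}"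
    using 1 2 q by (simp add: S.O3)
  ultimately show ?case by blast
next
  case (split_right a b1 b2)
  from split_right.prems obtain p q where x: "x = {#(p, q)#}" "p \<lless>\<^bsub>S\<^esub> a" "q \<lless>\<^bsub>T\<^esub> b1 \<oplus>\<^bsub>T\<^esub> b2"
    by (rule mwb_single_invR)
  obtain q1 q2 where p: "q1 \<lless>\<^bsub>T\<^esub> b1" "q2 \<lless>\<^bsub>T\<^esub> b2" "q \<preceq>\<^bsub>T\<^esub> q1 \<oplus>\<^bsub>T\<^esub> q2"
    using T.way_below_add[OF x(3)] split_right by blast
  have c: "p \<in> carrier S" "q1 \<in> carrier T" "q2 \<in> carrier T" "q \<in> carrier T"
    using x p by (auto dest: way_belowD)
  have "x \<lesssim> {#(p, q1 \<oplus>\<^bsub>T\<^esub> q2)#}" unfolding x using c p by (intro tensor_le.mono) auto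
  also have "{#(p, q1 \<oplus>\<^bsub>T\<^esub> q2)#} \<lesssim> {#(p, q1)#} + {#(p, q2)#}"
    using tensor_le.split_right[of p S q1 T q2] c by (simp add: add_mset_commute)
  finally (tle_trans) have "x \<lesssim> {#(p, q1)#} + {#(p, q2)#}" .
  moreover have "{#(p, q1)#} + {#(p, q2)#} \<prec>\<^sub>0 {#(a, b1)#} + {#(a, b2)#}"
    using p x by (intro mwb_add) auto
  ultimately show ?case by (auto simp: add_mset_commute)
next
  case (join_right a b1 b2)
  from join_right.prems have "x \<prec>\<^sub>0 {#(a, b1)#} + {#(a, b2)#}" by (simp add: add_mset_commute)
  from mwb_splitR[OF this] obtain x1 x2 where
    x: "x = x1 + x2" "x1 \<prec>\<^sub>0 {#(a, b1)#}" "x2 \<prec>\<^sub>0 {#(a, b2)#}" by blast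
  from x(2) obtain p1 q1 where 1: "x1 = {#(p1, q1)#}" "p1 \<lless>\<^bsub>S\<^esub> a" "q1 \<lless>\<^bsub>T\<^esub> b1"
    by (rule mwb_single_invR)
  from x(3) obtain p2 q2 where 2: "x2 = {#(p2, q2)#}" "p2 \<lless>\<^bsub>S\<^esub> a" "q2 \<lless>\<^bsub>T\<^esub> b2"
    by (rule mwb_single_invR)
  obtain p where p: "p1 \<lless>\<^bsub>S\<^esub> p" "p2 \<lless>\<^bsub>S\<^esub> p" "p \<lless>\<^bsub>S\<^esub> a"
    using S.way_below_directed[OF 1(2) 2(2)] .
  have c: "p1 \<in> carrier S" "p2 \<in> carrier S" "q1 \<in> carrier T" "q2 \<in> carrier T" "p \<in> carrier S"
    using 1 2 p by (auto dest: way_belowD)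
  have "x \<lesssim> {#(p, q1)#} + {#(p, q2)#}" unfolding x 1 2
    using c p by (intro tle_add tensor_le.mono S.way_below_imp_le) auto
  also have "{#(p, q1)#} + {#(p, q2)#} \<lesssim> {#(p, q1 \<oplus>\<^bsub>T\<^esub> q2)#}"
    using tensor_le.join_right[of p S q1 T q2] c by (simp add: add_mset_commute)
  finally (tle_trans) have "x \<lesssim> {#(p, q1 \<oplus>\<^bsub>T\<^esub> q2)#}" .
  moreover have "{#(p, q1 \<oplus>\<^bsub>T\<^esub> q2)#} \<prec>\<^sub>0 {#(a, b1 \<oplus>\<^bsub>T\<^esub> b2)#}"
    using 1 2 p by (simp add: T.O3)
  ultimately show ?case by blast
next
  case (zero_left b)
  from zero_left.prems obtain p q where x: "x = {#(p, q)#}" "p \<lless>\<^bsub>S\<^esub> \<zero>\<^bsub>S\<^esub>" "q \<lless>\<^bsub>T\<^esub> b"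
    by (rule mwb_single_invR)
  have "p = \<zero>\<^bsub>S\<^esub>" using x(2) S.way_below_imp_le S.zero_le S.le_antisym way_belowD by metis
  then have "x \<lesssim> {#}" using x tensor_le.zero_left way_belowD by metis
  then show ?case by auto
next
  case (zero_right a)
  from zero_right.prems obtain p q where x: "x = {#(p, q)#}" "p \<lless>\<^bsub>S\<^esub> a" "q \<lless>\<^bsub>T\<^esub> \<zero>\<^bsub>T\<^esub>"
    by (rule mwb_single_invR)
  have "q = \<zero>\<^bsub>T\<^esub>" using x(3) T.way_below_imp_le T.zero_le T.le_antisym way_belowD by metis
  then have "x \<lesssim> {#}" using x tensor_le.zero_right way_belowD by metis
  then show ?case by auto
next
  case (empty a b)
  then have "x = {#}" by simp
  moreover have "{#} \<lesssim> {#(\<zero>\<^bsub>S\<^esub>, \<zero>\<^bsub>T\<^esub>)#}" by (intro tensor_le.empty) auto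
  moreover have "{#(\<zero>\<^bsub>S\<^esub>, \<zero>\<^bsub>T\<^esub>)#} \<prec>\<^sub>0 {#(a, b)#}" using empty by simp
  ultimately show ?case by blast
qed

lemma twb_tle: "x \<prec> y \<Longrightarrow> y \<lesssim> z \<Longrightarrow> x \<prec> z"
  unfolding tensor_below_def using mwb_tle tle_trans by meson

lemma twb_trans: "x \<prec> y \<Longrightarrow> y \<prec> z \<Longrightarrow> x \<prec> z"
  using twb_imp_tle tle_twb by blast

lemma twb_splitR: 
  assumes "z \<prec> x + y" obtains x' y' where "x' \<prec> x" "y' \<prec> y" "z \<lesssim> x' + y'"
proof -
  obtain w where w: "z \<lesssim> w" "w \<prec>\<^sub>0 x + y" using assms unfolding tensor_below_def by blast
  obtain x' y' where "w = x' + y'" "x' \<prec>\<^sub>0 x" "y' \<prec>\<^sub>0 y" using mwb_splitR[OF w(2)] by blast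
  then show ?thesis using that[of x' y'] w(1) mwb_imp_twb by blast
qed

lemma twb_empty [simp]: "z \<prec> {#} \<longleftrightarrow> z \<lesssim> {#}"
  unfolding tensor_below_def by simp

lemma twb_approx:
  assumes "set_mset x \<subseteq> C"
  shows "\<exists>c. (\<forall>n. c n \<prec> c (Suc n)) \<and> (\<forall>z. z \<prec> x \<longleftrightarrow> (\<exists>n. z \<prec> c n))"
proof -
  have "\<exists>c :: nat \<Rightarrow> _. (\<forall>n. c n \<prec>\<^sub>0 c (Suc n)) \<and> (\<forall>n. c n \<prec>\<^sub>0 x) \<and> (\<forall>z. z \<prec>\<^sub>0 x \<longrightarrow> (\<exists>n. z \<lesssim> c n))"
    using assms
  proof (induction x)
    case empty
    then show ?case by (intro exI[of _ "\<lambda>_. {#}"]) (auto intro: tensor_le.refl)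
  next
    case (add p x)
    then obtain c where c: "\<And>n. c n \<prec>\<^sub>0 c (Suc n)" "\<And>n. c n \<prec>\<^sub>0 x" "\<And>z. z \<prec>\<^sub>0 x \<Longrightarrow> \<exists>n. z \<lesssim> c n"
      by auto
    obtain a b where p: "p = (a, b)" "a \<in> carrier S" "b \<in> carrier T" using add by auto
    obtain u where u: "\<forall>n. u n \<lless>\<^bsub>S\<^esub> u (Suc n)" "is_sup S (range u) a" using S.O2 p by blast
    obtain v where v: "\<forall>n. v n \<lless>\<^bsub>T\<^esub> v (Suc n)" "is_sup T (range v) b" using T.O2 p by blast
    have uinc: "increasing S u" "increasing T v"
      using u v S.way_below_increasing T.way_below_increasing by auto
    let ?c = "\<lambda>n. {#(u n, v n)#} + c n"
    have cinc: "c n \<lesssim> c m" if "n \<le> m" for n m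
      using that
    proof (induction m rule: dec_induct)
      case base
      show ?case using c(2)[of n] mwb_carrier tensor_le.refl by blast
    next
      case (step m)
      then show ?case using c(1)[of m] mwb_imp_tle tle_trans by blast
    qed
    show ?case
    proof (intro exI[of _ ?c] conjI allI impI)
      show "?c n \<prec>\<^sub>0 ?c (Suc n)" for n using u v c by (intro mwb_add) auto
      have "{#(u n, v n)#} + c n \<prec>\<^sub>0 {#p#} + x" for n
        using S.is_sup_below[OF u] T.is_sup_below[OF v] c p by (intro mwb_add) auto
      then show "?c n \<prec>\<^sub>0 add_mset p x" for n by simp
      fix z assume "z \<prec>\<^sub>0 add_mset p x"
      then have "z \<prec>\<^sub>0 {#p#} + x" by simp
      from mwb_splitR[OF this] obtain z1 z2 where z: "z = z1 + z2" "z1 \<prec>\<^sub>0 {#(a, b)#}" "z2 \<prec>\<^sub>0 x"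
        using p by blast
      from z(2) obtain a' b' where 1: "z1 = {#(a', b')#}" "a' \<lless>\<^bsub>S\<^esub> a" "b' \<lless>\<^bsub>T\<^esub> b"
        by (rule mwb_single_invR)
      obtain k where k: "a' \<preceq>\<^bsub>S\<^esub> u k" using 1 u uinc p S.le_refl unfolding way_below_def by blast
      obtain l where l: "b' \<preceq>\<^bsub>T\<^esub> v l" using 1 v uinc p T.le_refl unfolding way_below_def by blast
      obtain m where m: "z2 \<lesssim> c m" using c(3)[OF z(3)] by blast
      define n where "n = max k (max l m)"
      have n: "k \<le> n" "l \<le> n" "m \<le> n" by (auto simp: n_def)
      have car: "\<And>n. u n \<in> carrier S" "\<And>n. v n \<in> carrier T" "a' \<in> carrier S" "b' \<in> carrier T"
        using uinc 1 by (auto simp: increasing_def dest: way_belowD)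
      have "a' \<preceq>\<^bsub>S\<^esub> u n" using S.le_trans[OF _ _ _ k S.increasing_le[OF uinc(1) n(1)]] car by blast
      moreover have "b' \<preceq>\<^bsub>T\<^esub> v n" using T.le_trans[OF _ _ _ l T.increasing_le[OF uinc(2) n(2)]] car by blast
      ultimately have "z1 \<lesssim> {#(u n, v n)#}" unfolding 1 using car by (intro tensor_le.mono) auto
      moreover have "z2 \<lesssim> c n" using m cinc[OF n(3)] tle_trans by blast
      ultimately show "\<exists>n. z \<lesssim> ?c n" unfolding z using tle_add by blast
    qed
  qed
  then obtain c where c: "\<And>n. c n \<prec>\<^sub>0 c (Suc n)" "\<And>n. c n \<prec>\<^sub>0 x" "\<And>z. z \<prec>\<^sub>0 x \<Longrightarrow> \<exists>n. z \<lesssim> c n"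
    by blast
  have "z \<prec> x \<longleftrightarrow> (\<exists>n. z \<prec> c n)" for z
  proof
    assume "z \<prec> x"
    then obtain x' where x': "z \<lesssim> x'" "x' \<prec>\<^sub>0 x" unfolding tensor_below_def by blast
    obtain n where "x' \<lesssim> c n" using c(3)[OF x'(2)] by blast
    then have "z \<prec> c (Suc n)" using x' c(1)[of n] tle_trans unfolding tensor_below_def by blast
    then show "\<exists>n. z \<prec> c n" by blast
  next
    assume "\<exists>n. z \<prec> c n"
    then show "z \<prec> x" using c(2) mwb_imp_twb twb_trans by blast
  qed
  then show ?thesis using c mwb_imp_twb by blast
qed

end


subsection \<open>The tensor product is a Cu-semigroup\<close>

lemma tensor_simps [simp]:
  "\<zero>\<^bsub>cu_tensor S T\<^esub> = {z. tensor_below S T z {#}}"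
  "I \<oplus>\<^bsub>cu_tensor S T\<^esub> J = {z. \<exists>x\<in>I. \<exists>y\<in>J. tensor_below S T z (x + y)}"
  "I \<preceq>\<^bsub>cu_tensor S T\<^esub> J \<longleftrightarrow> I \<subseteq> J"
  by (auto simp: cu_tensor_def)

context cu_pair
begin

abbreviation X where "X \<equiv> cu_tensor S T"
abbreviation dn where "dn x \<equiv> {z. z \<prec> x}"

lemma carrier_X:
  "carrier X = {I. \<exists>c :: nat \<Rightarrow> _. (\<forall>n. c n \<prec> c (Suc n)) \<and> I = {z. \<exists>n. z \<prec> c n}}"
  by (simp add: cu_tensor_def)

lemma twb_chain: "\<forall>n. c n \<prec> c (Suc n) \<Longrightarrow> n < m \<Longrightarrow> c n \<prec> c m"
  by (induction m) (auto simp: less_Suc_eq intro: twb_trans)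

lemma carrier_iff: "I \<in> carrier X \<longleftrightarrow>
   (\<forall>z1\<in>I. \<forall>z2\<in>I. \<exists>w\<in>I. z1 \<prec> w \<and> z2 \<prec> w) \<and> (\<forall>z w. z \<prec> w \<longrightarrow> w \<in> I \<longrightarrow> z \<in> I) \<and>
   (\<exists>e :: nat \<Rightarrow> _. range e \<subseteq> I \<and> (\<forall>z\<in>I. \<exists>n. z \<prec> e n))" (is "_ \<longleftrightarrow> ?R")
proof
  assume "I \<in> carrier X"
  then obtain c :: "nat \<Rightarrow> _" where c: "\<forall>n. c n \<prec> c (Suc n)" and I: "I = {z. \<exists>n. z \<prec> c n}"
    unfolding carrier_X by blast
  have "\<exists>w\<in>I. z1 \<prec> w \<and> z2 \<prec> w" if "z1 \<in> I" "z2 \<in> I" for z1 z2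
  proof -
    obtain n where n: "z1 \<prec> c n" using \<open>z1 \<in> I\<close> I by blast
    obtain m where m: "z2 \<prec> c m" using \<open>z2 \<in> I\<close> I by blast
    note nm = n m
    let ?k = "Suc (max n m)"
    have "c n \<prec> c ?k" "c m \<prec> c ?k" "c ?k \<in> I" using twb_chain[OF c] c I by auto
    with nm show ?thesis using twb_trans by blast
  qed
  moreover have "\<forall>z w. z \<prec> w \<longrightarrow> w \<in> I \<longrightarrow> z \<in> I" using I twb_trans by blast
  moreover have "range c \<subseteq> I \<and> (\<forall>z\<in>I. \<exists>n. z \<prec> c n)" using c I by blast
  ultimately show ?R by blast
next
  assume R: ?R
  then obtain e :: "nat \<Rightarrow> _" where e': "range e \<subseteq> I" "\<forall>z\<in>I. \<exists>n. z \<prec> e n" by blast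
  have e: "\<And>n. e n \<in> I" "\<And>z. z \<in> I \<Longrightarrow> \<exists>n. z \<prec> e n" using e' by auto
  have "\<exists>d. \<forall>n. (d n \<in> I) \<and> (d n \<prec> d (Suc n) \<and> e n \<prec> d (Suc n))"
  proof (rule dependent_nat_choice)
    show "\<exists>x. x \<in> I" using e(1) by blast
    fix x n assume "x \<in> I"
    then show "\<exists>y. y \<in> I \<and> x \<prec> y \<and> e n \<prec> y" using e(1)[of n] R by blast
  qed
  then obtain d where d: "\<And>n. d n \<in> I" "\<And>n. d n \<prec> d (Suc n)" "\<And>n. e n \<prec> d (Suc n)" by blast
  have "I = {z. \<exists>n. z \<prec> d n}"
  proof (intro equalityI subsetI)
    fix z assume "z \<in> I"
    then obtain n where "z \<prec> e n" using e by blast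
    then show "z \<in> {z. \<exists>n. z \<prec> d n}" using d(3)[of n] twb_trans by blast
  next
    fix z assume "z \<in> {z. \<exists>n. z \<prec> d n}"
    then show "z \<in> I" using R d(1) by blast
  qed
  then show "I \<in> carrier X" using d(2) unfolding carrier_X by blast
qed

lemma ideal_chain:
  assumes "I \<in> carrier X"
  obtains c :: "nat \<Rightarrow> _" where "\<forall>n. c n \<prec> c (Suc n)" "I = {z. \<exists>n. z \<prec> c n}" "\<And>n. c n \<in> I"
  using assms unfolding carrier_X by blast

lemma ideal_round: "I \<in> carrier X \<Longrightarrow> z \<in> I \<Longrightarrow> \<exists>w\<in>I. z \<prec> w"
  unfolding carrier_iff by blast

lemma ideal_directed: "I \<in> carrier X \<Longrightarrow> z1 \<in> I \<Longrightarrow> z2 \<in> I \<Longrightarrow> \<exists>w\<in>I. z1 \<prec> w \<and> z2 \<prec> w"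
  unfolding carrier_iff by blast

lemma ideal_down: "I \<in> carrier X \<Longrightarrow> z \<prec> w \<Longrightarrow> w \<in> I \<Longrightarrow> z \<in> I"
  unfolding carrier_iff by blast

lemma ideal_carrier: "I \<in> carrier X \<Longrightarrow> z \<in> I \<Longrightarrow> set_mset z \<subseteq> C"
  using ideal_round twb_carrier by blast

lemma ideal_empty: assumes "I \<in> carrier X" shows "{#} \<in> I"
proof -
  obtain e where "e \<in> I" using assms unfolding carrier_iff by blast
  moreover obtain w where "e \<prec> w" "w \<in> I" using ideal_round[OF assms calculation] by blast
  moreover have "{#} \<lesssim> e" using tle_empty ideal_carrier assms calculation by blast
  ultimately show ?thesis using tle_twb ideal_down[OF assms] by blast
qed

lemma dn_closed: "set_mset x \<subseteq> C \<Longrightarrow> dn x \<in> carrier X"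
  using twb_approx[of x] unfolding carrier_X by blast

lemma dn_subset: "I \<in> carrier X \<Longrightarrow> x \<in> I \<Longrightarrow> dn x \<subseteq> I"
  using ideal_down by blast

lemma ideal_add_closed:
  assumes I: "I \<in> carrier X" and J: "J \<in> carrier X"
  shows "I \<oplus>\<^bsub>X\<^esub> J \<in> carrier X"
  unfolding carrier_iff
proof (intro conjI ballI allI impI)
  fix z1 z2 assume "z1 \<in> I \<oplus>\<^bsub>X\<^esub> J" "z2 \<in> I \<oplus>\<^bsub>X\<^esub> J"
  then obtain x1 y1 x2 y2 where
    z: "x1 \<in> I" "x2 \<in> I" "y1 \<in> J" "y2 \<in> J" "z1 \<prec> x1 + y1" "z2 \<prec> x2 + y2" by auto
  obtain x where x: "x \<in> I" "x1 \<prec> x" "x2 \<prec> x" using ideal_directed[OF I z(1,2)] by blast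
  obtain y where y: "y \<in> J" "y1 \<prec> y" "y2 \<prec> y" using ideal_directed[OF J z(3,4)] by blast
  obtain x' y' where "x' \<in> I" "x \<prec> x'" "y' \<in> J" "y \<prec> y'"
    using ideal_round I J x y by meson
  then have "x + y \<in> I \<oplus>\<^bsub>X\<^esub> J" using twb_add unfolding tensor_simps by blast
  then show "\<exists>w\<in>I \<oplus>\<^bsub>X\<^esub> J. z1 \<prec> w \<and> z2 \<prec> w"
    using x y z twb_add twb_trans by meson
next
  fix z w assume "z \<prec> w" "w \<in> I \<oplus>\<^bsub>X\<^esub> J"
  then show "z \<in> I \<oplus>\<^bsub>X\<^esub> J" using twb_trans unfolding tensor_simps by blast
next
  obtain c :: "nat \<Rightarrow> _" where c: "\<forall>n. c n \<prec> c (Suc n)" "I = {z. \<exists>n. z \<prec> c n}" "\<And>n. c n \<in> I"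
    using ideal_chain[OF I] by blast
  obtain d :: "nat \<Rightarrow> _" where d: "\<forall>n. d n \<prec> d (Suc n)" "J = {z. \<exists>n. z \<prec> d n}" "\<And>n. d n \<in> J"
    using ideal_chain[OF J] by blast
  have "c n + d n \<in> I \<oplus>\<^bsub>X\<^esub> J" for n
    unfolding tensor_simps using c(1,3) d(1,3) twb_add by blast
  moreover have "\<exists>n. z \<prec> c n + d n" if "z \<in> I \<oplus>\<^bsub>X\<^esub> J" for z
  proof -
    obtain x y where xy: "x \<in> I" "y \<in> J" "z \<prec> x + y"
      using \<open>z \<in> I \<oplus>\<^bsub>X\<^esub> J\<close> unfolding tensor_simps by blast
    obtain n where n: "x \<prec> c n" using xy c(2) by blast
    obtain m where m: "y \<prec> d m" using xy d(2) by blast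
    let ?k = "Suc (max n m)"
    have "c n \<prec> c ?k" "d m \<prec> d ?k" using twb_chain[OF c(1)] twb_chain[OF d(1)] by auto
    then have "x + y \<prec> c ?k + d ?k" using n m twb_trans twb_add by meson
    then show ?thesis using xy(3) twb_trans by blast
  qed
  ultimately show "\<exists>e :: nat \<Rightarrow> _. range e \<subseteq> I \<oplus>\<^bsub>X\<^esub> J \<and> (\<forall>z\<in>I \<oplus>\<^bsub>X\<^esub> J. \<exists>n. z \<prec> e n)"
    by (intro exI[of _ "\<lambda>n. c n + d n"]) (simp del: tensor_simps add: image_subset_iff)
qed

lemma ideal_add3:
  assumes "I \<in> carrier X" "J \<in> carrier X" "K \<in> carrier X"
  shows "(I \<oplus>\<^bsub>X\<^esub> J) \<oplus>\<^bsub>X\<^esub> K = {z. \<exists>i\<in>I. \<exists>j\<in>J. \<exists>k\<in>K. z \<prec> i + j + k}"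
proof (intro equalityI subsetI)
  fix z assume "z \<in> (I \<oplus>\<^bsub>X\<^esub> J) \<oplus>\<^bsub>X\<^esub> K"
  then obtain u i j k where z: "i \<in> I" "j \<in> J" "k \<in> K" "u \<prec> i + j" "z \<prec> u + k" by auto
  have "k \<lesssim> k" by (rule tensor_le.refl[OF ideal_carrier[OF assms(3) z(3)]])
  then have "u + k \<lesssim> i + j + k" using z twb_imp_tle tle_add by blast
  then show "z \<in> {z. \<exists>i\<in>I. \<exists>j\<in>J. \<exists>k\<in>K. z \<prec> i + j + k}" using z twb_tle by blast
next
  fix z assume "z \<in> {z. \<exists>i\<in>I. \<exists>j\<in>J. \<exists>k\<in>K. z \<prec> i + j + k}"
  then obtain i j k where z: "i \<in> I" "j \<in> J" "k \<in> K" "z \<prec> i + j + k" by blast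
  obtain i' j' where "i' \<in> I" "i \<prec> i'" "j' \<in> J" "j \<prec> j'" using ideal_round assms z by meson
  then have "i + j \<in> I \<oplus>\<^bsub>X\<^esub> J" using twb_add unfolding tensor_simps by blast
  then show "z \<in> (I \<oplus>\<^bsub>X\<^esub> J) \<oplus>\<^bsub>X\<^esub> K" using z unfolding tensor_simps(2)[of S T _ K] by blast
qed

lemma ideal_add_commute: "I \<oplus>\<^bsub>X\<^esub> J = J \<oplus>\<^bsub>X\<^esub> I"
  by (auto simp: add.commute) (metis add.commute)+

lemma ideal_zero_add:
  assumes "I \<in> carrier X" shows "\<zero>\<^bsub>X\<^esub> \<oplus>\<^bsub>X\<^esub> I = I"
proof (intro equalityI subsetI)
  fix z assume "z \<in> \<zero>\<^bsub>X\<^esub> \<oplus>\<^bsub>X\<^esub> I"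
  then obtain u i where z: "u \<lesssim> {#}" "i \<in> I" "z \<prec> u + i" by auto
  have "i \<lesssim> i" by (rule tensor_le.refl[OF ideal_carrier[OF assms z(2)]])
  from tle_add[OF z(1) this] z(3) have "z \<prec> i" using twb_tle by simp
  then show "z \<in> I" using assms z ideal_down by blast
next
  fix z assume "z \<in> I"
  then obtain w where "w \<in> I" "z \<prec> {#} + w" using ideal_round[OF assms] by auto
  moreover have "{#} \<in> \<zero>\<^bsub>X\<^esub>" by (auto intro: tensor_le.refl)
  ultimately show "z \<in> \<zero>\<^bsub>X\<^esub> \<oplus>\<^bsub>X\<^esub> I" unfolding tensor_simps(2) by blast
qed

lemma abelian_monoid_X: "abelian_monoid X"
proof (rule abelian_monoidI)
  fix I J K assume "I \<in> carrier X" "J \<in> carrier X" "K \<in> carrier X"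
  note IJK = this
  have eq: "z \<prec> j + k + i \<longleftrightarrow> z \<prec> i + j + k" for z i j k by (simp add: ac_simps)
  have "I \<oplus>\<^bsub>X\<^esub> (J \<oplus>\<^bsub>X\<^esub> K) = (J \<oplus>\<^bsub>X\<^esub> K) \<oplus>\<^bsub>X\<^esub> I" by (rule ideal_add_commute)
  also have "\<dots> = {z. \<exists>j\<in>J. \<exists>k\<in>K. \<exists>i\<in>I. z \<prec> j + k + i}" using ideal_add3 IJK by blast
  also have "\<dots> = {z. \<exists>i\<in>I. \<exists>j\<in>J. \<exists>k\<in>K. z \<prec> i + j + k}"
    using eq by blast
  also have "\<dots> = (I \<oplus>\<^bsub>X\<^esub> J) \<oplus>\<^bsub>X\<^esub> K" using ideal_add3 IJK by blast
  finally show "(I \<oplus>\<^bsub>X\<^esub> J) \<oplus>\<^bsub>X\<^esub> K = I \<oplus>\<^bsub>X\<^esub> (J \<oplus>\<^bsub>X\<^esub> K)" by simp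
next
  show "\<zero>\<^bsub>X\<^esub> \<in> carrier X" using dn_closed[of "{#}"] by simp
qed (use ideal_add_closed ideal_add_commute ideal_zero_add in blast)+

lemma pos_X: "positively_ordered_semigroup X"
proof (intro positively_ordered_semigroup.intro positively_ordered_semigroup_axioms.intro abelian_monoid_X)
  fix I assume I: "I \<in> carrier X"
  show "\<zero>\<^bsub>X\<^esub> \<preceq>\<^bsub>X\<^esub> I"
    using I ideal_empty ideal_round tle_twb ideal_down by (auto, meson)
qed auto

lemma union_closed:
  assumes "increasing X I" shows "(\<Union>k. I k) \<in> carrier X"
proof -
  have I: "\<And>k. I k \<in> carrier X" and sub: "\<And>k. I k \<subseteq> I (Suc k)"
    using assms by (auto simp: increasing_def)
  have mono: "I n \<subseteq> I m" if "n \<le> m" for n m using sub that by (rule lift_Suc_mono_le)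
  have "\<forall>k. \<exists>e :: nat \<Rightarrow> _. range e \<subseteq> I k \<and> (\<forall>z\<in>I k. \<exists>n. z \<prec> e n)"
    using I unfolding carrier_iff by blast
  then obtain e :: "nat \<Rightarrow> nat \<Rightarrow> _"
    where e: "\<And>k. range (e k) \<subseteq> I k" "\<And>k z. z \<in> I k \<Longrightarrow> \<exists>n. z \<prec> e k n" by metis
  let ?e = "\<lambda>m. e (fst (prod_decode m)) (snd (prod_decode m))"
  have "range ?e \<subseteq> (\<Union>k. I k)" using e(1) by blast
  moreover have "\<exists>n. z \<prec> ?e n" if "z \<in> (\<Union>k. I k)" for z
  proof -
    obtain k where "z \<in> I k" using \<open>z \<in> (\<Union>k. I k)\<close> by blast
    from e(2)[OF this] obtain n where "z \<prec> e k n" by blast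
    then have "z \<prec> ?e (prod_encode (k, n))" by (simp add: prod_encode_inverse)
    then show ?thesis by blast
  qed
  ultimately have ex: "\<exists>e :: nat \<Rightarrow> _. range e \<subseteq> (\<Union>k. I k) \<and> (\<forall>z\<in>(\<Union>k. I k). \<exists>n. z \<prec> e n)"
    by blast
  show ?thesis
    unfolding carrier_iff
  proof (intro conjI ballI allI impI ex)
    fix z1 z2 assume "z1 \<in> (\<Union>k. I k)" "z2 \<in> (\<Union>k. I k)"
    then obtain n m where "z1 \<in> I n" "z2 \<in> I m" by blast
    then have "z1 \<in> I (max n m)" "z2 \<in> I (max n m)" using mono by (meson max.cobounded1 max.cobounded2 subsetD)+
    then show "\<exists>w\<in>\<Union>k. I k. z1 \<prec> w \<and> z2 \<prec> w" using ideal_directed[OF I] by blast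
  next
    fix z w assume "z \<prec> w" "w \<in> (\<Union>k. I k)"
    then show "z \<in> (\<Union>k. I k)" using ideal_down[OF I] by blast
  qed
qed

lemma is_sup_union: "increasing X I \<Longrightarrow> is_sup X (range I) (\<Union>k. I k)"
  using union_closed unfolding is_sup_def by auto

lemma is_sup_iff: "increasing X I \<Longrightarrow> is_sup X (range I) J \<longleftrightarrow> J = (\<Union>k. I k)"
  using is_sup_union is_sup_unique[OF pos_X] by blast

lemma increasing_dn:
  assumes "\<forall>n. c n \<prec> c (Suc n)" shows "increasing X (\<lambda>n. dn (c n))"
  using assms twb_carrier twb_trans unfolding increasing_def by (auto intro!: dn_closed)

lemma way_below_X: "I \<lless>\<^bsub>X\<^esub> J \<longleftrightarrow> I \<in> carrier X \<and> J \<in> carrier X \<and> (\<exists>z\<in>J. I \<subseteq> dn z)"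
proof (intro iffI conjI)
  assume IJ: "I \<lless>\<^bsub>X\<^esub> J"
  then show J: "I \<in> carrier X" "J \<in> carrier X" by (auto dest: way_belowD)
  obtain c :: "nat \<Rightarrow> _" where c: "\<forall>n. c n \<prec> c (Suc n)" "J = {z. \<exists>n. z \<prec> c n}" "\<And>n. c n \<in> J"
    using ideal_chain[OF J(2)] by blast
  have "is_sup X (range (\<lambda>n. dn (c n))) J"
    unfolding is_sup_iff[OF increasing_dn[OF c(1)]] c(2) by blast
  then obtain k where "I \<subseteq> dn (c k)"
    using IJ increasing_dn[OF c(1)] unfolding way_below_def by (auto, blast)
  then show "\<exists>z\<in>J. I \<subseteq> dn z" using c(3) by blast
next
  assume "I \<in> carrier X \<and> J \<in> carrier X \<and> (\<exists>z\<in>J. I \<subseteq> dn z)"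
  then obtain z where z: "I \<in> carrier X" "J \<in> carrier X" "z \<in> J" "I \<subseteq> dn z" by blast
  show "I \<lless>\<^bsub>X\<^esub> J"
    unfolding way_below_def
  proof (intro conjI allI impI z)
    fix K L assume K: "increasing X K" "is_sup X (range K) L" "J \<preceq>\<^bsub>X\<^esub> L"
    then obtain k where k: "z \<in> K k" using is_sup_iff z by auto
    have "K k \<in> carrier X" using K by (auto simp: increasing_def)
    from dn_subset[OF this k] show "\<exists>k. I \<preceq>\<^bsub>X\<^esub> K k" using z by auto
  qed
qed

lemma cu_X: "cu_semigroup X"
proof (intro cu_semigroup.intro cu_semigroup_axioms.intro pos_X)
  show "\<exists>s. is_sup X (range I) s" if "increasing X I" for I using that is_sup_union by blast
next
  fix J assume J: "J \<in> carrier X"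
  obtain c :: "nat \<Rightarrow> _" where c: "\<forall>n. c n \<prec> c (Suc n)" "J = {z. \<exists>n. z \<prec> c n}" "\<And>n. c n \<in> J"
    using ideal_chain[OF J] by blast
  have "is_sup X (range (\<lambda>n. dn (c n))) J"
    unfolding is_sup_iff[OF increasing_dn[OF c(1)]] c(2) by blast
  moreover have "dn (c n) \<lless>\<^bsub>X\<^esub> dn (c (Suc n))" for n
    using c(1) twb_carrier by (auto simp: way_below_X intro!: dn_closed)
  ultimately show "\<exists>c. (\<forall>n. c n \<lless>\<^bsub>X\<^esub> c (Suc n)) \<and> is_sup X (range c) J"
    by (intro exI[of _ "\<lambda>n. dn (c n)"]) simp
next
  fix I' I J' J assume "I' \<lless>\<^bsub>X\<^esub> I" "J' \<lless>\<^bsub>X\<^esub> J"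
  then obtain z w where z: "I' \<in> carrier X" "I \<in> carrier X" "J' \<in> carrier X" "J \<in> carrier X"
    "z \<in> I" "w \<in> J" "I' \<subseteq> dn z" "J' \<subseteq> dn w" unfolding way_below_X by blast
  obtain z' w' where "z' \<in> I" "z \<prec> z'" "w' \<in> J" "w \<prec> w'" using ideal_round z by meson
  then have "z + w \<in> I \<oplus>\<^bsub>X\<^esub> J" using twb_add unfolding tensor_simps by blast
  moreover have "I' \<oplus>\<^bsub>X\<^esub> J' \<subseteq> dn (z + w)"
    using z(7,8) twb_add twb_trans unfolding tensor_simps by blast
  ultimately show "I' \<oplus>\<^bsub>X\<^esub> J' \<lless>\<^bsub>X\<^esub> I \<oplus>\<^bsub>X\<^esub> J"
    unfolding way_below_X using ideal_add_closed z by blast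
next
  fix I J K L assume *: "increasing X I" "increasing X J" "is_sup X (range I) K" "is_sup X (range J) L"
  then have KL: "K = (\<Union>k. I k)" "L = (\<Union>k. J k)" by (auto simp: is_sup_iff)
  have c: "\<And>k. I k \<in> carrier X" "\<And>k. J k \<in> carrier X"
    and sub: "\<And>k. I k \<subseteq> I (Suc k)" "\<And>k. J k \<subseteq> J (Suc k)"
    using * by (auto simp: increasing_def)
  have mono: "I n \<subseteq> I m" "J n \<subseteq> J m" if "n \<le> m" for n m
    using lift_Suc_mono_le[of I n m, OF sub(1) that] lift_Suc_mono_le[of J n m, OF sub(2) that] by auto
  have "I n \<oplus>\<^bsub>X\<^esub> J n \<subseteq> I (Suc n) \<oplus>\<^bsub>X\<^esub> J (Suc n)" for n
    using sub unfolding tensor_simps by blast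
  then have inc: "increasing X (\<lambda>n. I n \<oplus>\<^bsub>X\<^esub> J n)"
    unfolding increasing_def using c ideal_add_closed tensor_simps(3) by blast
  have "K \<oplus>\<^bsub>X\<^esub> L = (\<Union>k. I k \<oplus>\<^bsub>X\<^esub> J k)"
  proof (intro equalityI subsetI)
    fix z assume "z \<in> K \<oplus>\<^bsub>X\<^esub> L"
    then obtain x y n m where z: "x \<in> I n" "y \<in> J m" "z \<prec> x + y" unfolding KL by auto
    then have "x \<in> I (max n m)" "y \<in> J (max n m)"
      using mono by (meson max.cobounded1 max.cobounded2 subsetD)+
    with z show "z \<in> (\<Union>k. I k \<oplus>\<^bsub>X\<^esub> J k)" by auto
  next
    fix z assume "z \<in> (\<Union>k. I k \<oplus>\<^bsub>X\<^esub> J k)"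
    then show "z \<in> K \<oplus>\<^bsub>X\<^esub> L" unfolding KL by auto
  qed
  then show "is_sup X (range (\<lambda>n. I n \<oplus>\<^bsub>X\<^esub> J n)) (K \<oplus>\<^bsub>X\<^esub> L)" using is_sup_iff[OF inc] by blast
qed

lemma dn_add:
  assumes "set_mset x \<subseteq> C" "set_mset y \<subseteq> C"
  shows "dn (x + y) = dn x \<oplus>\<^bsub>X\<^esub> dn y"
proof (intro equalityI subsetI)
  fix z assume "z \<in> dn (x + y)"
  then obtain x' y' where z: "x' \<prec> x" "y' \<prec> y" "z \<lesssim> x' + y'" using twb_splitR by blast
  obtain x'' y'' where "x'' \<in> dn x" "x' \<prec> x''" "y'' \<in> dn y" "y' \<prec> y''"
    using ideal_round[OF dn_closed[OF assms(1)]] ideal_round[OF dn_closed[OF assms(2)]] z by blast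
  moreover from this have "z \<prec> x'' + y''" using tle_twb[OF z(3)] twb_add by blast
  ultimately show "z \<in> dn x \<oplus>\<^bsub>X\<^esub> dn y" unfolding tensor_simps by blast
next
  fix z assume "z \<in> dn x \<oplus>\<^bsub>X\<^esub> dn y"
  then show "z \<in> dn (x + y)" using twb_add twb_trans unfolding tensor_simps by blast
qed

lemma dn_mono: "x \<lesssim> y \<Longrightarrow> dn x \<subseteq> dn y"
  using twb_tle by blast

lemma dn_eq: "x \<lesssim> y \<Longrightarrow> y \<lesssim> x \<Longrightarrow> dn x = dn y"
  using dn_mono by blast

lemma way_below_pure:
  assumes "a' \<lless>\<^bsub>S\<^esub> a" "b' \<lless>\<^bsub>T\<^esub> b" shows "dn {#(a', b')#} \<lless>\<^bsub>X\<^esub> dn {#(a, b)#}"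
proof -
  have "{#(a', b')#} \<prec> {#(a, b)#}" using assms by (intro mwb_imp_twb) simp
  moreover have "set_mset {#(a', b')#} \<subseteq> C" "set_mset {#(a, b)#} \<subseteq> C"
    using assms by (auto dest: way_belowD)
  ultimately show ?thesis unfolding way_below_X using dn_closed by blast
qed

lemma pure_bimorphism: "cu_bimorphism S T X (\<lambda>a b. dn {#(a, b)#})"
  unfolding cu_bimorphism_def
proof (intro conjI ballI allI impI)
  fix a b assume "a \<in> carrier S" "b \<in> carrier T"
  then show "dn {#(a, b)#} \<in> carrier X" by (intro dn_closed) auto
next
  fix a1 a2 b assume *: "a1 \<in> carrier S" "a2 \<in> carrier S" "b \<in> carrier T"
  have "dn {#(a1 \<oplus>\<^bsub>S\<^esub> a2, b)#} = dn ({#(a1, b)#} + {#(a2, b)#})"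
    using tensor_le.split_left[of a1 S a2 b T] tensor_le.join_left[of a1 S a2 b T] *
    by (intro dn_eq) (auto simp: add_mset_commute)
  then show "dn {#(a1 \<oplus>\<^bsub>S\<^esub> a2, b)#} = dn {#(a1, b)#} \<oplus>\<^bsub>X\<^esub> dn {#(a2, b)#}"
    using dn_add[of "{#(a1, b)#}" "{#(a2, b)#}"] * by simp
next
  fix a b1 b2 assume *: "a \<in> carrier S" "b1 \<in> carrier T" "b2 \<in> carrier T"
  have "dn {#(a, b1 \<oplus>\<^bsub>T\<^esub> b2)#} = dn ({#(a, b1)#} + {#(a, b2)#})"
    using tensor_le.split_right[of a S b1 T b2] tensor_le.join_right[of a S b1 T b2] *
    by (intro dn_eq) (auto simp: add_mset_commute)
  then show "dn {#(a, b1 \<oplus>\<^bsub>T\<^esub> b2)#} = dn {#(a, b1)#} \<oplus>\<^bsub>X\<^esub> dn {#(a, b2)#}"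
    using dn_add[of "{#(a, b1)#}" "{#(a, b2)#}"] * by simp
next
  fix b assume "b \<in> carrier T"
  then have "dn {#(\<zero>\<^bsub>S\<^esub>, b)#} = dn {#}" 
    by (intro dn_eq tensor_le.zero_left tensor_le.empty) auto
  then show "dn {#(\<zero>\<^bsub>S\<^esub>, b)#} = \<zero>\<^bsub>X\<^esub>" by simp
next
  fix a assume "a \<in> carrier S"
  then have "dn {#(a, \<zero>\<^bsub>T\<^esub>)#} = dn {#}" 
    by (intro dn_eq tensor_le.zero_right tensor_le.empty) auto
  then show "dn {#(a, \<zero>\<^bsub>T\<^esub>)#} = \<zero>\<^bsub>X\<^esub>" by simp
next
  fix a1 a2 b assume "a1 \<in> carrier S" "a2 \<in> carrier S" "b \<in> carrier T" "a1 \<preceq>\<^bsub>S\<^esub> a2"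
  then show "dn {#(a1, b)#} \<preceq>\<^bsub>X\<^esub> dn {#(a2, b)#}"
    unfolding tensor_simps by (intro dn_mono tensor_le.mono) auto
next
  fix a b1 b2 assume "a \<in> carrier S" "b1 \<in> carrier T" "b2 \<in> carrier T" "b1 \<preceq>\<^bsub>T\<^esub> b2"
  then show "dn {#(a, b1)#} \<preceq>\<^bsub>X\<^esub> dn {#(a, b2)#}"
    unfolding tensor_simps by (intro dn_mono tensor_le.mono) auto
next
  fix a b s t
  assume *: "increasing S a" "increasing T b" "is_sup S (range a) s" "is_sup T (range b) t"
  have st: "s \<in> carrier S" "t \<in> carrier T" using * by (auto dest: is_sup_carrier)
  have ab: "\<And>n. a n \<in> carrier S" "\<And>n. b n \<in> carrier T" using * by (auto simp: increasing_def)
  have inc: "increasing X (\<lambda>k. dn {#(a k, b k)#})"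
    unfolding increasing_def
  proof (intro allI conjI)
    show "dn {#(a k, b k)#} \<in> carrier X" for k using ab by (intro dn_closed) auto
    show "dn {#(a k, b k)#} \<preceq>\<^bsub>X\<^esub> dn {#(a (Suc k), b (Suc k))#}" for k
      unfolding tensor_simps using * by (intro dn_mono tensor_le.mono) (auto simp: increasing_def)
  qed
  have "dn {#(s, t)#} = (\<Union>k. dn {#(a k, b k)#})"
  proof (intro equalityI subsetI)
    fix z assume "z \<in> dn {#(s, t)#}"
    then obtain x' where x': "z \<lesssim> x'" "x' \<prec>\<^sub>0 {#(s, t)#}" unfolding tensor_below_def by blast
    from x'(2) obtain p q where pq: "x' = {#(p, q)#}" "p \<lless>\<^bsub>S\<^esub> s" "q \<lless>\<^bsub>T\<^esub> t"
      by (rule mwb_single_invR)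
    obtain p' where p': "p \<lless>\<^bsub>S\<^esub> p'" "p' \<lless>\<^bsub>S\<^esub> s" using S.way_below_interpolate[OF pq(2)] .
    obtain q' where q': "q \<lless>\<^bsub>T\<^esub> q'" "q' \<lless>\<^bsub>T\<^esub> t" using T.way_below_interpolate[OF pq(3)] .
    obtain k where k: "p' \<preceq>\<^bsub>S\<^esub> a k" using p' * st S.le_refl unfolding way_below_def by blast
    obtain l where l: "q' \<preceq>\<^bsub>T\<^esub> b l" using q' * st T.le_refl unfolding way_below_def by blast
    define n where "n = max k l"
    have "p' \<preceq>\<^bsub>S\<^esub> a n" using ab p'
      by (intro S.le_trans[OF _ _ _ k S.increasing_le[OF *(1)]]) (auto simp: n_def dest: way_belowD)
    moreover have "q' \<preceq>\<^bsub>T\<^esub> b n" using ab q'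
      by (intro T.le_trans[OF _ _ _ l T.increasing_le[OF *(2)]]) (auto simp: n_def dest: way_belowD)
    ultimately have "p \<lless>\<^bsub>S\<^esub> a n" "q \<lless>\<^bsub>T\<^esub> b n"
      using p' q' ab S.way_below_le T.way_below_le by blast+
    then have "x' \<prec>\<^sub>0 {#(a n, b n)#}" unfolding pq by simp
    then show "z \<in> (\<Union>k. dn {#(a k, b k)#})" using x' unfolding tensor_below_def by blast
  next
    fix z assume "z \<in> (\<Union>k. dn {#(a k, b k)#})"
    then obtain k where "z \<prec> {#(a k, b k)#}" by blast
    moreover have "{#(a k, b k)#} \<lesssim> {#(s, t)#}"
      using st ab * by (intro tensor_le.mono) (auto simp: is_sup_def)
    ultimately show "z \<in> dn {#(s, t)#}" using twb_tle by blast
  qed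
  then show "is_sup X (range (\<lambda>k. dn {#(a k, b k)#})) (dn {#(s, t)#})" 
    using is_sup_iff[OF inc] by blast
next
  fix a' a b' b assume "a' \<lless>\<^bsub>S\<^esub> a" "b' \<lless>\<^bsub>T\<^esub> b"
  then show "dn {#(a', b')#} \<lless>\<^bsub>X\<^esub> dn {#(a, b)#}" by (rule way_below_pure)
qed

end


subsection \<open>The universal property\<close>

lemma cu_morphismD:
  assumes "cu_morphism S T f"
  shows "a \<in> carrier S \<Longrightarrow> f a \<in> carrier T"
    and "\<lbrakk>a \<in> carrier S; b \<in> carrier S\<rbrakk> \<Longrightarrow> f (a \<oplus>\<^bsub>S\<^esub> b) = f a \<oplus>\<^bsub>T\<^esub> f b"
    and "f \<zero>\<^bsub>S\<^esub> = \<zero>\<^bsub>T\<^esub>"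
    and "\<lbrakk>a \<in> carrier S; b \<in> carrier S; a \<preceq>\<^bsub>S\<^esub> b\<rbrakk> \<Longrightarrow> f a \<preceq>\<^bsub>T\<^esub> f b"
    and "\<lbrakk>increasing S c; is_sup S (range c) s\<rbrakk> \<Longrightarrow> is_sup T (range (\<lambda>n. f (c n))) (f s)"
    and "a \<lless>\<^bsub>S\<^esub> b \<Longrightarrow> f a \<lless>\<^bsub>T\<^esub> f b"
  using assms unfolding cu_morphism_def gen_cu_morphism_def by (simp_all add: Pi_iff)

lemma is_sup_cong:
  assumes "\<And>u. u \<in> carrier S \<Longrightarrow> (\<forall>x\<in>A. x \<preceq>\<^bsub>S\<^esub> u) \<longleftrightarrow> (\<forall>x\<in>B. x \<preceq>\<^bsub>S\<^esub> u)"
  shows "is_sup S A s \<longleftrightarrow> is_sup S B s"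
  unfolding is_sup_def using assms by (metis (no_types, lifting))

locale cu_bimorphism_pair = cu_pair S T + P: cu_semigroup P
  for S :: "('a, 'm) cu_scheme" and T :: "('b, 'n) cu_scheme" and P :: "('c, 'k) cu_scheme" +
  fixes \<phi> :: "'a \<Rightarrow> 'b \<Rightarrow> 'c"
  assumes bimorphism: "cu_bimorphism S T P \<phi>"
begin

lemma bim:
  shows bim_closed: "\<lbrakk>a \<in> carrier S; b \<in> carrier T\<rbrakk> \<Longrightarrow> \<phi> a b \<in> carrier P"
    and bim_add_left: "\<lbrakk>a1 \<in> carrier S; a2 \<in> carrier S; b \<in> carrier T\<rbrakk> \<Longrightarrow>
        \<phi> (a1 \<oplus>\<^bsub>S\<^esub> a2) b = \<phi> a1 b \<oplus>\<^bsub>P\<^esub> \<phi> a2 b"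
    and bim_add_right: "\<lbrakk>a \<in> carrier S; b1 \<in> carrier T; b2 \<in> carrier T\<rbrakk> \<Longrightarrow>
        \<phi> a (b1 \<oplus>\<^bsub>T\<^esub> b2) = \<phi> a b1 \<oplus>\<^bsub>P\<^esub> \<phi> a b2"
    and bim_zero_left: "b \<in> carrier T \<Longrightarrow> \<phi> \<zero>\<^bsub>S\<^esub> b = \<zero>\<^bsub>P\<^esub>"
    and bim_zero_right: "a \<in> carrier S \<Longrightarrow> \<phi> a \<zero>\<^bsub>T\<^esub> = \<zero>\<^bsub>P\<^esub>"
    and bim_mono_left: "\<lbrakk>a1 \<in> carrier S; a2 \<in> carrier S; b \<in> carrier T; a1 \<preceq>\<^bsub>S\<^esub> a2\<rbrakk> \<Longrightarrow>
        \<phi> a1 b \<preceq>\<^bsub>P\<^esub> \<phi> a2 b"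
    and bim_mono_right: "\<lbrakk>a \<in> carrier S; b1 \<in> carrier T; b2 \<in> carrier T; b1 \<preceq>\<^bsub>T\<^esub> b2\<rbrakk> \<Longrightarrow>
        \<phi> a b1 \<preceq>\<^bsub>P\<^esub> \<phi> a b2"
    and bim_sup: "\<lbrakk>increasing S c; increasing T d; is_sup S (range c) s; is_sup T (range d) t\<rbrakk> \<Longrightarrow>
        is_sup P (range (\<lambda>k. \<phi> (c k) (d k))) (\<phi> s t)"
    and bim_way_below: "\<lbrakk>a' \<lless>\<^bsub>S\<^esub> a; b' \<lless>\<^bsub>T\<^esub> b\<rbrakk> \<Longrightarrow> \<phi> a' b' \<lless>\<^bsub>P\<^esub> \<phi> a b"
  using bimorphism[unfolded cu_bimorphism_def] by simp_all

definition tsum :: "('a \<times> 'b) multiset \<Rightarrow> 'c" where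
  "tsum = fold_mset (\<lambda>p s. if p \<in> C \<and> s \<in> carrier P then \<phi> (fst p) (snd p) \<oplus>\<^bsub>P\<^esub> s else s) \<zero>\<^bsub>P\<^esub>"

lemma tsum_empty [simp]: "tsum {#} = \<zero>\<^bsub>P\<^esub>"
  by (simp add: tsum_def)

lemma tsum_aux: "tsum (add_mset p x) =
   (if p \<in> C \<and> tsum x \<in> carrier P then \<phi> (fst p) (snd p) \<oplus>\<^bsub>P\<^esub> tsum x else tsum x)"
proof -
  interpret comp_fun_commute
    "\<lambda>p s. if p \<in> C \<and> s \<in> carrier P then \<phi> (fst p) (snd p) \<oplus>\<^bsub>P\<^esub> s else s"
    by standard (auto simp: fun_eq_iff bim_closed P.a_lcomm)
  show ?thesis unfolding tsum_def by simp
qed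

lemma tsum_closed [simp]: "tsum x \<in> carrier P"
  by (induction x) (auto simp: tsum_aux bim_closed)

lemma tsum_add_mset [simp]:
  "\<lbrakk>a \<in> carrier S; b \<in> carrier T\<rbrakk> \<Longrightarrow> tsum (add_mset (a, b) x) = \<phi> a b \<oplus>\<^bsub>P\<^esub> tsum x"
  by (simp add: tsum_aux)

lemma tsum_add: "set_mset x \<subseteq> C \<Longrightarrow> tsum (x + y) = tsum x \<oplus>\<^bsub>P\<^esub> tsum y"
  by (induction x) (auto simp: bim_closed P.a_assoc)

lemma tsum_mono: "x \<lesssim> y \<Longrightarrow> tsum x \<preceq>\<^bsub>P\<^esub> tsum y"
proof (induction rule: tensor_le.induct)
  case (trans x y z)
  then show ?case using P.le_trans[of "tsum x" "tsum y" "tsum z"] by simp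
next
  case (add x y z)
  then show ?case using tle_carrier[OF add.hyps(1)] by (simp add: tsum_add P.add_right_mono)
next
  case (mono a' a b' b)
  then have "\<phi> a' b' \<preceq>\<^bsub>P\<^esub> \<phi> a b"
    using P.le_trans[of "\<phi> a' b'" "\<phi> a b'" "\<phi> a b"] bim by auto
  then show ?case using mono by (simp add: bim_closed)
qed (auto simp: bim_closed bim_add_left bim_add_right bim_zero_left bim_zero_right P.a_ac)

lemma tsum_mwb: "x \<prec>\<^sub>0 y \<Longrightarrow> tsum x \<lless>\<^bsub>P\<^esub> tsum y"
proof (induction rule: mwb_induct)
  case (add a' a b' b M N)
  have "a' \<in> carrier S" "b' \<in> carrier T" "a \<in> carrier S" "b \<in> carrier T"
    using add.hyps(1,2) by (auto dest: way_belowD)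
  then show ?case using P.O3[OF bim_way_below[OF add.hyps(1,2)] add.IH] by simp
qed simp

lemma tsum_twb: "x \<prec> y \<Longrightarrow> tsum x \<lless>\<^bsub>P\<^esub> tsum y"
  unfolding tensor_below_def using tsum_mono tsum_mwb P.le_way_below tsum_closed by meson

definition lift :: "('a \<times> 'b) multiset set \<Rightarrow> 'c" where
  "lift I = (THE s. is_sup P (tsum ` I) s)"

lemma chain_increasing: "\<forall>n. c n \<prec> c (Suc n) \<Longrightarrow> increasing P (\<lambda>n. tsum (c n))"
  unfolding increasing_def by (simp add: tsum_mono twb_imp_tle)

lemma is_sup_chain_iff:
  assumes "\<forall>n. c n \<prec> c (Suc n)" "I = {z. \<exists>n. z \<prec> c n}"
  shows "is_sup P (range (\<lambda>n. tsum (c n))) s \<longleftrightarrow> is_sup P (tsum ` I) s"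
proof -
  have "(\<forall>x\<in>range (\<lambda>n. tsum (c n)). x \<preceq>\<^bsub>P\<^esub> u) \<longleftrightarrow> (\<forall>x\<in>tsum ` I. x \<preceq>\<^bsub>P\<^esub> u)" 
    if u: "u \<in> carrier P" for u
  proof
    assume *: "\<forall>x\<in>range (\<lambda>n. tsum (c n)). x \<preceq>\<^bsub>P\<^esub> u"
    show "\<forall>x\<in>tsum ` I. x \<preceq>\<^bsub>P\<^esub> u"
    proof
      fix x assume "x \<in> tsum ` I"
      then obtain z n where z: "x = tsum z" "z \<prec> c n" using assms(2) by blast
      have "tsum z \<preceq>\<^bsub>P\<^esub> tsum (c n)" using z tsum_mono twb_imp_tle by blast
      then show "x \<preceq>\<^bsub>P\<^esub> u" using * u z P.le_trans[of "tsum z" "tsum (c n)" u] by simp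
    qed
  next
    assume *: "\<forall>x\<in>tsum ` I. x \<preceq>\<^bsub>P\<^esub> u"
    have "c n \<in> I" for n using assms by blast
    then show "\<forall>x\<in>range (\<lambda>n. tsum (c n)). x \<preceq>\<^bsub>P\<^esub> u" using * by blast
  qed
  then show ?thesis by (rule is_sup_cong)
qed

lemma lift_is_sup: assumes "I \<in> carrier X" shows "is_sup P (tsum ` I) (lift I)"
proof -
  obtain c :: "nat \<Rightarrow> _" where c: "\<forall>n. c n \<prec> c (Suc n)" "I = {z. \<exists>n. z \<prec> c n}"
    using ideal_chain[OF assms] by blast
  obtain s where "is_sup P (range (\<lambda>n. tsum (c n))) s" using P.O1[OF chain_increasing[OF c(1)]] by blast
  then have s: "is_sup P (tsum ` I) s" using is_sup_chain_iff[OF c] by blast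
  then show ?thesis unfolding lift_def by (rule theI) (rule is_sup_unique[OF P.posgp _ s])
qed

lemma lift_eqI: "I \<in> carrier X \<Longrightarrow> is_sup P (tsum ` I) s \<Longrightarrow> lift I = s"
  using lift_is_sup is_sup_unique[OF P.posgp] by blast

lemma lift_closed: "I \<in> carrier X \<Longrightarrow> lift I \<in> carrier P"
  by (rule is_sup_carrier[OF lift_is_sup])

lemma tsum_le_lift: "I \<in> carrier X \<Longrightarrow> z \<in> I \<Longrightarrow> tsum z \<preceq>\<^bsub>P\<^esub> lift I"
  using lift_is_sup unfolding is_sup_def by blast

lemma lift_least:
  "I \<in> carrier X \<Longrightarrow> u \<in> carrier P \<Longrightarrow> (\<And>z. z \<in> I \<Longrightarrow> tsum z \<preceq>\<^bsub>P\<^esub> u) \<Longrightarrow> lift I \<preceq>\<^bsub>P\<^esub> u"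
  using lift_is_sup unfolding is_sup_def by blast

lemma lift_mono: "I \<in> carrier X \<Longrightarrow> J \<in> carrier X \<Longrightarrow> I \<subseteq> J \<Longrightarrow> lift I \<preceq>\<^bsub>P\<^esub> lift J"
  by (intro lift_least lift_closed tsum_le_lift) auto

lemma lift_add:
  assumes I: "I \<in> carrier X" and J: "J \<in> carrier X"
  shows "lift (I \<oplus>\<^bsub>X\<^esub> J) = lift I \<oplus>\<^bsub>P\<^esub> lift J"
proof -
  obtain c :: "nat \<Rightarrow> _" where c: "\<forall>n. c n \<prec> c (Suc n)" "I = {z. \<exists>n. z \<prec> c n}" "\<And>n. c n \<in> I"
    using ideal_chain[OF I] by blast
  obtain d :: "nat \<Rightarrow> _" where d: "\<forall>n. d n \<prec> d (Suc n)" "J = {z. \<exists>n. z \<prec> d n}" "\<And>n. d n \<in> J"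
    using ideal_chain[OF J] by blast
  have cd: "\<forall>n. c n + d n \<prec> c (Suc n) + d (Suc n)" using c(1) d(1) twb_add by blast
  have IJ: "I \<oplus>\<^bsub>X\<^esub> J = {z. \<exists>n. z \<prec> c n + d n}"
  proof (intro equalityI subsetI)
    fix z assume "z \<in> I \<oplus>\<^bsub>X\<^esub> J"
    then obtain x y where xy: "x \<in> I" "y \<in> J" "z \<prec> x + y" by auto
    obtain n where n: "x \<prec> c n" using xy c(2) by blast
    obtain m where m: "y \<prec> d m" using xy d(2) by blast
    let ?k = "Suc (max n m)"
    have "c n \<prec> c ?k" "d m \<prec> d ?k" using twb_chain[OF c(1)] twb_chain[OF d(1)] by auto
    then have "x + y \<prec> c ?k + d ?k" using n m twb_trans twb_add by meson
    then show "z \<in> {z. \<exists>n. z \<prec> c n + d n}" using xy twb_trans by blast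
  next
    fix z assume "z \<in> {z. \<exists>n. z \<prec> c n + d n}"
    then show "z \<in> I \<oplus>\<^bsub>X\<^esub> J" unfolding tensor_simps using c(3) d(3) by blast
  qed
  have "is_sup P (range (\<lambda>n. tsum (c n))) (lift I)" "is_sup P (range (\<lambda>n. tsum (d n))) (lift J)"
    using is_sup_chain_iff[OF c(1,2)] is_sup_chain_iff[OF d(1,2)] lift_is_sup I J by auto
  from P.O4[OF chain_increasing[OF c(1)] chain_increasing[OF d(1)] this]
  have "is_sup P (range (\<lambda>n. tsum (c n) \<oplus>\<^bsub>P\<^esub> tsum (d n))) (lift I \<oplus>\<^bsub>P\<^esub> lift J)" .
  moreover have "tsum (c n) \<oplus>\<^bsub>P\<^esub> tsum (d n) = tsum (c n + d n)" for n
    using tsum_add ideal_carrier[OF I] c(3) by simp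
  ultimately have "is_sup P (range (\<lambda>n. tsum (c n + d n))) (lift I \<oplus>\<^bsub>P\<^esub> lift J)" by simp
  then show ?thesis
    using is_sup_chain_iff[OF cd IJ] by (intro lift_eqI ideal_add_closed I J) blast
qed

lemma lift_morphism: "cu_morphism X P lift"
  unfolding cu_morphism_def gen_cu_morphism_def
proof (intro conjI ballI allI impI)
  show "lift \<in> carrier X \<rightarrow> carrier P" using lift_closed by blast
  show "lift (I \<oplus>\<^bsub>X\<^esub> J) = lift I \<oplus>\<^bsub>P\<^esub> lift J" if "I \<in> carrier X" "J \<in> carrier X" for I J
    using that by (rule lift_add)
  have z: "\<zero>\<^bsub>X\<^esub> \<in> carrier X" using dn_closed[of "{#}"] by simp
  have "tsum x \<preceq>\<^bsub>P\<^esub> \<zero>\<^bsub>P\<^esub>" if "x \<in> \<zero>\<^bsub>X\<^esub>" for x using that tsum_mono[of x "{#}"] by simp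
  then have "lift \<zero>\<^bsub>X\<^esub> \<preceq>\<^bsub>P\<^esub> \<zero>\<^bsub>P\<^esub>" by (intro lift_least z) auto
  then show "lift \<zero>\<^bsub>X\<^esub> = \<zero>\<^bsub>P\<^esub>" using lift_closed[OF z] by (intro P.le_antisym) auto
  show "lift I \<preceq>\<^bsub>P\<^esub> lift J" if "I \<in> carrier X" "J \<in> carrier X" "I \<preceq>\<^bsub>X\<^esub> J" for I J
    using that lift_mono by simp
next
  fix I J assume *: "increasing X I" "is_sup X (range I) J"
  have J: "J = (\<Union>k. I k)" "J \<in> carrier X" and I: "\<And>k. I k \<in> carrier X"
    using is_sup_iff[OF *(1)] is_sup_carrier[OF *(2)] * by (auto simp: increasing_def)
  show "is_sup P (range (\<lambda>n. lift (I n))) (lift J)"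
    unfolding is_sup_def
  proof (intro conjI ballI impI)
    show "lift J \<in> carrier P" using J(2) by (rule lift_closed)
    show "x \<preceq>\<^bsub>P\<^esub> lift J" if "x \<in> range (\<lambda>n. lift (I n))" for x
    proof -
      obtain n where "x = lift (I n)" using \<open>x \<in> range (\<lambda>n. lift (I n))\<close> by blast
      moreover have "I n \<subseteq> J" using J by blast
      ultimately show ?thesis using lift_mono[OF I J(2)] by simp
    qed
    fix u assume u: "u \<in> carrier P" "\<forall>x\<in>range (\<lambda>n. lift (I n)). x \<preceq>\<^bsub>P\<^esub> u"
    show "lift J \<preceq>\<^bsub>P\<^esub> u"
    proof (rule lift_least[OF J(2) u(1)])
      fix z assume "z \<in> J"
      then obtain n where "z \<in> I n" using J by blast
      then have "tsum z \<preceq>\<^bsub>P\<^esub> lift (I n)" using tsum_le_lift I by blast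
      then show "tsum z \<preceq>\<^bsub>P\<^esub> u" using u lift_closed[OF I] P.le_trans[of "tsum z" "lift (I n)" u] by auto
    qed
  qed
next
  fix I J assume "I \<lless>\<^bsub>X\<^esub> J"
  then obtain z where z: "I \<in> carrier X" "J \<in> carrier X" "z \<in> J" "I \<subseteq> dn z"
    unfolding way_below_X by blast
  obtain w where w: "w \<in> J" "z \<prec> w" using ideal_round[OF z(2,3)] by blast
  have "lift I \<preceq>\<^bsub>P\<^esub> tsum z"
    using z by (intro lift_least) (auto intro!: tsum_mono twb_imp_tle)
  then have "lift I \<lless>\<^bsub>P\<^esub> tsum w" 
    using P.le_way_below[OF lift_closed[OF z(1)] _ tsum_twb[OF w(2)]] by blast
  then show "lift I \<lless>\<^bsub>P\<^esub> lift J"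
    using P.way_below_le[OF lift_closed[OF z(2)] _ tsum_le_lift[OF z(2) w(1)]] by blast
qed

lemma lift_pure:
  assumes a: "a \<in> carrier S" and b: "b \<in> carrier T" shows "lift (dn {#(a, b)#}) = \<phi> a b"
proof -
  obtain u where u: "\<forall>n. u n \<lless>\<^bsub>S\<^esub> u (Suc n)" "is_sup S (range u) a" using S.O2 a by blast
  obtain v where v: "\<forall>n. v n \<lless>\<^bsub>T\<^esub> v (Suc n)" "is_sup T (range v) b" using T.O2 b by blast
  have c: "dn {#(a, b)#} \<in> carrier X" using a b by (intro dn_closed) auto
  have uv: "\<And>n. u n \<in> carrier S" "\<And>n. v n \<in> carrier T" using u(1) v(1) by (auto dest: way_belowD)
  have sup: "is_sup P (range (\<lambda>k. \<phi> (u k) (v k))) (\<phi> a b)"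
    using u v by (intro bim_sup S.way_below_increasing T.way_below_increasing)
  have "is_sup P (tsum ` dn {#(a, b)#}) (\<phi> a b)"
    unfolding is_sup_def
  proof (intro conjI ballI impI)
    show "\<phi> a b \<in> carrier P" using a b by (rule bim_closed)
    fix x assume "x \<in> tsum ` dn {#(a, b)#}"
    then obtain z where "x = tsum z" "z \<lesssim> {#(a, b)#}" using twb_imp_tle by blast
    then show "x \<preceq>\<^bsub>P\<^esub> \<phi> a b" using tsum_mono[of z "{#(a, b)#}"] a b by (simp add: bim_closed)
  next
    fix w assume w: "w \<in> carrier P" "\<forall>x\<in>tsum ` dn {#(a, b)#}. x \<preceq>\<^bsub>P\<^esub> w"
    have "\<phi> (u k) (v k) \<preceq>\<^bsub>P\<^esub> w" for k
    proof -
      have "{#(u k, v k)#} \<prec> {#(a, b)#}"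
        using S.is_sup_below[OF u] T.is_sup_below[OF v] by (intro mwb_imp_twb) simp
      then have "tsum {#(u k, v k)#} \<preceq>\<^bsub>P\<^esub> w" using w(2) by blast
      then show ?thesis using uv by (simp add: bim_closed)
    qed
    then show "\<phi> a b \<preceq>\<^bsub>P\<^esub> w" using sup w(1) unfolding is_sup_def by blast
  qed
  then show ?thesis by (rule lift_eqI[OF c])
qed

end

theorem cu_semigroup_cu_tensor:
  assumes "cu_semigroup S" "cu_semigroup T"
  shows "cu_semigroup (cu_tensor S T)"
proof -
  interpret cu_pair S T using assms by (rule cu_pair.intro)
  show ?thesis by (rule cu_X)
qed

theorem cu_bimorphism_pure_tensor:
  assumes "cu_semigroup S" "cu_semigroup T"
  shows "cu_bimorphism S T (cu_tensor S T) (pure_tensor S T)"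
proof -
  interpret cu_pair S T using assms by (rule cu_pair.intro)
  show ?thesis using pure_bimorphism unfolding pure_tensor_def .
qed

theorem cu_tensor_morphism_le_iff:
  assumes "cu_semigroup S" "cu_semigroup T" "cu_semigroup P"
    and \<alpha>1: "cu_morphism (cu_tensor S T) P \<alpha>1" and \<alpha>2: "cu_morphism (cu_tensor S T) P \<alpha>2"
  shows "(\<forall>I\<in>carrier (cu_tensor S T). \<alpha>1 I \<preceq>\<^bsub>P\<^esub> \<alpha>2 I) \<longleftrightarrow>
    (\<forall>a\<in>carrier S. \<forall>b\<in>carrier T. \<alpha>1 (pure_tensor S T a b) \<preceq>\<^bsub>P\<^esub> \<alpha>2 (pure_tensor S T a b))"
proof
  interpret cu_pair S T using assms(1,2) by (rule cu_pair.intro)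
  assume "\<forall>I\<in>carrier (cu_tensor S T). \<alpha>1 I \<preceq>\<^bsub>P\<^esub> \<alpha>2 I"
  then show "\<forall>a\<in>carrier S. \<forall>b\<in>carrier T. \<alpha>1 (pure_tensor S T a b) \<preceq>\<^bsub>P\<^esub> \<alpha>2 (pure_tensor S T a b)"
    using dn_closed unfolding pure_tensor_def by simp
next
  interpret cu_pair S T using assms(1,2) by (rule cu_pair.intro)
  interpret P: cu_semigroup P by fact
  assume le: "\<forall>a\<in>carrier S. \<forall>b\<in>carrier T. \<alpha>1 (pure_tensor S T a b) \<preceq>\<^bsub>P\<^esub> \<alpha>2 (pure_tensor S T a b)"
  note closed = cu_morphismD(1)[OF \<alpha>1] cu_morphismD(1)[OF \<alpha>2]
  note add_eq = cu_morphismD(2)[OF \<alpha>1] cu_morphismD(2)[OF \<alpha>2]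
  note zero = cu_morphismD(3)[OF \<alpha>1] cu_morphismD(3)[OF \<alpha>2]
  note sup = cu_morphismD(5)[OF \<alpha>1] cu_morphismD(5)[OF \<alpha>2]
  have dn: "\<alpha>1 (dn x) \<preceq>\<^bsub>P\<^esub> \<alpha>2 (dn x)" if "set_mset x \<subseteq> C" for x
    using that
  proof (induction x)
    case empty
    have "dn {#} = \<zero>\<^bsub>X\<^esub>" by simp
    then show ?case using zero by (simp del: tensor_simps)
  next
    case (add p x)
    obtain a b where p: "p = (a, b)" "a \<in> carrier S" "b \<in> carrier T" using add.prems by auto
    have x: "set_mset x \<subseteq> C" "set_mset {#p#} \<subseteq> C" using add.prems by auto
    have "dn (add_mset p x) = dn {#p#} \<oplus>\<^bsub>X\<^esub> dn x" using dn_add[OF x(2,1)] by simp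
    moreover have "\<alpha>1 (dn {#p#}) \<preceq>\<^bsub>P\<^esub> \<alpha>2 (dn {#p#})" using le p unfolding pure_tensor_def by blast
    ultimately show ?case
      using add.IH[OF x(1)] dn_closed[OF x(1)] dn_closed[OF x(2)] closed add_eq
      by (simp del: tensor_simps add: P.add_mono)
  qed
  show "\<forall>I\<in>carrier (cu_tensor S T). \<alpha>1 I \<preceq>\<^bsub>P\<^esub> \<alpha>2 I"
  proof
    fix J assume J: "J \<in> carrier X"
    obtain c :: "nat \<Rightarrow> _" where c: "\<forall>n. c n \<prec> c (Suc n)" "J = {z. \<exists>n. z \<prec> c n}" "\<And>n. c n \<in> J"
      using ideal_chain[OF J] by blast
    have J': "is_sup X (range (\<lambda>n. dn (c n))) J"
      unfolding is_sup_iff[OF increasing_dn[OF c(1)]] c(2) by blast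
    note s = sup[OF increasing_dn[OF c(1)] J']
    have "\<alpha>1 (dn (c n)) \<preceq>\<^bsub>P\<^esub> \<alpha>2 J" for n
    proof -
      have cn: "set_mset (c n) \<subseteq> C" using ideal_carrier[OF J c(3)] .
      have "\<alpha>2 (dn (c n)) \<preceq>\<^bsub>P\<^esub> \<alpha>2 J" using s(2) unfolding is_sup_def by blast
      then show ?thesis
        by (rule P.le_trans[OF closed(1)[OF dn_closed[OF cn]] closed(2)[OF dn_closed[OF cn]]
              closed(2)[OF J] dn[OF cn]])
    qed
    then show "\<alpha>1 J \<preceq>\<^bsub>P\<^esub> \<alpha>2 J" using s(1) closed(2)[OF J] unfolding is_sup_def by blast
  qed
qed

theorem cu_tensor_universal:
  assumes "cu_semigroup S" "cu_semigroup T" "cu_semigroup P" "cu_bimorphism S T P \<phi>"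
  shows "\<exists>!\<alpha>. \<alpha> \<in> extensional (carrier (cu_tensor S T)) \<and> cu_morphism (cu_tensor S T) P \<alpha> \<and>
     (\<forall>a\<in>carrier S. \<forall>b\<in>carrier T. \<alpha> (pure_tensor S T a b) = \<phi> a b)"
proof -
  interpret cu_bimorphism_pair S T P \<phi>
    using assms by (intro cu_bimorphism_pair.intro cu_pair.intro cu_bimorphism_pair_axioms.intro)
  let ?\<alpha> = "restrict lift (carrier X)"
  have pure: "pure_tensor S T a b \<in> carrier X" if "a \<in> carrier S" "b \<in> carrier T" for a b
    using that unfolding pure_tensor_def by (intro dn_closed) auto
  interpret X: cu_semigroup X by (rule cu_X)
  have "cu_morphism X P ?\<alpha>"
    using lift_morphism
    unfolding cu_morphism_def gen_cu_morphism_def increasing_def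
    by (auto simp del: tensor_simps dest: way_belowD is_sup_carrier cong: image_cong)
  moreover have "\<forall>a\<in>carrier S. \<forall>b\<in>carrier T. ?\<alpha> (pure_tensor S T a b) = \<phi> a b"
    using pure lift_pure by (simp add: pure_tensor_def)
  moreover have "\<alpha> = \<beta>"
    if \<alpha>: "\<alpha> \<in> extensional (carrier X)" "cu_morphism X P \<alpha>"
        "\<forall>a\<in>carrier S. \<forall>b\<in>carrier T. \<alpha> (pure_tensor S T a b) = \<phi> a b"
      and \<beta>: "\<beta> \<in> extensional (carrier X)" "cu_morphism X P \<beta>"
        "\<forall>a\<in>carrier S. \<forall>b\<in>carrier T. \<beta> (pure_tensor S T a b) = \<phi> a b" for \<alpha> \<beta>
  proof (rule extensionalityI[OF \<alpha>(1) \<beta>(1)])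
    fix I assume I: "I \<in> carrier X"
    have "\<forall>I\<in>carrier X. \<alpha> I \<preceq>\<^bsub>P\<^esub> \<beta> I" "\<forall>I\<in>carrier X. \<beta> I \<preceq>\<^bsub>P\<^esub> \<alpha> I"
      using cu_tensor_morphism_le_iff[OF assms(1-3) \<alpha>(2) \<beta>(2)]
        cu_tensor_morphism_le_iff[OF assms(1-3) \<beta>(2) \<alpha>(2)] \<alpha>(3) \<beta>(3) bim_closed by auto
    moreover have "\<alpha> I \<in> carrier P" "\<beta> I \<in> carrier P"
      using I cu_morphismD(1)[OF \<alpha>(2)] cu_morphismD(1)[OF \<beta>(2)] by blast+
    ultimately show "\<alpha> I = \<beta> I" using I P.le_antisym by blast
  qed
  ultimately show ?thesis by (intro ex1I[of _ ?\<alpha>]) auto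
qed

corollary tensor_lift:
  assumes "cu_semigroup S" "cu_semigroup T" "cu_semigroup P" "cu_bimorphism S T P \<phi>"
  shows "cu_morphism (cu_tensor S T) P (tensor_lift S T P \<phi>)"
    and "\<lbrakk>a \<in> carrier S; b \<in> carrier T\<rbrakk> \<Longrightarrow>
           tensor_lift S T P \<phi> (pure_tensor S T a b) = \<phi> a b"
  using theI'[OF cu_tensor_universal[OF assms]] unfolding tensor_lift_def by blast+


section \<open>The operations of the internal hom are well defined\<close>

lemma gen_cu_morphismD:
  assumes "gen_cu_morphism S T f"
  shows "a \<in> carrier S \<Longrightarrow> f a \<in> carrier T"
    and "\<lbrakk>a \<in> carrier S; b \<in> carrier S\<rbrakk> \<Longrightarrow> f (a \<oplus>\<^bsub>S\<^esub> b) = f a \<oplus>\<^bsub>T\<^esub> f b"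
    and "f \<zero>\<^bsub>S\<^esub> = \<zero>\<^bsub>T\<^esub>"
    and "\<lbrakk>a \<in> carrier S; b \<in> carrier S; a \<preceq>\<^bsub>S\<^esub> b\<rbrakk> \<Longrightarrow> f a \<preceq>\<^bsub>T\<^esub> f b"
    and "\<lbrakk>increasing S c; is_sup S (range c) s\<rbrakk> \<Longrightarrow> is_sup T (range (\<lambda>n. f (c n))) (f s)"
  using assms unfolding gen_cu_morphism_def by (simp_all add: Pi_iff)

context cu_pair
begin

lemma morph_below_le:
  assumes f: "gen_cu_morphism S T f" and fg: "morph_below S T f g" and a: "a \<in> carrier S"
  shows "g a \<in> carrier T" "f a \<preceq>\<^bsub>T\<^esub> g a"
proof -
  obtain u where u: "\<forall>n. u n \<lless>\<^bsub>S\<^esub> u (Suc n)" "is_sup S (range u) a" using S.O2 a by blast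
  have fu: "is_sup T (range (\<lambda>n. f (u n))) (f a)"
    using u S.way_below_increasing by (intro gen_cu_morphismD(5)[OF f])
  have wb: "f (u n) \<lless>\<^bsub>T\<^esub> g a" for n
    using S.is_sup_below[OF u] fg unfolding morph_below_def by blast
  then show g: "g a \<in> carrier T" using way_belowD by fast
  have "f (u n) \<preceq>\<^bsub>T\<^esub> g a" for n using wb by (rule T.way_below_imp_le)
  then show "f a \<preceq>\<^bsub>T\<^esub> g a" using fu g unfolding is_sup_def by blast
qed

lemma morph_below_trans:
  assumes g: "gen_cu_morphism S T g" and fg: "morph_below S T f g" and gh: "morph_below S T g h"
  shows "morph_below S T f h"
  unfolding morph_below_def
proof (intro allI impI)
  fix a' a assume a: "a' \<lless>\<^bsub>S\<^esub> a"
  then have "a \<in> carrier S" by (auto dest: way_belowD)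
  note * = morph_below_le[OF g gh this]
  show "f a' \<lless>\<^bsub>T\<^esub> h a"
    by (rule T.way_below_le[OF *(1) _ *(2)]) (use fg a in \<open>simp add: morph_below_def\<close>)
qed

lemma pathsD:
  assumes "f \<in> paths S T"
  shows "l \<in> unit_rats \<Longrightarrow> gen_cu_morphism S T (f l)"
    and "\<lbrakk>l' \<in> unit_rats; l \<in> unit_rats; l' < l\<rbrakk> \<Longrightarrow> morph_below S T (f l') (f l)"
  using assms unfolding paths_def by auto

lemma path_le_refl: assumes "f \<in> paths S T" shows "path_le S T f f"
  unfolding path_le_def
proof
  fix l assume l: "l \<in> unit_rats"
  then have "(l + 1) / 2 \<in> unit_rats" "l < (l + 1) / 2" by (auto simp: unit_rats_def)
  then show "\<exists>m\<in>unit_rats. morph_below S T (f l) (f m)" using pathsD(2)[OF assms l] by blast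
qed

lemma path_le_trans:
  assumes "g \<in> paths S T" "path_le S T f g" "path_le S T g h" shows "path_le S T f h"
  using assms(2,3) pathsD(1)[OF assms(1)] morph_below_trans unfolding path_le_def by meson

lemma equiv_path_rel: "equiv (paths S T) (path_rel S T)"
proof (rule equivI)
  show "path_rel S T \<subseteq> paths S T \<times> paths S T" by (auto simp: path_rel_def)
  show "refl_on (paths S T) (path_rel S T)"
    by (rule refl_onI) (auto simp: path_rel_def path_le_refl)
  show "sym (path_rel S T)" by (rule symI) (auto simp: path_rel_def)
  show "trans (path_rel S T)" by (rule transI) (auto simp: path_rel_def intro: path_le_trans)
qed

lemma mem_path_class: "h \<in> path_rel S T `` {f} \<longleftrightarrow> (f, h) \<in> path_rel S T"
  by simp

lemma cu_hom_leq:
  assumes f: "f \<in> paths S T" and g: "g \<in> paths S T"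
  shows "path_rel S T `` {f} \<preceq>\<^bsub>cu_hom S T\<^esub> path_rel S T `` {g} \<longleftrightarrow> path_le S T f g"
proof -
  have "path_le S T f g" if "(f, f') \<in> path_rel S T" "(g, g') \<in> path_rel S T" "path_le S T f' g'" for f' g'
  proof -
    have p: "f' \<in> paths S T" "g' \<in> paths S T" "path_le S T f f'" "path_le S T g' g"
      using that by (auto simp: path_rel_def)
    show ?thesis
      by (rule path_le_trans[OF p(1) p(3) path_le_trans[OF p(2) that(3) p(4)]])
  qed
  moreover have "(f, f) \<in> path_rel S T" "(g, g) \<in> path_rel S T"
    using f g by (auto simp: path_rel_def path_le_refl)
  ultimately show ?thesis by (auto simp: cu_hom_def)
qed

lemma gen_cu_morphism_add:
  assumes f: "gen_cu_morphism S T f" and g: "gen_cu_morphism S T g"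
  shows "gen_cu_morphism S T (\<lambda>a. f a \<oplus>\<^bsub>T\<^esub> g a)"
proof -
  note F = gen_cu_morphismD[OF f] and G = gen_cu_morphismD[OF g]
  show ?thesis
    unfolding gen_cu_morphism_def
  proof (intro conjI ballI allI impI)
    fix c s assume *: "increasing S c" "is_sup S (range c) s"
    have "increasing T (\<lambda>n. f (c n))" "increasing T (\<lambda>n. g (c n))"
      using *(1) F(1,4) G(1,4) by (auto simp: increasing_def)
    then show "is_sup T (range (\<lambda>n. f (c n) \<oplus>\<^bsub>T\<^esub> g (c n))) (f s \<oplus>\<^bsub>T\<^esub> g s)"
      using F(5)[OF *] G(5)[OF *] by (rule T.O4)
  qed (auto simp: F(1-3) G(1-3) T.a_ac intro!: T.add_mono F(4) G(4))
qed

lemma morph_below_add: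
  "\<lbrakk>morph_below S T f f'; morph_below S T g g'\<rbrakk> \<Longrightarrow>
     morph_below S T (\<lambda>a. f a \<oplus>\<^bsub>T\<^esub> g a) (\<lambda>a. f' a \<oplus>\<^bsub>T\<^esub> g' a)"
  unfolding morph_below_def using T.O3 by simp

lemma paths_add:
  assumes "f \<in> paths S T" "g \<in> paths S T"
  shows "(\<lambda>l a. f l a \<oplus>\<^bsub>T\<^esub> g l a) \<in> paths S T"
  using assms unfolding paths_def by (auto intro!: gen_cu_morphism_add morph_below_add)

lemma paths_zero: "(\<lambda>l a. \<zero>\<^bsub>T\<^esub>) \<in> paths S T"
  unfolding paths_def gen_cu_morphism_def morph_below_def
  by (auto simp: is_sup_def)

lemma path_mono:
  assumes f: "f \<in> paths S T" and l: "l' \<in> unit_rats" "l \<in> unit_rats" "l' \<le> l" and a: "a \<in> carrier S"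
  shows "f l' a \<preceq>\<^bsub>T\<^esub> f l a"
proof (cases "l' = l")
  case True
  then show ?thesis using gen_cu_morphismD(1)[OF pathsD(1)[OF f l(2)] a] by simp
next
  case False
  then show ?thesis
    using morph_below_le(2)[OF pathsD(1)[OF f l(1)] pathsD(2)[OF f l(1,2)] a] l by simp
qed

lemma morph_below_weaken:
  assumes "f \<in> paths S T" "m \<in> unit_rats" "m' \<in> unit_rats" "m \<le> m'" "morph_below S T k (f m)"
  shows "morph_below S T k (f m')"
  using assms morph_below_trans[OF pathsD(1)[OF assms(1,2)] assms(5)] pathsD(2)[OF assms(1-3)]
  by (cases "m = m'") auto

lemma path_le_add:
  assumes p: "f' \<in> paths S T" "g' \<in> paths S T" and "path_le S T f f'" "path_le S T g g'"
  shows "path_le S T (\<lambda>l a. f l a \<oplus>\<^bsub>T\<^esub> g l a) (\<lambda>l a. f' l a \<oplus>\<^bsub>T\<^esub> g' l a)"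
  unfolding path_le_def
proof
  fix l assume "l \<in> unit_rats"
  then obtain m m' where m: "m \<in> unit_rats" "m' \<in> unit_rats"
      "morph_below S T (f l) (f' m)" "morph_below S T (g l) (g' m')"
    using assms(3,4) unfolding path_le_def by meson
  have k: "max m m' \<in> unit_rats" using m(1,2) by (simp add: max_def)
  have "morph_below S T (f l) (f' (max m m'))" "morph_below S T (g l) (g' (max m m'))"
    using morph_below_weaken[OF p(1) m(1) k _ m(3)] morph_below_weaken[OF p(2) m(2) k _ m(4)] by auto
  then show "\<exists>m\<in>unit_rats. morph_below S T (\<lambda>a. f l a \<oplus>\<^bsub>T\<^esub> g l a) (\<lambda>a. f' m a \<oplus>\<^bsub>T\<^esub> g' m a)"
    using k morph_below_add by blast
qed

lemma cu_hom_add: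
  assumes f: "f \<in> paths S T" and g: "g \<in> paths S T"
  shows "path_rel S T `` {f} \<oplus>\<^bsub>cu_hom S T\<^esub> path_rel S T `` {g} =
           path_rel S T `` {\<lambda>l a. f l a \<oplus>\<^bsub>T\<^esub> g l a}"
proof -
  have "path_rel S T `` {\<lambda>l a. f' l a \<oplus>\<^bsub>T\<^esub> g' l a} = path_rel S T `` {\<lambda>l a. f l a \<oplus>\<^bsub>T\<^esub> g l a}"
    if "f' \<in> path_rel S T `` {f}" "g' \<in> path_rel S T `` {g}" for f' g'
    using that by (intro equiv_class_eq[OF equiv_path_rel])
      (auto simp: path_rel_def intro!: path_le_add paths_add)
  note const = this
  have fg: "f \<in> path_rel S T `` {f}" "g \<in> path_rel S T `` {g}"
    using f g by (auto simp: path_rel_def path_le_refl)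
  have UN: "(\<Union>x\<in>A. \<Union>y\<in>B. F x y) = K"
    if "x0 \<in> A" "y0 \<in> B" "\<And>x y. x \<in> A \<Longrightarrow> y \<in> B \<Longrightarrow> F x y = K"
    for A :: "'x set" and B :: "'y set" and F :: "'x \<Rightarrow> 'y \<Rightarrow> 'z set" and K x0 y0
    using that by fastforce
  show ?thesis unfolding cu_hom_def ring.simps by (rule UN[OF fg const])
qed

lemma endpoint_path_class:
  assumes f: "f \<in> paths S T" and a: "a \<in> carrier S"
  shows "is_sup T ((\<lambda>l. f l a) ` unit_rats) (endpoint S T (path_rel S T `` {f}) a)"
proof -
  define q :: "nat \<Rightarrow> rat" where "q n = 1 - 1 / of_nat (n + 2)" for n
  have q: "q n \<in> unit_rats" "q n \<le> q (Suc n)" for n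
    by (auto simp: q_def unit_rats_def field_simps)
  have cofinal: "\<exists>n. l \<le> q n" if "l \<in> unit_rats" for l
  proof -
    have l: "0 < 1 - l" using that by (simp add: unit_rats_def)
    obtain n :: nat where "1 / (1 - l) < of_nat n" using reals_Archimedean2 by blast
    then have "1 / of_nat (n + 2) \<le> 1 - l" using l by (simp add: field_simps)
    then show ?thesis unfolding q_def by (intro exI[of _ n]) simp
  qed
  have closed: "f l a \<in> carrier T" if "l \<in> unit_rats" for l
    using gen_cu_morphismD(1)[OF pathsD(1)[OF f that] a] .
  have "increasing T (\<lambda>n. f (q n) a)"
    using q closed path_mono[OF f q(1) q(1) q(2) a] by (auto simp: increasing_def)
  then obtain s where s: "is_sup T (range (\<lambda>n. f (q n) a)) s" using T.O1 by blast
  have ub: "(\<forall>x\<in>(\<lambda>l. g l a) ` unit_rats. x \<preceq>\<^bsub>T\<^esub> u) \<longrightarrow> (\<forall>x\<in>(\<lambda>l. g' l a) ` unit_rats. x \<preceq>\<^bsub>T\<^esub> u)"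
    if g: "g \<in> paths S T" "g' \<in> paths S T" "path_le S T g' g" and u: "u \<in> carrier T" for g g' u
  proof (intro impI ballI)
    fix x assume *: "\<forall>x\<in>(\<lambda>l. g l a) ` unit_rats. x \<preceq>\<^bsub>T\<^esub> u" "x \<in> (\<lambda>l. g' l a) ` unit_rats"
    then obtain l where l: "l \<in> unit_rats" "x = g' l a" by blast
    then obtain m where m: "m \<in> unit_rats" "morph_below S T (g' l) (g m)"
      using g(3) unfolding path_le_def by blast
    have c: "g' l a \<in> carrier T" "g m a \<in> carrier T"
      using gen_cu_morphismD(1)[OF pathsD(1) a] g l m by blast+
    have "g' l a \<preceq>\<^bsub>T\<^esub> g m a" using morph_below_le(2)[OF pathsD(1)[OF g(2) l(1)] m(2) a] .
    moreover have "g m a \<preceq>\<^bsub>T\<^esub> u" using * m by blast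
    ultimately show "x \<preceq>\<^bsub>T\<^esub> u" using l T.le_trans[OF c u] by blast
  qed
  have eq: "is_sup T ((\<lambda>l. g l a) ` unit_rats) t \<longleftrightarrow> is_sup T ((\<lambda>l. f l a) ` unit_rats) t"
    if "(f, g) \<in> path_rel S T" for g t
  proof (rule is_sup_cong)
    fix u assume u: "u \<in> carrier T"
    have g: "g \<in> paths S T" "path_le S T f g" "path_le S T g f" using that by (auto simp: path_rel_def)
    show "(\<forall>x\<in>(\<lambda>l. g l a) ` unit_rats. x \<preceq>\<^bsub>T\<^esub> u) \<longleftrightarrow> (\<forall>x\<in>(\<lambda>l. f l a) ` unit_rats. x \<preceq>\<^bsub>T\<^esub> u)"
      using ub[OF f g(1) g(3) u] ub[OF g(1) f g(2) u] by argo
  qed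
  have sup: "is_sup T ((\<lambda>l. f l a) ` unit_rats) s"
  proof -
    have "(\<forall>x\<in>range (\<lambda>n. f (q n) a). x \<preceq>\<^bsub>T\<^esub> u) \<longleftrightarrow> (\<forall>x\<in>(\<lambda>l. f l a) ` unit_rats. x \<preceq>\<^bsub>T\<^esub> u)"
      if u: "u \<in> carrier T" for u
    proof
      assume *: "\<forall>x\<in>range (\<lambda>n. f (q n) a). x \<preceq>\<^bsub>T\<^esub> u"
      show "\<forall>x\<in>(\<lambda>l. f l a) ` unit_rats. x \<preceq>\<^bsub>T\<^esub> u"
      proof
        fix x assume "x \<in> (\<lambda>l. f l a) ` unit_rats"
        then obtain l where l: "l \<in> unit_rats" "x = f l a" by blast
        then obtain n where n: "l \<le> q n" using cofinal by blast
        have "f (q n) a \<preceq>\<^bsub>T\<^esub> u" using * by blast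
        then show "x \<preceq>\<^bsub>T\<^esub> u"
          using T.le_trans[OF closed[OF l(1)] closed[OF q(1)] u path_mono[OF f l(1) q(1) n a]] l by blast
      qed
    next
      assume "\<forall>x\<in>(\<lambda>l. f l a) ` unit_rats. x \<preceq>\<^bsub>T\<^esub> u"
      then show "\<forall>x\<in>range (\<lambda>n. f (q n) a). x \<preceq>\<^bsub>T\<^esub> u" using q(1) by blast
    qed
    from is_sup_cong[of T, OF this] show ?thesis using s by blast
  qed
  have ff: "f \<in> path_rel S T `` {f}" using f by (auto simp: path_rel_def path_le_refl)
  have "endpoint S T (path_rel S T `` {f}) a = s"
    unfolding endpoint_def
  proof (rule the_equality)
    show "\<forall>g\<in>path_rel S T `` {f}. is_sup T ((\<lambda>l. g l a) ` unit_rats) s"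
      using eq sup by simp
    fix t assume "\<forall>g\<in>path_rel S T `` {f}. is_sup T ((\<lambda>l. g l a) ` unit_rats) t"
    from bspec[OF this ff] show "t = s" using is_sup_unique[OF T.posgp _ sup] by blast
  qed
  then show ?thesis using sup by simp
qed

end

end

theory Submission
  imports Defs "HOL-Library.Countable_Set" "HOL-Library.Extended_Nonnegative_Real"
begin

text \<open>Write \<open>M\<close> for the internal hom of \<open>R\<close> with itself. An element \<open>r\<close> of a Cu-semiring \<open>R\<close> gives an
  element \<open>\<tau>(r)\<close> of \<open>M\<close>, namely multiplication by the members of a path below \<open>r\<close>, and
  \<open>ev \<circ> (\<tau> \<otimes> id) = \<mu>\<close> for the evaluation map \<open>ev\<close>. If \<open>1\<close> is compact then \<open>\<tau>\<close> is split by evaluation at \<open>1\<close>, so that \<open>\<mu>\<close> is an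
  isomorphism if \<open>ev\<close> is.

  If \<open>R\<close> is solid then \<open>r \<otimes> 1 = 1 \<otimes> r\<close>, hence every generalized Cu-morphism \<open>R \<rightarrow> R\<close> is multiplication by
  its value at \<open>1\<close>, and \<open>ev\<close> is an isomorphism as soon as \<open>F \<otimes> t = \<tau>(F(1)) \<otimes> t\<close> for all \<open>F \<in> M\<close> and
  \<open>t \<in> R\<close>. If \<open>1\<close> is compact then \<open>F = \<tau>(F(1))\<close>. Otherwise, for each \<open>e \<lless> 1\<close> one finds \<open>n\<close> and \<open>s\<close> with
  \<open>e \<le> n s\<close> and \<open>(n + 2) s \<le> 1\<close>, and \<open>e' \<lless> 1\<close> with \<open>n 1 \<le> (n + 2) e'\<close>. The latter gives
  \<open>n F \<le> (n + 2) \<tau>(F(1))\<close>, so moving multiples across the tensor sign,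
  \<open>F \<otimes> e t \<le> F \<otimes> n s t = n F \<otimes> s t \<le> \<tau>(F(1)) \<otimes> (n + 2) s t \<le> \<tau>(F(1)) \<otimes> t\<close>.

  For the divisibility of \<open>1\<close>, (O5) provides \<open>z\<close> and \<open>x\<close> with \<open>n z + x\<close> close to \<open>1\<close>; multiplying out
  \<open>1 = n z + x (n z + x) = \<dots>\<close> gives \<open>1 = n z (1 + x + \<dots> + x\<^sup>k\<^sup>-\<^sup>1) + x\<^sup>k\<close>, whose remainder
  is eventually below \<open>z (1 + x + \<dots> + x\<^sup>k\<^sup>-\<^sup>1)\<close>. This makes \<open>R\<close> almost unperforated, so if
  \<open>n 1 \<le> (n + 2) e'\<close> failed for all \<open>e' \<lless> 1\<close>, a Hahn-Banach argument would produce functionals that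
  contradict their uniqueness, which follows from \<open>r \<otimes> s = s \<otimes> r\<close>.\<close>

section \<open>Paths indexed by the rationals\<close>

text \<open>Without a compact unit the identity F = \<tau>(F(1)) itself can fail. For
  [0,\<infinity>] the constant path at the identity has a compact class, while \<tau>(1), built from
  multiplications by numbers below 1, is strictly smaller although both have value 1 at 1. A path
  controls \<open>f l e\<close> for \<open>e \<lless> \<one>\<close> rather than
  \<open>f l \<one>\<close>, so equality can only be expected after tensoring, where the loss from 1
  to e is compensated by divisibility in the other factor.

  Solidity enters through injectivity of \<mu>, in a form stronger than it looks. Equality of two
  pure tensors in the completion yields, for elements way below, an inequality in the algebraic
  preorder \<open>tensor_le\<close>. Every biadditive monotone map respects that preorder, even one
  that is discontinuous or takes only the values 0 and \<infinity>. Commutativity, linearity of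
  generalized morphisms, simplicity and uniqueness of functionals are four choices of such a
  map.\<close>

text \<open>The path is defined along an enumeration of the rationals, after placing a cofinal chain of
  \<open>D\<close> at the points \<open>1 - 1/(k+1)\<close>; at each step only finitely many of these points lie below any
  given rational, so there is a greatest value below and a least value above the new point.\<close>

lemma rational_path:
  fixes P :: "'x \<Rightarrow> 'x \<Rightarrow> bool" and D :: "'x set"
  assumes trans: "\<And>x y z. P x y \<Longrightarrow> P y z \<Longrightarrow> P x z"
    and interpolate: "\<And>x z. P x z \<Longrightarrow> \<exists>y. P x y \<and> P y z"
    and D: "countable D" "D \<noteq> {}" "\<And>x y. x \<in> D \<Longrightarrow> y \<in> D \<Longrightarrow> \<exists>z\<in>D. P x z \<and> P y z"
  obtains f :: "rat \<Rightarrow> 'x" where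
    "\<And>l' l. \<lbrakk>l' \<in> unit_rats; l \<in> unit_rats; l' < l\<rbrakk> \<Longrightarrow> P (f l') (f l)"
    "\<And>x. x \<in> D \<Longrightarrow> \<exists>l\<in>unit_rats. P x (f l)"
    "\<And>l. l \<in> unit_rats \<Longrightarrow> \<exists>x\<in>D. P (f l) x"
proof -
  define d where "d = from_nat_into D"
  have d: "d n \<in> D" "\<And>x. x \<in> D \<Longrightarrow> \<exists>n. x = d n" for n
    using from_nat_into_surj[OF D(1)] from_nat_into[OF D(2)] unfolding d_def by metis+
  have "\<exists>c. \<forall>n. c n \<in> D \<and> (P (c n) (c (Suc n)) \<and> P (d n) (c (Suc n)))"
  proof (rule dependent_nat_choice)
    show "\<exists>x. x \<in> D" using D(2) by blast
    show "\<exists>y. y \<in> D \<and> (P x y \<and> P (d n) y)" if "x \<in> D" for x n using D(3)[OF that d(1)] by blast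
  qed
  then obtain c where c: "\<And>n. c n \<in> D" "\<And>n. P (c n) (c (Suc n))" "\<And>n. P (d n) (c (Suc n))" by blast
  have chain: "i < j \<Longrightarrow> P (c i) (c j)" for i j
    by (induction j) (auto simp: less_Suc_eq intro: c(2) trans)
  \<comment> \<open>\<open>p 0 = 0\<close> lies outside \<open>unit_rats\<close> on purpose: it
    belongs to every \<open>E n\<close>, so each new rational has a point of \<open>E n\<close>
    below it.\<close>
  define p :: "nat \<Rightarrow> rat" where "p k = 1 - 1 / of_nat (k + 1)" for k
  have p_mono: "i < j \<Longrightarrow> p i < p j" for i j by (simp add: p_def frac_less2)
  have p_iff: "p i < p j \<longleftrightarrow> i < j" for i j using p_mono by (metis less_asym linorder_cases)
  have p_bounds: "0 \<le> p k" "p k < 1" "0 < p (Suc k)" for k by (auto simp: p_def)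
  have p_cofinal: "\<exists>k. x < p k" if "x < 1" for x
  proof -
    have x: "0 < 1 - x" using that by simp
    obtain n :: nat where "1 / (1 - x) < of_nat n" using reals_Archimedean2 by blast
    then have "1 / of_nat (n + 1) < 1 - x" using x by (simp add: field_simps)
    then show ?thesis unfolding p_def by (intro exI[of _ n]) linarith
  qed
  define q :: "nat \<Rightarrow> rat" where "q = from_nat"
  have q_surj: "\<exists>n. q n = x" for x unfolding q_def by (metis from_nat_to_nat)
  define E where "E n = range p \<union> {q i |i. i < n \<and> q i \<in> unit_rats}" for n
  have E_mono: "n \<le> m \<Longrightarrow> E n \<subseteq> E m" for n m unfolding E_def by fastforce
  let ?I = "\<lambda>n g. (\<forall>x\<in>E n. \<forall>y\<in>E n. x < y \<longrightarrow> P (g x) (g y)) \<and> (\<forall>k. g (p k) = c k)"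
  have "\<exists>g. \<forall>n. ?I n (g n) \<and> (\<forall>x\<in>E n. g (Suc n) x = g n x)"
  proof (rule dependent_nat_choice)
    have "inj p" by (rule strict_mono_imp_inj_on) (simp add: strict_mono_def p_mono)
    then have "?I 0 (c \<circ> inv_into UNIV p)" by (auto simp: E_def p_iff chain)
    then show "\<exists>g. ?I 0 g" by blast
    fix g n assume g: "?I n g"
    show "\<exists>g'. ?I (Suc n) g' \<and> (\<forall>x\<in>E n. g' x = g x)"
    proof (cases "q n \<in> E n \<or> q n \<notin> unit_rats")
      case True
      then have "E (Suc n) = E n" unfolding E_def by (auto simp: less_Suc_eq)
      then show ?thesis using g by auto
    next
      case False
      define x where "x = q n"
      have x: "x \<notin> E n" "0 < x" "x < 1" using False by (auto simp: x_def unit_rats_def)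
      have ES: "E (Suc n) = insert x (E n)" using False unfolding E_def x_def by (auto simp: less_Suc_eq)
      obtain k where k: "x < p k" using p_cofinal x(3) by blast
      have fin: "finite {y \<in> E n. y \<le> p k}"
      proof -
        have "{y \<in> E n. y \<le> p k} \<subseteq> p ` {..k} \<union> q ` {..<n}"
          unfolding E_def using p_iff by (auto simp: not_less[symmetric])
        then show ?thesis by (rule finite_subset) simp
      qed
      define a where "a = Max {y \<in> E n. y < x}"
      define b where "b = Min {y \<in> E n. y \<le> p k \<and> x < y}"
      have finab: "finite {y \<in> E n. y < x}" "finite {y \<in> E n. y \<le> p k \<and> x < y}"
        by (rule finite_subset[OF _ fin], use k in force)+
      have "p 0 \<in> E n" "p 0 < x" using x by (auto simp: E_def) (simp add: p_def)
      then have "p 0 \<in> {y \<in> E n. y < x}" by simp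
      then have a: "a \<in> E n" "a < x" "\<And>y. y \<in> E n \<Longrightarrow> y < x \<Longrightarrow> y \<le> a"
        using Max_in[OF finab(1)] Max_ge[OF finab(1)] unfolding a_def by blast+
      have "p k \<in> {y \<in> E n. y \<le> p k \<and> x < y}" using k by (auto simp: E_def)
      then have b: "b \<in> E n" "x < b" "b \<le> p k" "\<And>y. y \<in> E n \<Longrightarrow> y \<le> p k \<Longrightarrow> x < y \<Longrightarrow> b \<le> y"
        using Min_in[OF finab(2)] Min_le[OF finab(2)] unfolding b_def by blast+
      have b': "b \<le> y" if "y \<in> E n" "x < y" for y using b(3,4) that by (meson le_cases order_trans)
      have "P (g a) (g b)" using g a(1,2) b(1,2) by simp
      then obtain z where z: "P (g a) z" "P z (g b)" using interpolate by blast
      have zl: "P (g y) z" if "y \<in> E n" "y < x" for y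
        using g a(1) a(3)[OF that] z(1) that trans[of "g y" "g a" z] by (cases "y = a") auto
      have zu: "P z (g y)" if "y \<in> E n" "x < y" for y
        using g b(1) b'[OF that] z(2) that trans[of z "g b" "g y"] by (cases "y = b") auto
      have "p k \<noteq> x" for k using x(1) by (auto simp: E_def)
      then have "?I (Suc n) (g(x := z))" using g zl zu x(1) unfolding ES by auto
      moreover have "\<forall>y\<in>E n. (g(x := z)) y = g y" using x(1) by auto
      ultimately show ?thesis by blast
    qed
  qed
  then obtain g where g: "\<And>n x y. x \<in> E n \<Longrightarrow> y \<in> E n \<Longrightarrow> x < y \<Longrightarrow> P (g n x) (g n y)"
    "\<And>n k. g n (p k) = c k" "\<And>n x. x \<in> E n \<Longrightarrow> g (Suc n) x = g n x" by blast
  have stable: "n \<le> m \<Longrightarrow> x \<in> E n \<Longrightarrow> g m x = g n x" for n m x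
  proof (induction m rule: dec_induct)
    case (step k)
    then show ?case using g(3)[of x k] E_mono[OF step.hyps(1)] by auto
  qed simp
  define idx where "idx x = (SOME n. q n = x)" for x
  \<comment> \<open>\<open>q i\<close> is present from stage \<open>Suc i\<close> on, and later
    stages keep the value given to it.\<close>
  define f where "f x = g (Suc (idx x)) x" for x
  have E_idx: "x \<in> E (Suc (idx x))" if "x \<in> unit_rats" for x
  proof -
    have "q (idx x) = x" unfolding idx_def by (rule someI_ex[OF q_surj])
    then show ?thesis using that unfolding E_def by (intro UnI2 CollectI exI[of _ "idx x"]) simp
  qed
  have f_eq: "f x = g n x" if "x \<in> unit_rats" "Suc (idx x) \<le> n" for x n
    using stable[OF that(2) E_idx[OF that(1)]] by (simp add: f_def)
  have f_p: "f (p k) = c k" for k by (simp add: f_def g(2))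
  have pu: "p (Suc k) \<in> unit_rats" for k using p_bounds by (simp add: unit_rats_def)
  have f_mono: "P (f l') (f l)" if "l' \<in> unit_rats" "l \<in> unit_rats" "l' < l" for l' l
  proof -
    define n where "n = max (Suc (idx l')) (Suc (idx l))"
    have "l' \<in> E n" "l \<in> E n" using E_idx that E_mono unfolding n_def by (meson max.cobounded1 max.cobounded2 subsetD)+
    then show ?thesis using f_eq[OF that(1), of n] f_eq[OF that(2), of n] g(1) that(3) by (simp add: n_def)
  qed
  show ?thesis
  proof (rule that)
    show "\<exists>l\<in>unit_rats. P x (f l)" if "x \<in> D" for x
      using d(2)[OF that] c(3) pu f_p by metis
    show "\<exists>x\<in>D. P (f l) x" if l: "l \<in> unit_rats" for l
    proof -
      obtain k where "l < p k" using p_cofinal l by (auto simp: unit_rats_def)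
      then have "l < p (Suc k)" using p_mono[of k "Suc k"] by simp
      then have "P (f l) (c (Suc k))" using f_mono[OF l pu, of k] f_p[of "Suc k"] by simp
      then show ?thesis using c(1) by blast
    qed
  qed (fact f_mono)
qed


section \<open>The internal hom is a Cu-semigroup\<close>

context cu_pair
begin

abbreviation hom_class where "hom_class f \<equiv> path_rel S T `` {f}"

lemma hom_class_closed: "f \<in> paths S T \<Longrightarrow> hom_class f \<in> carrier (cu_hom S T)"
  by (auto simp: cu_hom_def intro: quotientI)

lemma hom_classE:
  assumes "F \<in> carrier (cu_hom S T)" obtains f where "f \<in> paths S T" "F = hom_class f"
  using assms by (auto simp: cu_hom_def elim: quotientE)

lemma hom_class_eqI:
  assumes "f \<in> paths S T" "g \<in> paths S T" "path_le S T f g" "path_le S T g f"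
  shows "hom_class f = hom_class g"
  using assms by (intro equiv_class_eq[OF equiv_path_rel]) (simp add: path_rel_def)

lemma hom_zero: "\<zero>\<^bsub>cu_hom S T\<^esub> = hom_class (\<lambda>l a. \<zero>\<^bsub>T\<^esub>)"
  by (simp add: cu_hom_def)

lemma path_le_pointwise:
  assumes "f \<in> paths S T" "g \<in> paths S T"
    and "\<And>l a. l \<in> unit_rats \<Longrightarrow> a \<in> carrier S \<Longrightarrow> f l a = g l a"
  shows "path_le S T f g"
proof -
  have "morph_below S T (f l) h = morph_below S T (g l) h" if "l \<in> unit_rats" for l h
    using assms(3)[OF that] unfolding morph_below_def by (metis way_belowD)
  then show ?thesis using path_le_refl[OF assms(2)] unfolding path_le_def by simp
qed

lemma hom_class_cong:
  assumes "f \<in> paths S T" "g \<in> paths S T"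
    and "\<And>l a. l \<in> unit_rats \<Longrightarrow> a \<in> carrier S \<Longrightarrow> f l a = g l a"
  shows "hom_class f = hom_class g"
  using assms by (intro hom_class_eqI path_le_pointwise) simp_all

lemma positively_ordered_cu_hom: "positively_ordered_semigroup (cu_hom S T)" (is "positively_ordered_semigroup ?H")
proof -
  have val: "f l a \<in> carrier T" if "f \<in> paths S T" "l \<in> unit_rats" "a \<in> carrier S" for f l a
    using gen_cu_morphismD(1)[OF pathsD(1)] that by blast
  have add: "hom_class f \<oplus>\<^bsub>?H\<^esub> hom_class g = hom_class (\<lambda>l a. f l a \<oplus>\<^bsub>T\<^esub> g l a)"
    if "f \<in> paths S T" "g \<in> paths S T" for f g using cu_hom_add that .
  show ?thesis
  proof (intro positively_ordered_semigroup.intro abelian_monoidI positively_ordered_semigroup_axioms.intro)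
    show "\<zero>\<^bsub>?H\<^esub> \<in> carrier ?H" unfolding hom_zero by (rule hom_class_closed[OF paths_zero])
    fix F G assume F: "F \<in> carrier ?H" and G: "G \<in> carrier ?H"
    obtain f where f: "f \<in> paths S T" "F = hom_class f" using hom_classE[OF F] .
    obtain g where g: "g \<in> paths S T" "G = hom_class g" using hom_classE[OF G] .
    show "F \<oplus>\<^bsub>?H\<^esub> G \<in> carrier ?H" using f g by (simp only: add hom_class_closed paths_add)
    show "F \<oplus>\<^bsub>?H\<^esub> G = G \<oplus>\<^bsub>?H\<^esub> F"
      unfolding f(2) g(2) add[OF f(1) g(1)] add[OF g(1) f(1)]
      using f g by (intro hom_class_cong paths_add) (auto simp: val T.a_comm)
    show "F = G" if "F \<preceq>\<^bsub>?H\<^esub> G" "G \<preceq>\<^bsub>?H\<^esub> F"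
      using that f g cu_hom_leq by (metis hom_class_eqI)
    fix K assume K: "K \<in> carrier ?H"
    obtain k where k: "k \<in> paths S T" "K = hom_class k" using hom_classE[OF K] .
    have "hom_class (\<lambda>l a. (f l a \<oplus>\<^bsub>T\<^esub> g l a) \<oplus>\<^bsub>T\<^esub> k l a) = hom_class (\<lambda>l a. f l a \<oplus>\<^bsub>T\<^esub> (g l a \<oplus>\<^bsub>T\<^esub> k l a))"
      using f g k by (intro hom_class_cong paths_add) (auto simp: val T.a_assoc)
    then show "F \<oplus>\<^bsub>?H\<^esub> G \<oplus>\<^bsub>?H\<^esub> K = F \<oplus>\<^bsub>?H\<^esub> (G \<oplus>\<^bsub>?H\<^esub> K)"
      unfolding f(2) g(2) k(2) using f g k by (simp only: add paths_add)
    show "F \<preceq>\<^bsub>?H\<^esub> K" if "F \<preceq>\<^bsub>?H\<^esub> G" "G \<preceq>\<^bsub>?H\<^esub> K"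
      using that path_le_trans[OF g(1), of f k] unfolding f(2) g(2) k(2)
        cu_hom_leq[OF f(1) g(1)] cu_hom_leq[OF g(1) k(1)] cu_hom_leq[OF f(1) k(1)] by blast
    show "F \<oplus>\<^bsub>?H\<^esub> K \<preceq>\<^bsub>?H\<^esub> G \<oplus>\<^bsub>?H\<^esub> K" if "F \<preceq>\<^bsub>?H\<^esub> G"
      using that unfolding f(2) g(2) k(2) add[OF f(1) k(1)] add[OF g(1) k(1)]
      using f g k by (simp only: cu_hom_leq paths_add path_le_add path_le_refl)
  next
    fix F assume F: "F \<in> carrier ?H"
    obtain f where f: "f \<in> paths S T" "F = hom_class f" using hom_classE[OF F] .
    show "F \<preceq>\<^bsub>?H\<^esub> F" unfolding f(2) using f(1) by (simp only: cu_hom_leq path_le_refl)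
    show "\<zero>\<^bsub>?H\<^esub> \<oplus>\<^bsub>?H\<^esub> F = F"
      unfolding hom_zero f(2) add[OF paths_zero f(1)]
      using f by (intro hom_class_cong paths_add paths_zero) (auto simp: val)
    have "path_le S T (\<lambda>l a. \<zero>\<^bsub>T\<^esub>) f"
      unfolding path_le_def morph_below_def using val[OF f(1)]
      by (auto intro!: T.zero_way_below dest: way_belowD)
    then show "\<zero>\<^bsub>?H\<^esub> \<preceq>\<^bsub>?H\<^esub> F" unfolding hom_zero f(2) using f(1) paths_zero by (simp only: cu_hom_leq)
  qed
qed

interpretation H: positively_ordered_semigroup "cu_hom S T"
  by (rule positively_ordered_cu_hom)

lemma unit_rats_above:
  assumes "l \<in> unit_rats" obtains m where "m \<in> unit_rats" "l < m"
  using dense[of l 1] assms by (auto simp: unit_rats_def)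

lemma path_le_bound2:
  assumes g: "g \<in> paths S T" and "path_le S T f g" "path_le S T f' g" "l \<in> unit_rats" "l' \<in> unit_rats"
  obtains m where "m \<in> unit_rats" "morph_below S T (f l) (g m)" "morph_below S T (f' l') (g m)"
proof -
  obtain m m' where m: "m \<in> unit_rats" "m' \<in> unit_rats"
      "morph_below S T (f l) (g m)" "morph_below S T (f' l') (g m')"
    using assms unfolding path_le_def by meson
  have k: "max m m' \<in> unit_rats" using m(1,2) by (simp add: max_def)
  show ?thesis
    using that[OF k] morph_below_weaken[OF g m(1) k _ m(3)] morph_below_weaken[OF g m(2) k _ m(4)] by simp
qed

lemma hom_class_increasing:
  assumes "\<And>n. c n \<in> paths S T" "increasing (cu_hom S T) (\<lambda>n. hom_class (c n))" "n \<le> m"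
  shows "path_le S T (c n) (c m)"
  using assms(3)
proof (induction m rule: dec_induct)
  case base
  show ?case by (rule path_le_refl[OF assms(1)])
next
  case (step m)
  have "path_le S T (c m) (c (Suc m))"
    using assms(2) assms(1) unfolding increasing_def by (simp only: cu_hom_leq)
  then show ?case using path_le_trans[OF assms(1) step.IH] by blast
qed

text \<open>The relation \<open>morph_below\<close> need not interpolate; two morphisms are therefore
  only compared through an intermediate segment of a path.\<close>

lemma path_sup_exists:
  assumes c: "\<And>n. c n \<in> paths S T" and inc: "increasing (cu_hom S T) (\<lambda>n. hom_class (c n))"
  obtains h where "h \<in> paths S T" "is_sup (cu_hom S T) (range (\<lambda>n. hom_class (c n))) (hom_class h)"
    "\<And>l. l \<in> unit_rats \<Longrightarrow> \<exists>n. \<exists>m\<in>unit_rats. morph_below S T (h l) (c n m)"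
proof -
  define P where "P \<phi> \<psi> \<longleftrightarrow> gen_cu_morphism S T \<phi> \<and> gen_cu_morphism S T \<psi> \<and>
    (\<exists>h\<in>paths S T. \<exists>l\<in>unit_rats. \<exists>m\<in>unit_rats. l < m \<and> morph_below S T \<phi> (h l) \<and> morph_below S T (h m) \<psi>)"
    for \<phi> \<psi>
  \<comment> \<open>The members of all the paths form a countable set that is directed for
    \<open>P\<close>. A rational path cofinal in it dominates every \<open>c n\<close> at once,
    which replaces a diagonal argument.\<close>
  define D where "D = (\<Union>n. c n ` unit_rats)"
  have P_below: "morph_below S T \<phi> \<psi>" if P: "P \<phi> \<psi>" for \<phi> \<psi>
  proof -
    obtain h l m where h: "h \<in> paths S T" "l \<in> unit_rats" "m \<in> unit_rats" "l < m"
      "morph_below S T \<phi> (h l)" "morph_below S T (h m) \<psi>" using P unfolding P_def by blast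
    have "morph_below S T \<phi> (h m)" using morph_below_weaken[OF h(1-3) _ h(5)] h(4) by simp
    then show ?thesis using morph_below_trans[OF pathsD(1)[OF h(1,3)] _ h(6)] by blast
  qed
  have P_trans: "P \<phi> \<chi>" if pq: "P \<phi> \<psi>" "P \<psi> \<chi>" for \<phi> \<psi> \<chi>
  proof -
    obtain h l m where h: "h \<in> paths S T" "l \<in> unit_rats" "m \<in> unit_rats" "l < m"
      "morph_below S T \<phi> (h l)" "morph_below S T (h m) \<psi>" using pq(1) unfolding P_def by blast
    have "morph_below S T (h m) \<chi>"
      using morph_below_trans[OF _ h(6) P_below[OF pq(2)]] pq(2) unfolding P_def by blast
    then show ?thesis using h pq unfolding P_def by blast
  qed
  have P_path: "P (h l) (h m)" if h: "h \<in> paths S T" "l \<in> unit_rats" "m \<in> unit_rats" "l < m" for h l m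
  proof -
    obtain k where k: "l < k" "k < m" using dense[OF h(4)] by blast
    obtain k' where k': "k < k'" "k' < m" using dense[OF k(2)] by blast
    have u: "k \<in> unit_rats" "k' \<in> unit_rats" using h(2,3) k k' by (auto simp: unit_rats_def)
    show ?thesis unfolding P_def
      using h u k k' pathsD(1)[OF h(1)] pathsD(2)[OF h(1)] by blast
  qed
  have P_trans_below: "P \<phi> (h m)" if hh: "gen_cu_morphism S T \<phi>" "h \<in> paths S T" "l \<in> unit_rats" "m \<in> unit_rats"
    "l < m" "morph_below S T \<phi> (h l)" for \<phi> h l m
  proof -
    obtain k where k: "l < k" "k < m" using dense[OF hh(5)] by blast
    have u: "k \<in> unit_rats" using hh(3,4) k by (auto simp: unit_rats_def)
    show ?thesis unfolding P_def
      using hh u k pathsD(1)[OF hh(2,4)] pathsD(2)[OF hh(2) u hh(4) k(2)] by blast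
  qed
  have P_interpolate: "\<exists>\<psi>. P \<phi> \<psi> \<and> P \<psi> \<chi>" if pc: "P \<phi> \<chi>" for \<phi> \<chi>
  proof -
    obtain h l m where h: "h \<in> paths S T" "l \<in> unit_rats" "m \<in> unit_rats" "l < m"
      "morph_below S T \<phi> (h l)" "morph_below S T (h m) \<chi>"
      and gen: "gen_cu_morphism S T \<phi>" "gen_cu_morphism S T \<chi>" using pc unfolding P_def by blast
    obtain k where k: "l < k" "k < m" using dense[OF h(4)] by blast
    obtain k' where k': "k < k'" "k' < m" using dense[OF k(2)] by blast
    have u: "k \<in> unit_rats" "k' \<in> unit_rats" using h(2,3) k k' by (auto simp: unit_rats_def)
    have "P \<phi> (h k)" using P_trans_below[OF gen(1) h(1,2) u(1) k(1) h(5)] .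
    moreover have "P (h k) \<chi>" unfolding P_def
      using h gen u k' pathsD(1)[OF h(1) u(1)] pathsD(2)[OF h(1) u k'(1)] by blast
    ultimately show ?thesis by blast
  qed
  have cle: "path_le S T (c n) (c m)" if "n \<le> m" for n m
    using hom_class_increasing[OF c inc that] .
  have D_dir: "\<exists>z\<in>D. P x z \<and> P y z" if xy: "x \<in> D" "y \<in> D" for x y
  proof -
    obtain n l n' l' where x: "l \<in> unit_rats" "x = c n l" and y: "l' \<in> unit_rats" "y = c n' l'"
      using xy unfolding D_def by blast
    obtain m where m: "m \<in> unit_rats" "morph_below S T x (c (max n n') m)" "morph_below S T y (c (max n n') m)"
      using path_le_bound2[OF c cle[of n "max n n'"] cle[of n' "max n n'"] x(1) y(1)] x(2) y(2) by auto
    obtain m' where m': "m' \<in> unit_rats" "m < m'" using unit_rats_above[OF m(1)] .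
    have "P x (c (max n n') m')" "P y (c (max n n') m')"
      using P_trans_below[OF _ c m(1) m'] m(2,3) pathsD(1)[OF c] x y by blast+
    then show ?thesis using m'(1) unfolding D_def by blast
  qed
  have D_countable: "countable D" unfolding D_def by (intro countable_UN) auto
  have "1/2 \<in> (unit_rats :: rat set)" by (simp add: unit_rats_def)
  then have D_nonempty: "D \<noteq> {}" unfolding D_def by blast
  obtain h where h: "\<And>l' l. \<lbrakk>l' \<in> unit_rats; l \<in> unit_rats; l' < l\<rbrakk> \<Longrightarrow> P (h l') (h l)"
    "\<And>x. x \<in> D \<Longrightarrow> \<exists>l\<in>unit_rats. P x (h l)" "\<And>l. l \<in> unit_rats \<Longrightarrow> \<exists>x\<in>D. P (h l) x"
    by (rule rational_path[of P D, OF P_trans P_interpolate D_countable D_nonempty D_dir]) (assumption | blast)+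
  have "gen_cu_morphism S T (h l)" if "l \<in> unit_rats" for l
    using h(3)[OF that] unfolding P_def by blast
  then have path: "h \<in> paths S T"
    using P_below[OF h(1)] unfolding paths_def by simp
  have bound: "\<exists>n. \<exists>m\<in>unit_rats. morph_below S T (h l) (c n m)" if "l \<in> unit_rats" for l
    using h(3)[OF that] P_below unfolding D_def by blast
  have "is_sup (cu_hom S T) (range (\<lambda>n. hom_class (c n))) (hom_class h)"
    unfolding is_sup_def
  proof (intro conjI ballI impI)
    show "hom_class h \<in> carrier (cu_hom S T)" using path by (rule hom_class_closed)
    fix F assume "F \<in> range (\<lambda>n. hom_class (c n))"
    then obtain n where F: "F = hom_class (c n)" by blast
    have "path_le S T (c n) h"
      unfolding path_le_def
    proof
      fix l assume "l \<in> unit_rats"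
      then have "c n l \<in> D" unfolding D_def by blast
      then show "\<exists>m\<in>unit_rats. morph_below S T (c n l) (h m)" using h(2) P_below by blast
    qed
    then show "F \<preceq>\<^bsub>cu_hom S T\<^esub> hom_class h" unfolding F cu_hom_leq[OF c path] .
  next
    fix U assume U: "U \<in> carrier (cu_hom S T)"
      and ub: "\<forall>F\<in>range (\<lambda>n. hom_class (c n)). F \<preceq>\<^bsub>cu_hom S T\<^esub> U"
    obtain u where u: "u \<in> paths S T" "U = hom_class u" using hom_classE[OF U] .
    have le: "path_le S T (c n) u" for n
      using ub unfolding u(2) using cu_hom_leq[OF c u(1), of n] by blast
    have "path_le S T h u"
      unfolding path_le_def
    proof
      fix l assume l: "l \<in> unit_rats"
      obtain n m where m: "m \<in> unit_rats" "morph_below S T (h l) (c n m)" using bound[OF l] by blast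
      obtain k where "k \<in> unit_rats" "morph_below S T (c n m) (u k)"
        using le[of n] m(1) unfolding path_le_def by blast
      then show "\<exists>m\<in>unit_rats. morph_below S T (h l) (u m)"
        using morph_below_trans[OF pathsD(1)[OF c m(1)] m(2)] by blast
    qed
    then show "hom_class h \<preceq>\<^bsub>cu_hom S T\<^esub> U" unfolding u(2) cu_hom_leq[OF path u(1)] .
  qed
  then show ?thesis using that path bound by blast
qed

text \<open>The bound is known for one particular representative of the supremum; uniqueness of
  suprema carries it to every other one. The description of way-below, (O4) and the joint continuity
  of evaluation all rest on it.\<close>

lemma path_supD:
  assumes c: "\<And>n. c n \<in> paths S T" and inc: "increasing (cu_hom S T) (\<lambda>n. hom_class (c n))"
    and f: "f \<in> paths S T" and sup: "is_sup (cu_hom S T) (range (\<lambda>n. hom_class (c n))) (hom_class f)"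
    and l: "l \<in> unit_rats"
  shows "\<exists>n. \<exists>m\<in>unit_rats. morph_below S T (f l) (c n m)"
proof -
  obtain h where h: "h \<in> paths S T" "is_sup (cu_hom S T) (range (\<lambda>n. hom_class (c n))) (hom_class h)"
    "\<And>l. l \<in> unit_rats \<Longrightarrow> \<exists>n. \<exists>m\<in>unit_rats. morph_below S T (h l) (c n m)"
    using path_sup_exists[OF c inc] by blast
  have "hom_class f = hom_class h" using is_sup_unique[OF positively_ordered_cu_hom sup h(2)] .
  then have "path_le S T f h"
    using cu_hom_leq[OF f h(1)] H.le_refl[OF hom_class_closed[OF h(1)]] by simp
  then obtain k where k: "k \<in> unit_rats" "morph_below S T (f l) (h k)" using l unfolding path_le_def by blast
  then obtain n m where "m \<in> unit_rats" "morph_below S T (h k) (c n m)" using h(3) by blast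
  then show ?thesis using morph_below_trans[OF pathsD(1)[OF h(1) k(1)] k(2)] by blast
qed

section \<open>Truncated paths and the way-below relation of the internal hom\<close>

lemma increasing_hom_reps:
  assumes "increasing (cu_hom S T) M"
  obtains c where "\<And>n. c n \<in> paths S T" "M = (\<lambda>n. hom_class (c n))"
proof -
  have "\<forall>n. \<exists>f. f \<in> paths S T \<and> M n = hom_class f"
    using assms hom_classE unfolding increasing_def by metis
  from choice[OF this] show ?thesis using that by blast
qed

text \<open>The initial segment of g below 1 - 1/(n + 2), stretched over the whole unit interval.
  The summand 2 keeps the scaling factor strictly between 0 and 1 for n = 0 as well. These classes
  form the way-below sequence that (O2) asks for.\<close>

definition trunc :: "(rat \<Rightarrow> 'a \<Rightarrow> 'b) \<Rightarrow> nat \<Rightarrow> rat \<Rightarrow> 'a \<Rightarrow> 'b" where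
  "trunc g n l = g ((1 - 1 / of_nat (n + 2)) * l)"

lemma trunc_index:
  assumes "l \<in> unit_rats"
  shows "(1 - 1 / of_nat (n + 2)) * l \<in> unit_rats" "(1 - 1 / of_nat (n + 2)) * l < 1 - 1 / of_nat (n + 2)"
    and "1 - 1 / of_nat (n + 2) \<in> (unit_rats :: rat set)"
proof -
  have "0 < 1 - 1 / (of_nat (n + 2) :: rat)" "1 - 1 / (of_nat (n + 2) :: rat) < 1" by (auto simp: field_simps)
  moreover from this have "(1 - 1 / of_nat (n + 2)) * l < 1 - 1 / of_nat (n + 2)" "0 < (1 - 1 / of_nat (n + 2)) * l"
    using assms by (auto simp: unit_rats_def mult_pos_pos)
  ultimately show "(1 - 1 / of_nat (n + 2)) * l \<in> unit_rats" "(1 - 1 / of_nat (n + 2)) * l < 1 - 1 / of_nat (n + 2)"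
    "1 - 1 / of_nat (n + 2) \<in> (unit_rats :: rat set)"
    unfolding unit_rats_def greaterThanLessThan_iff by (meson less_trans)+
qed

lemma trunc_path: "g \<in> paths S T \<Longrightarrow> trunc g n \<in> paths S T"
  unfolding trunc_def paths_def using trunc_index(1,3)[of _ n] by (auto simp: unit_rats_def)

lemma trunc_below:
  "\<lbrakk>g \<in> paths S T; l \<in> unit_rats\<rbrakk> \<Longrightarrow> morph_below S T (trunc g n l) (g (1 - 1 / of_nat (n + 2)))"
  unfolding trunc_def using pathsD(2) trunc_index[of l n] by blast

lemma trunc_cofinal:
  assumes g: "g \<in> paths S T" and k: "k \<in> unit_rats" "k < 1 - 1 / of_nat (n + 2)"
  shows "\<exists>m\<in>unit_rats. morph_below S T (g k) (trunc g n m)"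
proof -
  define q where "q = (1 - 1 / of_nat (n + 2) :: rat)"
  have q: "0 < q" "k < q" "q < 1" using k by (auto simp: q_def unit_rats_def field_simps)
  obtain k' where k': "k < k'" "k' < q" using dense[OF q(2)] by blast
  have u: "k' \<in> unit_rats" "k' / q \<in> unit_rats" using k' k q by (auto simp: unit_rats_def)
  have "trunc g n (k' / q) = g k'" using q unfolding trunc_def q_def[symmetric] by simp
  then show ?thesis using pathsD(2)[OF g k(1) u(1) k'(1)] u(2) by (intro bexI[of _ "k' / q"]) simp_all
qed

lemma trunc_path_le: assumes g: "g \<in> paths S T" shows "path_le S T (trunc g n) g"
  unfolding path_le_def using trunc_below[OF g] trunc_index(3) by blast

text \<open>A rational k strictly between the two cut-off points separates the truncations, so one m
  serves for all l. This uniformity is what distinguishes way-below from the order.\<close>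

lemma trunc_bounded: "g \<in> paths S T \<Longrightarrow> \<exists>m\<in>unit_rats. \<forall>l\<in>unit_rats. morph_below S T (trunc g n l) (trunc g (Suc n) m)"
proof -
  assume g: "g \<in> paths S T"
  have lt: "1 - 1 / of_nat (n + 2) < 1 - 1 / (of_nat (Suc n + 2) :: rat)" by (simp add: frac_less2)
  obtain k where k: "1 - 1 / of_nat (n + 2) < k" "k < 1 - 1 / (of_nat (Suc n + 2) :: rat)" using dense[OF lt] by blast
  have q: "1 - 1 / of_nat (n + 2) \<in> (unit_rats :: rat set)" by (auto simp: unit_rats_def field_simps)
  have "1 - 1 / (of_nat (Suc n + 2) :: rat) < 1" by simp
  then have u: "k \<in> unit_rats" using k q unfolding unit_rats_def greaterThanLessThan_iff by linarith
  obtain m where m: "m \<in> unit_rats" "morph_below S T (g k) (trunc g (Suc n) m)"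
    using trunc_cofinal[OF g u] k(2) by blast
  have "morph_below S T (trunc g n l) (trunc g (Suc n) m)" if l: "l \<in> unit_rats" for l
  proof -
    have "morph_below S T (trunc g n l) (g k)"
      using morph_below_weaken[OF g q u _ trunc_below[OF g l]] k(1) by simp
    then show ?thesis using morph_below_trans[OF pathsD(1)[OF g u] _ m(2)] by blast
  qed
  then show ?thesis using m(1) by blast
qed

lemma trunc_increasing:
  assumes g: "g \<in> paths S T" shows "increasing (cu_hom S T) (\<lambda>n. hom_class (trunc g n))"
  unfolding increasing_def
proof (intro allI conjI)
  fix n
  show "hom_class (trunc g n) \<in> carrier (cu_hom S T)" by (rule hom_class_closed[OF trunc_path[OF g]])
  show "hom_class (trunc g n) \<preceq>\<^bsub>cu_hom S T\<^esub> hom_class (trunc g (Suc n))"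
    unfolding cu_hom_leq[OF trunc_path[OF g] trunc_path[OF g]] path_le_def using trunc_bounded[OF g] by blast
qed

lemma trunc_sup:
  assumes g: "g \<in> paths S T" shows "is_sup (cu_hom S T) (range (\<lambda>n. hom_class (trunc g n))) (hom_class g)"
  unfolding is_sup_def
proof (intro conjI ballI impI)
  show "hom_class g \<in> carrier (cu_hom S T)" by (rule hom_class_closed[OF g])
  show "F \<preceq>\<^bsub>cu_hom S T\<^esub> hom_class g" if "F \<in> range (\<lambda>n. hom_class (trunc g n))" for F
    using that cu_hom_leq[OF trunc_path[OF g] g] trunc_path_le[OF g] by blast
  fix U assume U: "U \<in> carrier (cu_hom S T)"
    and ub: "\<forall>F\<in>range (\<lambda>n. hom_class (trunc g n)). F \<preceq>\<^bsub>cu_hom S T\<^esub> U"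
  obtain u where u: "u \<in> paths S T" "U = hom_class u" using hom_classE[OF U] .
  have le: "path_le S T (trunc g n) u" for n
    using ub unfolding u(2) using cu_hom_leq[OF trunc_path[OF g] u(1), of n] by blast
  have "path_le S T g u"
    unfolding path_le_def
  proof
    fix l :: rat assume l: "l \<in> unit_rats"
    then have "0 < 1 - l" by (simp add: unit_rats_def)
    moreover obtain n :: nat where "1 / (1 - l) < of_nat n" using reals_Archimedean2 by blast
    ultimately have "l < 1 - 1 / of_nat (n + 2)" by (simp add: field_simps)
    then obtain m where m: "m \<in> unit_rats" "morph_below S T (g l) (trunc g n m)"
      using trunc_cofinal[OF g l] by blast
    then obtain k where "k \<in> unit_rats" "morph_below S T (trunc g n m) (u k)"
      using le unfolding path_le_def by blast
    then show "\<exists>m\<in>unit_rats. morph_below S T (g l) (u m)"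
      using morph_below_trans[OF pathsD(1)[OF trunc_path[OF g] m(1)] m(2)] by blast
  qed
  then show "hom_class g \<preceq>\<^bsub>cu_hom S T\<^esub> U" unfolding u(2) cu_hom_leq[OF g u(1)] .
qed

text \<open>Forward: g is the supremum of its truncations, and each truncation lies below a single
  member of g. Backward: the single member \<open>g m\<close> is overtaken by a member of some term
  of any sequence whose supremum dominates g.\<close>

lemma hom_way_below:
  assumes f: "f \<in> paths S T" and g: "g \<in> paths S T"
  shows "hom_class f \<lless>\<^bsub>cu_hom S T\<^esub> hom_class g \<longleftrightarrow>
    (\<exists>m\<in>unit_rats. \<forall>l\<in>unit_rats. morph_below S T (f l) (g m))"
proof
  assume wb: "hom_class f \<lless>\<^bsub>cu_hom S T\<^esub> hom_class g"
  obtain n where "hom_class f \<preceq>\<^bsub>cu_hom S T\<^esub> hom_class (trunc g n)"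
    using wb trunc_increasing[OF g] trunc_sup[OF g] H.le_refl[OF hom_class_closed[OF g]]
    unfolding way_below_def by blast
  then have le: "path_le S T f (trunc g n)" using cu_hom_leq[OF f trunc_path[OF g]] by blast
  show "\<exists>m\<in>unit_rats. \<forall>l\<in>unit_rats. morph_below S T (f l) (g m)"
  proof (intro bexI ballI)
    show q: "1 - 1 / of_nat (n + 2) \<in> (unit_rats :: rat set)" by (auto simp: unit_rats_def field_simps)
    fix l assume "l \<in> unit_rats"
    then obtain m where m: "m \<in> unit_rats" "morph_below S T (f l) (trunc g n m)"
      using le unfolding path_le_def by blast
    then show "morph_below S T (f l) (g (1 - 1 / of_nat (n + 2)))"
      using morph_below_trans[OF pathsD(1)[OF trunc_path[OF g] m(1)] m(2) trunc_below[OF g m(1)]] by blast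
  qed
next
  assume "\<exists>m\<in>unit_rats. \<forall>l\<in>unit_rats. morph_below S T (f l) (g m)"
  then obtain m where m: "m \<in> unit_rats" "\<And>l. l \<in> unit_rats \<Longrightarrow> morph_below S T (f l) (g m)" by blast
  show "hom_class f \<lless>\<^bsub>cu_hom S T\<^esub> hom_class g"
    unfolding way_below_def
  proof (intro conjI allI impI)
    show "hom_class f \<in> carrier (cu_hom S T)" "hom_class g \<in> carrier (cu_hom S T)"
      using f g by (auto intro: hom_class_closed)
    fix M U assume M: "increasing (cu_hom S T) M" and U: "is_sup (cu_hom S T) (range M) U"
      and le: "hom_class g \<preceq>\<^bsub>cu_hom S T\<^esub> U"
    obtain c where c: "\<And>n. c n \<in> paths S T" "M = (\<lambda>n. hom_class (c n))" using increasing_hom_reps[OF M] by blast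
    obtain u where u: "u \<in> paths S T" "U = hom_class u" using hom_classE[OF is_sup_carrier[OF U]] .
    have "path_le S T g u" using le cu_hom_leq[OF g u(1)] u(2) by simp
    then obtain k where k: "k \<in> unit_rats" "morph_below S T (g m) (u k)" using m(1) unfolding path_le_def by blast
    obtain n k' where k': "k' \<in> unit_rats" "morph_below S T (u k) (c n k')"
      using path_supD[OF c(1) M[unfolded c(2)] u(1) U[unfolded c(2) u(2)] k(1)] by blast
    have "morph_below S T (f l) (c n k')" if "l \<in> unit_rats" for l
      using morph_below_trans[OF pathsD(1)[OF g m(1)] m(2)[OF that]]
        morph_below_trans[OF pathsD(1)[OF u(1) k(1)] k(2) k'(2)] by blast
    then have "path_le S T f (c n)" using k'(1) unfolding path_le_def by blast
    then show "\<exists>k. hom_class f \<preceq>\<^bsub>cu_hom S T\<^esub> M k" unfolding c(2) using cu_hom_leq[OF f c(1)] by blast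
  qed
qed

theorem cu_semigroup_cu_hom: "cu_semigroup (cu_hom S T)" (is "cu_semigroup ?H")
proof (intro cu_semigroup.intro cu_semigroup_axioms.intro positively_ordered_cu_hom)
  fix M assume M: "increasing ?H M"
  obtain c where c: "\<And>n. c n \<in> paths S T" "M = (\<lambda>n. hom_class (c n))" using increasing_hom_reps[OF M] by blast
  show "\<exists>U. is_sup ?H (range M) U" using path_sup_exists[OF c(1) M[unfolded c(2)]] c(2) by metis
next
  fix G assume "G \<in> carrier ?H"
  then obtain g where g: "g \<in> paths S T" "G = hom_class g" using hom_classE by blast
  show "\<exists>c. (\<forall>n. c n \<lless>\<^bsub>?H\<^esub> c (Suc n)) \<and> is_sup ?H (range c) G"
    unfolding g(2)
    using trunc_sup[OF g(1)] hom_way_below[OF trunc_path[OF g(1)] trunc_path[OF g(1)]] trunc_bounded[OF g(1)]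
    by (intro exI[of _ "\<lambda>n. hom_class (trunc g n)"]) blast
next
  fix F F' G G' assume wb: "F' \<lless>\<^bsub>?H\<^esub> F" "G' \<lless>\<^bsub>?H\<^esub> G"
  obtain f where f: "f \<in> paths S T" "F = hom_class f" using wb hom_classE way_belowD by metis
  obtain f' where f': "f' \<in> paths S T" "F' = hom_class f'" using wb hom_classE way_belowD by metis
  obtain g where g: "g \<in> paths S T" "G = hom_class g" using wb hom_classE way_belowD by metis
  obtain g' where g': "g' \<in> paths S T" "G' = hom_class g'" using wb hom_classE way_belowD by metis
  obtain m where m: "m \<in> unit_rats" "\<And>l. l \<in> unit_rats \<Longrightarrow> morph_below S T (f' l) (f m)"
    using wb(1) unfolding f(2) f'(2) hom_way_below[OF f'(1) f(1)] by blast
  obtain k where k: "k \<in> unit_rats" "\<And>l. l \<in> unit_rats \<Longrightarrow> morph_below S T (g' l) (g k)"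
    using wb(2) unfolding g(2) g'(2) hom_way_below[OF g'(1) g(1)] by blast
  have u: "max m k \<in> unit_rats" using m(1) k(1) by (simp add: max_def)
  have "morph_below S T (f' l) (f (max m k))" "morph_below S T (g' l) (g (max m k))" if "l \<in> unit_rats" for l
    using morph_below_weaken[OF f(1) m(1) u _ m(2)[OF that]] morph_below_weaken[OF g(1) k(1) u _ k(2)[OF that]]
    by auto
  then show "F' \<oplus>\<^bsub>?H\<^esub> G' \<lless>\<^bsub>?H\<^esub> F \<oplus>\<^bsub>?H\<^esub> G"
    unfolding f(2) f'(2) g(2) g'(2) cu_hom_add[OF f(1) g(1)] cu_hom_add[OF f'(1) g'(1)]
      hom_way_below[OF paths_add[OF f'(1) g'(1)] paths_add[OF f(1) g(1)]]
    using u morph_below_add by blast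
next
  fix M D U V assume M: "increasing ?H M" and D: "increasing ?H D" and U: "is_sup ?H (range M) U" and V: "is_sup ?H (range D) V"
  obtain c where c: "\<And>n. c n \<in> paths S T" "M = (\<lambda>n. hom_class (c n))" using increasing_hom_reps[OF M] by blast
  obtain d where d: "\<And>n. d n \<in> paths S T" "D = (\<lambda>n. hom_class (d n))" using increasing_hom_reps[OF D] by blast
  obtain u where u: "u \<in> paths S T" "U = hom_class u" using hom_classE[OF is_sup_carrier[OF U]] .
  obtain v where v: "v \<in> paths S T" "V = hom_class v" using hom_classE[OF is_sup_carrier[OF V]] .
  have UV: "U \<in> carrier ?H" "V \<in> carrier ?H" using U V by (auto dest: is_sup_carrier)
  have CD: "M n \<in> carrier ?H" "D n \<in> carrier ?H" for n using M D by (auto simp: increasing_def)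
  show "is_sup ?H (range (\<lambda>n. M n \<oplus>\<^bsub>?H\<^esub> D n)) (U \<oplus>\<^bsub>?H\<^esub> V)"
    unfolding is_sup_def
  proof (intro conjI ballI impI)
    show "U \<oplus>\<^bsub>?H\<^esub> V \<in> carrier ?H" using UV by simp
    fix Y assume "Y \<in> range (\<lambda>n. M n \<oplus>\<^bsub>?H\<^esub> D n)"
    then obtain n where Y: "Y = M n \<oplus>\<^bsub>?H\<^esub> D n" by blast
    have "M n \<preceq>\<^bsub>?H\<^esub> U" "D n \<preceq>\<^bsub>?H\<^esub> V" using U V unfolding is_sup_def by blast+
    then have "M n \<oplus>\<^bsub>?H\<^esub> D n \<preceq>\<^bsub>?H\<^esub> U \<oplus>\<^bsub>?H\<^esub> D n" "D n \<oplus>\<^bsub>?H\<^esub> U \<preceq>\<^bsub>?H\<^esub> V \<oplus>\<^bsub>?H\<^esub> U"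
      using CD UV by (auto intro: H.add_right_mono)
    then show "Y \<preceq>\<^bsub>?H\<^esub> U \<oplus>\<^bsub>?H\<^esub> V"
      unfolding Y using CD[of n] UV H.le_trans[of "M n \<oplus>\<^bsub>?H\<^esub> D n" "U \<oplus>\<^bsub>?H\<^esub> D n" "U \<oplus>\<^bsub>?H\<^esub> V"]
      by (simp add: H.a_comm)
  next
    fix W assume W: "W \<in> carrier ?H" and ub: "\<forall>Y\<in>range (\<lambda>n. M n \<oplus>\<^bsub>?H\<^esub> D n). Y \<preceq>\<^bsub>?H\<^esub> W"
    obtain w where w: "w \<in> paths S T" "W = hom_class w" using hom_classE[OF W] .
    have le: "path_le S T (\<lambda>l a. c n l a \<oplus>\<^bsub>T\<^esub> d n l a) w" for n
    proof -
      have "M n \<oplus>\<^bsub>?H\<^esub> D n \<preceq>\<^bsub>?H\<^esub> W" using ub by blast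
      then show ?thesis
        unfolding c(2) d(2) w(2) cu_hom_add[OF c(1) d(1)] cu_hom_leq[OF paths_add[OF c(1) d(1)] w(1)] .
    qed
    have "path_le S T (\<lambda>l a. u l a \<oplus>\<^bsub>T\<^esub> v l a) w"
      unfolding path_le_def
    proof
      fix l assume l: "l \<in> unit_rats"
      \<comment> \<open>The two supremum paths are bounded at different terms and parameters.
        Passing to the larger index and then to the larger parameter makes the two bounds
        addable.\<close>
      obtain n k where k: "k \<in> unit_rats" "morph_below S T (u l) (c n k)"
        using path_supD[OF c(1) M[unfolded c(2)] u(1) U[unfolded c(2) u(2)] l] by blast
      obtain n' k' where k': "k' \<in> unit_rats" "morph_below S T (v l) (d n' k')"
        using path_supD[OF d(1) D[unfolded d(2)] v(1) V[unfolded d(2) v(2)] l] by blast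
      let ?N = "max n n'"
      obtain i where i: "i \<in> unit_rats" "morph_below S T (c n k) (c ?N i)"
        using hom_class_increasing[OF c(1) M[unfolded c(2)], of n ?N] k(1) unfolding path_le_def by auto
      obtain i' where i': "i' \<in> unit_rats" "morph_below S T (d n' k') (d ?N i')"
        using hom_class_increasing[OF d(1) D[unfolded d(2)], of n' ?N] k'(1) unfolding path_le_def by auto
      have m: "max i i' \<in> unit_rats" using i(1) i'(1) by (simp add: max_def)
      have "morph_below S T (u l) (c ?N i)" "morph_below S T (v l) (d ?N i')"
        using morph_below_trans[OF pathsD(1)[OF c(1) k(1)] k(2) i(2)]
          morph_below_trans[OF pathsD(1)[OF d(1) k'(1)] k'(2) i'(2)] by blast+
      then have "morph_below S T (u l) (c ?N (max i i'))" "morph_below S T (v l) (d ?N (max i i'))"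
        using morph_below_weaken[OF c(1) i(1) m] morph_below_weaken[OF d(1) i'(1) m] by auto
      then have 1: "morph_below S T (\<lambda>a. u l a \<oplus>\<^bsub>T\<^esub> v l a) (\<lambda>a. c ?N (max i i') a \<oplus>\<^bsub>T\<^esub> d ?N (max i i') a)"
        by (rule morph_below_add)
      obtain j where "j \<in> unit_rats"
          "morph_below S T (\<lambda>a. c ?N (max i i') a \<oplus>\<^bsub>T\<^esub> d ?N (max i i') a) (w j)"
        using le[of ?N] m unfolding path_le_def by blast
      then show "\<exists>m\<in>unit_rats. morph_below S T (\<lambda>a. u l a \<oplus>\<^bsub>T\<^esub> v l a) (w m)"
        using morph_below_trans[OF gen_cu_morphism_add[OF pathsD(1)[OF c(1) m] pathsD(1)[OF d(1) m]] 1] by blast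
    qed
    then show "U \<oplus>\<^bsub>?H\<^esub> V \<preceq>\<^bsub>?H\<^esub> W"
      unfolding u(2) v(2) w(2) cu_hom_add[OF u(1) v(1)] cu_hom_leq[OF paths_add[OF u(1) v(1)] w(1)] .
  qed
qed

end


section \<open>Evaluation is a Cu-bimorphism\<close>

context cu_pair
begin

interpretation H: cu_semigroup "cu_hom S T"
  by (rule cu_semigroup_cu_hom)

lemma endpoint_upper:
  "\<lbrakk>f \<in> paths S T; l \<in> unit_rats; a \<in> carrier S\<rbrakk> \<Longrightarrow> f l a \<preceq>\<^bsub>T\<^esub> endpoint S T (hom_class f) a"
  using endpoint_path_class unfolding is_sup_def by blast

lemma endpoint_least:
  "\<lbrakk>f \<in> paths S T; a \<in> carrier S; u \<in> carrier T; \<And>l. l \<in> unit_rats \<Longrightarrow> f l a \<preceq>\<^bsub>T\<^esub> u\<rbrakk> \<Longrightarrow>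
     endpoint S T (hom_class f) a \<preceq>\<^bsub>T\<^esub> u"
  using endpoint_path_class[of f a] unfolding is_sup_def by blast

lemma endpoint_class_closed:
  "\<lbrakk>f \<in> paths S T; a \<in> carrier S\<rbrakk> \<Longrightarrow> endpoint S T (hom_class f) a \<in> carrier T"
  using endpoint_path_class is_sup_carrier by metis

lemma path_value: "\<lbrakk>f \<in> paths S T; l \<in> unit_rats; a \<in> carrier S\<rbrakk> \<Longrightarrow> f l a \<in> carrier T"
  using gen_cu_morphismD(1)[OF pathsD(1)] by blast

text \<open>(O4) and uniqueness of suprema are available for sequences, so the supremum over all
  rationals is replaced by one over a cofinal sequence.\<close>

lemma endpoint_sequence:
  assumes f: "f \<in> paths S T" and a: "a \<in> carrier S"
  shows "increasing T (\<lambda>n. f (1 - 1 / of_nat (n + 2)) a)"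
    and "is_sup T (range (\<lambda>n. f (1 - 1 / of_nat (n + 2)) a)) (endpoint S T (hom_class f) a)"
proof -
  define q :: "nat \<Rightarrow> rat" where "q n = 1 - 1 / of_nat (n + 2)" for n
  have q: "q n \<in> unit_rats" "q n \<le> q (Suc n)" for n
    by (auto simp: q_def unit_rats_def field_simps)
  have "increasing T (\<lambda>n. f (q n) a)"
    using q path_value[OF f q(1) a] path_mono[OF f q(1) q(1) q(2) a] by (auto simp: increasing_def)
  then show "increasing T (\<lambda>n. f (1 - 1 / of_nat (n + 2)) a)" unfolding q_def .
  have "is_sup T (range (\<lambda>n. f (q n) a)) (endpoint S T (hom_class f) a)"
    unfolding is_sup_def
  proof (intro conjI ballI impI)
    show "endpoint S T (hom_class f) a \<in> carrier T" using f a by (rule endpoint_class_closed)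
    show "x \<preceq>\<^bsub>T\<^esub> endpoint S T (hom_class f) a" if "x \<in> range (\<lambda>n. f (q n) a)" for x
      using that endpoint_upper[OF f q(1) a] by blast
    fix u assume u: "u \<in> carrier T" "\<forall>x\<in>range (\<lambda>n. f (q n) a). x \<preceq>\<^bsub>T\<^esub> u"
    show "endpoint S T (hom_class f) a \<preceq>\<^bsub>T\<^esub> u"
    proof (rule endpoint_least[OF f a u(1)])
      fix l :: rat assume l: "l \<in> unit_rats"
      then have "0 < 1 - l" by (simp add: unit_rats_def)
      moreover obtain n :: nat where "1 / (1 - l) < of_nat n" using reals_Archimedean2 by blast
      ultimately have "l \<le> q n" unfolding q_def by (simp add: field_simps)
      then have "f l a \<preceq>\<^bsub>T\<^esub> f (q n) a" using path_mono[OF f l q(1) _ a] by blast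
      moreover have "f (q n) a \<preceq>\<^bsub>T\<^esub> u" using u(2) by blast
      ultimately show "f l a \<preceq>\<^bsub>T\<^esub> u"
        using T.le_trans[OF path_value[OF f l a] path_value[OF f q(1) a] u(1)] by blast
    qed
  qed
  then show "is_sup T (range (\<lambda>n. f (1 - 1 / of_nat (n + 2)) a)) (endpoint S T (hom_class f) a)"
    unfolding q_def .
qed

lemma endpoint_closed: "\<lbrakk>F \<in> carrier (cu_hom S T); a \<in> carrier S\<rbrakk> \<Longrightarrow> endpoint S T F a \<in> carrier T"
  using hom_classE endpoint_class_closed by metis

lemma endpoint_mono_left:
  assumes "F \<in> carrier (cu_hom S T)" "G \<in> carrier (cu_hom S T)" "F \<preceq>\<^bsub>cu_hom S T\<^esub> G" and a: "a \<in> carrier S"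
  shows "endpoint S T F a \<preceq>\<^bsub>T\<^esub> endpoint S T G a"
proof -
  obtain f where f: "f \<in> paths S T" "F = hom_class f" using hom_classE[OF assms(1)] .
  obtain g where g: "g \<in> paths S T" "G = hom_class g" using hom_classE[OF assms(2)] .
  have le: "path_le S T f g" using assms(3) cu_hom_leq[OF f(1) g(1)] f(2) g(2) by simp
  show ?thesis
    unfolding f(2) g(2)
  proof (rule endpoint_least[OF f(1) a endpoint_class_closed[OF g(1) a]])
    fix l assume l: "l \<in> unit_rats"
    then obtain m where m: "m \<in> unit_rats" "morph_below S T (f l) (g m)" using le unfolding path_le_def by blast
    show "f l a \<preceq>\<^bsub>T\<^esub> endpoint S T (hom_class g) a"
      by (rule T.le_trans[OF path_value[OF f(1) l a] path_value[OF g(1) m(1) a] endpoint_class_closed[OF g(1) a]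
            morph_below_le(2)[OF pathsD(1)[OF f(1) l] m(2) a] endpoint_upper[OF g(1) m(1) a]])
  qed
qed

lemma endpoint_mono_right:
  assumes "F \<in> carrier (cu_hom S T)" and a: "a \<in> carrier S" "b \<in> carrier S" "a \<preceq>\<^bsub>S\<^esub> b"
  shows "endpoint S T F a \<preceq>\<^bsub>T\<^esub> endpoint S T F b"
proof -
  obtain f where f: "f \<in> paths S T" "F = hom_class f" using hom_classE[OF assms(1)] .
  show ?thesis
    unfolding f(2)
  proof (rule endpoint_least[OF f(1) a(1) endpoint_class_closed[OF f(1) a(2)]])
    fix l assume l: "l \<in> unit_rats"
    show "f l a \<preceq>\<^bsub>T\<^esub> endpoint S T (hom_class f) b"
      by (rule T.le_trans[OF path_value[OF f(1) l a(1)] path_value[OF f(1) l a(2)] endpoint_class_closed[OF f(1) a(2)]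
            gen_cu_morphismD(4)[OF pathsD(1)[OF f(1) l] a] endpoint_upper[OF f(1) l a(2)]])
  qed
qed

theorem endpoint_bimorphism: "cu_bimorphism (cu_hom S T) S T (endpoint S T)"
  unfolding cu_bimorphism_def
proof (intro conjI ballI allI impI)
  fix F G a assume F: "F \<in> carrier (cu_hom S T)" and G: "G \<in> carrier (cu_hom S T)" and a: "a \<in> carrier S"
  obtain f where f: "f \<in> paths S T" "F = hom_class f" using hom_classE[OF F] .
  obtain g where g: "g \<in> paths S T" "G = hom_class g" using hom_classE[OF G] .
  show "endpoint S T (F \<oplus>\<^bsub>cu_hom S T\<^esub> G) a = endpoint S T F a \<oplus>\<^bsub>T\<^esub> endpoint S T G a"
    unfolding f(2) g(2) cu_hom_add[OF f(1) g(1)]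
    by (rule is_sup_unique[OF T.posgp endpoint_sequence(2)[OF paths_add[OF f(1) g(1)] a]
          T.O4[OF endpoint_sequence(1)[OF f(1) a] endpoint_sequence(1)[OF g(1) a]
            endpoint_sequence(2)[OF f(1) a] endpoint_sequence(2)[OF g(1) a]]])
next
  fix F a b assume F: "F \<in> carrier (cu_hom S T)" and a: "a \<in> carrier S" and b: "b \<in> carrier S"
  obtain f where f: "f \<in> paths S T" "F = hom_class f" using hom_classE[OF F] .
  have q: "1 - 1 / of_nat (n + 2) \<in> (unit_rats :: rat set)" for n by (auto simp: unit_rats_def field_simps)
  have "is_sup T (range (\<lambda>n. f (1 - 1 / of_nat (n + 2)) (a \<oplus>\<^bsub>S\<^esub> b)))
      (endpoint S T (hom_class f) a \<oplus>\<^bsub>T\<^esub> endpoint S T (hom_class f) b)"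
    unfolding gen_cu_morphismD(2)[OF pathsD(1)[OF f(1) q] a b]
    by (rule T.O4[OF endpoint_sequence(1)[OF f(1) a] endpoint_sequence(1)[OF f(1) b]
          endpoint_sequence(2)[OF f(1) a] endpoint_sequence(2)[OF f(1) b]])
  then show "endpoint S T F (a \<oplus>\<^bsub>S\<^esub> b) = endpoint S T F a \<oplus>\<^bsub>T\<^esub> endpoint S T F b"
    unfolding f(2)
    using is_sup_unique[OF T.posgp endpoint_sequence(2)[OF f(1) S.a_closed[OF a b]]] by blast
next
  fix b assume b: "b \<in> carrier S"
  have "is_sup T (range (\<lambda>n::nat. \<zero>\<^bsub>T\<^esub>)) \<zero>\<^bsub>T\<^esub>" by (auto simp: is_sup_def)
  then show "endpoint S T \<zero>\<^bsub>cu_hom S T\<^esub> b = \<zero>\<^bsub>T\<^esub>"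
    unfolding hom_zero using is_sup_unique[OF T.posgp endpoint_sequence(2)[OF paths_zero b]] by blast
next
  fix F assume F: "F \<in> carrier (cu_hom S T)"
  obtain f where f: "f \<in> paths S T" "F = hom_class f" using hom_classE[OF F] .
  have q: "1 - 1 / of_nat (n + 2) \<in> (unit_rats :: rat set)" for n by (auto simp: unit_rats_def field_simps)
  have "is_sup T (range (\<lambda>n. f (1 - 1 / of_nat (n + 2)) \<zero>\<^bsub>S\<^esub>)) \<zero>\<^bsub>T\<^esub>"
    unfolding gen_cu_morphismD(3)[OF pathsD(1)[OF f(1) q]] by (auto simp: is_sup_def)
  then show "endpoint S T F \<zero>\<^bsub>S\<^esub> = \<zero>\<^bsub>T\<^esub>"
    unfolding f(2) using is_sup_unique[OF T.posgp endpoint_sequence(2)[OF f(1) S.zero_closed]] by blast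
next
  fix M b U t assume M: "increasing (cu_hom S T) M" and b: "increasing S b"
    and U: "is_sup (cu_hom S T) (range M) U" and t: "is_sup S (range b) t"
  have Mc: "M n \<in> carrier (cu_hom S T)" and bc: "b n \<in> carrier S" for n
    using M b by (auto simp: increasing_def)
  have Uc: "U \<in> carrier (cu_hom S T)" and tc: "t \<in> carrier S" using U t by (auto dest: is_sup_carrier)
  have MU: "M n \<preceq>\<^bsub>cu_hom S T\<^esub> U" and bt: "b n \<preceq>\<^bsub>S\<^esub> t" for n using U t by (auto simp: is_sup_def)
  have mono: "endpoint S T F x \<preceq>\<^bsub>T\<^esub> endpoint S T G y"
    if "F \<in> carrier (cu_hom S T)" "G \<in> carrier (cu_hom S T)" "F \<preceq>\<^bsub>cu_hom S T\<^esub> G"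
      "x \<in> carrier S" "y \<in> carrier S" "x \<preceq>\<^bsub>S\<^esub> y" for F G x y
    by (rule T.le_trans[OF endpoint_closed[OF that(1,4)] endpoint_closed[OF that(2,4)] endpoint_closed[OF that(2,5)]
          endpoint_mono_left[OF that(1-4)] endpoint_mono_right[OF that(2,4-6)]])
  show "is_sup T (range (\<lambda>k. endpoint S T (M k) (b k))) (endpoint S T U t)"
    unfolding is_sup_def
  proof (intro conjI ballI impI)
    show "endpoint S T U t \<in> carrier T" using Uc tc by (rule endpoint_closed)
    show "x \<preceq>\<^bsub>T\<^esub> endpoint S T U t" if "x \<in> range (\<lambda>k. endpoint S T (M k) (b k))" for x
      using that mono[OF Mc Uc MU bc tc bt] by blast
    fix w assume w: "w \<in> carrier T" "\<forall>x\<in>range (\<lambda>k. endpoint S T (M k) (b k)). x \<preceq>\<^bsub>T\<^esub> w"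
    obtain c where c: "\<And>n. c n \<in> paths S T" "M = (\<lambda>n. hom_class (c n))" using increasing_hom_reps[OF M] by blast
    obtain u where u: "u \<in> paths S T" "U = hom_class u" using hom_classE[OF Uc] .
    show "endpoint S T U t \<preceq>\<^bsub>T\<^esub> w"
      unfolding u(2)
    proof (rule endpoint_least[OF u(1) tc w(1)])
      fix l assume l: "l \<in> unit_rats"
      obtain n m where m: "m \<in> unit_rats" "morph_below S T (u l) (c n m)"
        using path_supD[OF c(1) M[unfolded c(2)] u(1) U[unfolded c(2) u(2)] l] by blast
      \<comment> \<open>Only n depends on l; k stays free. Joint continuity is thereby reduced to
        continuity of the single morphism \<open>u l\<close> along b.\<close>
      have "u l (b k) \<preceq>\<^bsub>T\<^esub> w" for k
      proof -
        have 1: "u l (b k) \<preceq>\<^bsub>T\<^esub> c n m (b k)"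
          using morph_below_le(2)[OF pathsD(1)[OF u(1) l] m(2) bc] .
        have 2: "c n m (b k) \<preceq>\<^bsub>T\<^esub> endpoint S T (M n) (b k)"
          unfolding c(2) by (rule endpoint_upper[OF c(1) m(1) bc])
        have 3: "endpoint S T (M n) (b k) \<preceq>\<^bsub>T\<^esub> endpoint S T (M (max n k)) (b (max n k))"
          by (intro mono Mc bc S.increasing_le[OF b] H.increasing_le[OF M]) auto
        have 4: "endpoint S T (M (max n k)) (b (max n k)) \<preceq>\<^bsub>T\<^esub> w" using w(2) by blast
        note cl = path_value[OF u(1) l bc] path_value[OF c(1) m(1) bc] endpoint_closed[OF Mc bc]
        show ?thesis
          using T.le_trans[OF cl(1,2) w(1) 1 T.le_trans[OF cl(2,3) w(1) 2 T.le_trans[OF cl(3,3) w(1) 3 4]]] .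
      qed
      then show "u l t \<preceq>\<^bsub>T\<^esub> w"
        using gen_cu_morphismD(5)[OF pathsD(1)[OF u(1) l] b t] w(1) unfolding is_sup_def by blast
    qed
  qed
next
  fix F' F a' a assume wb: "F' \<lless>\<^bsub>cu_hom S T\<^esub> F" "a' \<lless>\<^bsub>S\<^esub> a"
  obtain f where f: "f \<in> paths S T" "F = hom_class f" using wb(1) hom_classE way_belowD by metis
  obtain f' where f': "f' \<in> paths S T" "F' = hom_class f'" using wb(1) hom_classE way_belowD by metis
  have a: "a \<in> carrier S" "a' \<in> carrier S" using wb(2) by (auto dest: way_belowD)
  \<comment> \<open>One m bounds all members of F', so their supremum at a' is still below
    \<open>f m a'\<close>. The strict gain then comes from the step m < k inside the path f.\<close>
  obtain m where m: "m \<in> unit_rats" "\<And>l. l \<in> unit_rats \<Longrightarrow> morph_below S T (f' l) (f m)"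
    using wb(1) unfolding f(2) f'(2) hom_way_below[OF f'(1) f(1)] by blast
  obtain k where k: "k \<in> unit_rats" "m < k" using unit_rats_above[OF m(1)] .
  have 1: "endpoint S T F' a' \<preceq>\<^bsub>T\<^esub> f m a'"
    unfolding f'(2)
    by (rule endpoint_least[OF f'(1) a(2) path_value[OF f(1) m(1) a(2)]])
      (use morph_below_le(2)[OF pathsD(1)[OF f'(1)] m(2) a(2)] in blast)
  have 2: "f m a' \<lless>\<^bsub>T\<^esub> f k a" using pathsD(2)[OF f(1) m(1) k] wb(2) unfolding morph_below_def by blast
  have 3: "f k a \<preceq>\<^bsub>T\<^esub> endpoint S T F a" unfolding f(2) by (rule endpoint_upper[OF f(1) k(1) a(1)])
  have "endpoint S T F' a' \<in> carrier T" unfolding f'(2) by (rule endpoint_class_closed[OF f'(1) a(2)])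
  moreover have "endpoint S T F a \<in> carrier T" unfolding f(2) by (rule endpoint_class_closed[OF f(1) a(1)])
  ultimately show "endpoint S T F' a' \<lless>\<^bsub>T\<^esub> endpoint S T F a"
    using T.way_below_le[OF _ T.le_way_below[OF _ 1 2] 3] by blast
qed (auto intro: endpoint_closed endpoint_mono_left endpoint_mono_right)

end


section \<open>Functoriality\<close>

lemma gen_cu_morphism_increasing:
  assumes "gen_cu_morphism S T f" "increasing S c" shows "increasing T (\<lambda>n. f (c n))"
  using assms unfolding gen_cu_morphism_def increasing_def by blast

lemma cu_morphism_comp:
  assumes f: "cu_morphism S T f" and g: "cu_morphism T P g"
  shows "cu_morphism S P (\<lambda>a. g (f a))"
  unfolding cu_morphism_def gen_cu_morphism_def
proof (intro conjI ballI allI impI)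
  fix c s assume "increasing S c" "is_sup S (range c) s"
  then show "is_sup P (range (\<lambda>n. g (f (c n)))) (g (f s))"
    using f cu_morphismD(5)[OF f] cu_morphismD(5)[OF g] gen_cu_morphism_increasing unfolding cu_morphism_def by blast
qed (auto simp: cu_morphismD[OF f] cu_morphismD[OF g])

lemma cu_bimorphism_comp_left:
  assumes f: "cu_morphism S' S f" and \<phi>: "cu_bimorphism S T P \<phi>"
  shows "cu_bimorphism S' T P (\<lambda>a b. \<phi> (f a) b)"
proof -
  have inc: "increasing S' c \<Longrightarrow> increasing S (\<lambda>n. f (c n))" for c
    using f gen_cu_morphism_increasing unfolding cu_morphism_def by blast
  show ?thesis
    using \<phi> unfolding cu_bimorphism_def
    by (simp add: cu_morphismD[OF f] inc)
qed

text \<open>Suprema and the way-below relation are defined from the order alone, so an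
  order-isomorphism transports both, and zero as the least element.\<close>

lemma cu_iso_inverse:
  assumes "cu_semigroup S" "cu_semigroup T" and f: "cu_iso S T f"
  shows "cu_morphism T S (inv_into (carrier S) f)"
proof -
  interpret S: cu_semigroup S by fact
  interpret T: cu_semigroup T by fact
  let ?g = "inv_into (carrier S) f"
  have bij: "bij_betw f (carrier S) (carrier T)"
    and add: "\<And>a b. a \<in> carrier S \<Longrightarrow> b \<in> carrier S \<Longrightarrow> f (a \<oplus>\<^bsub>S\<^esub> b) = f a \<oplus>\<^bsub>T\<^esub> f b"
    and le: "\<And>a b. a \<in> carrier S \<Longrightarrow> b \<in> carrier S \<Longrightarrow> a \<preceq>\<^bsub>S\<^esub> b \<longleftrightarrow> f a \<preceq>\<^bsub>T\<^esub> f b"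
    using f unfolding cu_iso_def by auto
  have fc: "f a \<in> carrier T" if "a \<in> carrier S" for a using bij that by (auto simp: bij_betw_def)
  have gc: "?g b \<in> carrier S" and fg: "f (?g b) = b" if "b \<in> carrier T" for b
    using bij that by (auto simp: bij_betw_def f_inv_into_f inv_into_into)
  have gf: "?g (f a) = a" if "a \<in> carrier S" for a using bij that by (auto simp: bij_betw_def)
  have gle: "?g a \<preceq>\<^bsub>S\<^esub> ?g b \<longleftrightarrow> a \<preceq>\<^bsub>T\<^esub> b" if "a \<in> carrier T" "b \<in> carrier T" for a b
    using le[OF gc gc] that fg by simp
  have sup_g: "is_sup S (range (\<lambda>n. ?g (c n))) (?g s)" if "increasing T c" "is_sup T (range c) s" for c s
    unfolding is_sup_def
  proof (intro conjI ballI impI)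
    have c: "c n \<in> carrier T" for n using that(1) by (auto simp: increasing_def)
    have s: "s \<in> carrier T" using that(2) by (rule is_sup_carrier)
    show "?g s \<in> carrier S" using gc s .
    show "x \<preceq>\<^bsub>S\<^esub> ?g s" if "x \<in> range (\<lambda>n. ?g (c n))" for x
      using that gle[OF c s] \<open>is_sup T (range c) s\<close> by (auto simp: is_sup_def)
    fix u assume u: "u \<in> carrier S" "\<forall>x\<in>range (\<lambda>n. ?g (c n)). x \<preceq>\<^bsub>S\<^esub> u"
    have "c n \<preceq>\<^bsub>T\<^esub> f u" for n using u(2) le[OF gc[OF c[of n]] u(1)] fg[OF c] by auto
    then have "s \<preceq>\<^bsub>T\<^esub> f u" using that(2) fc[OF u(1)] by (auto simp: is_sup_def)
    then show "?g s \<preceq>\<^bsub>S\<^esub> u" using le[OF gc[OF s] u(1)] fg[OF s] by simp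
  qed
  have sup_f: "is_sup T (range (\<lambda>n. f (c n))) (f s)" if "increasing S c" "is_sup S (range c) s" for c s
    unfolding is_sup_def
  proof (intro conjI ballI impI)
    have c: "c n \<in> carrier S" for n using that(1) by (auto simp: increasing_def)
    have s: "s \<in> carrier S" using that(2) by (rule is_sup_carrier)
    show "f s \<in> carrier T" using fc s .
    show "x \<preceq>\<^bsub>T\<^esub> f s" if "x \<in> range (\<lambda>n. f (c n))" for x
      using that le[OF c s] \<open>is_sup S (range c) s\<close> by (auto simp: is_sup_def)
    fix u assume u: "u \<in> carrier T" "\<forall>x\<in>range (\<lambda>n. f (c n)). x \<preceq>\<^bsub>T\<^esub> u"
    have "c n \<preceq>\<^bsub>S\<^esub> ?g u" for n using u(2) le[OF c gc[OF u(1)], of n] fg[OF u(1)] by auto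
    then have "s \<preceq>\<^bsub>S\<^esub> ?g u" using that(2) gc[OF u(1)] by (auto simp: is_sup_def)
    then show "f s \<preceq>\<^bsub>T\<^esub> u" using le[OF s gc[OF u(1)]] fg[OF u(1)] by simp
  qed
  show ?thesis
    unfolding cu_morphism_def gen_cu_morphism_def
  proof (intro conjI ballI allI impI)
    show "?g \<in> carrier T \<rightarrow> carrier S" using gc by blast
    fix a b assume ab: "a \<in> carrier T" "b \<in> carrier T"
    show "?g (a \<oplus>\<^bsub>T\<^esub> b) = ?g a \<oplus>\<^bsub>S\<^esub> ?g b"
      using gf[of "?g a \<oplus>\<^bsub>S\<^esub> ?g b"] gc ab fg by (simp add: add)
    show "?g a \<preceq>\<^bsub>S\<^esub> ?g b" if "a \<preceq>\<^bsub>T\<^esub> b" using that gle ab by simp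
  next
    have "\<zero>\<^bsub>T\<^esub> \<preceq>\<^bsub>T\<^esub> f \<zero>\<^bsub>S\<^esub>" using fc by simp
    then have "?g \<zero>\<^bsub>T\<^esub> \<preceq>\<^bsub>S\<^esub> \<zero>\<^bsub>S\<^esub>" using gle[of "\<zero>\<^bsub>T\<^esub>" "f \<zero>\<^bsub>S\<^esub>"] gf[of "\<zero>\<^bsub>S\<^esub>"] fc by simp
    then show "?g \<zero>\<^bsub>T\<^esub> = \<zero>\<^bsub>S\<^esub>" using gc[of "\<zero>\<^bsub>T\<^esub>"] by (intro S.le_antisym) auto
  next
    fix a b assume wb: "a \<lless>\<^bsub>T\<^esub> b"
    then have ab: "a \<in> carrier T" "b \<in> carrier T" by (auto dest: way_belowD)
    show "?g a \<lless>\<^bsub>S\<^esub> ?g b"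
      unfolding way_below_def
    proof (intro conjI allI impI)
      show "?g a \<in> carrier S" "?g b \<in> carrier S" using gc ab by auto
      fix c s assume c: "increasing S c" "is_sup S (range c) s" "?g b \<preceq>\<^bsub>S\<^esub> s"
      have cc: "c n \<in> carrier S" "c n \<preceq>\<^bsub>S\<^esub> c (Suc n)" for n using c(1) by (auto simp: increasing_def)
      have s: "s \<in> carrier S" using c(2) by (rule is_sup_carrier)
      have "increasing T (\<lambda>n. f (c n))" using cc fc le by (auto simp: increasing_def)
      moreover have "b \<preceq>\<^bsub>T\<^esub> f s" using c(3) le[OF gc s] fg ab by simp
      ultimately obtain k where "a \<preceq>\<^bsub>T\<^esub> f (c k)" using wb sup_f[OF c(1,2)] unfolding way_below_def by blast
      then show "\<exists>k. ?g a \<preceq>\<^bsub>S\<^esub> c k" using le[OF gc cc(1)] fg ab by auto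
    qed
  qed (fact sup_g)
qed

lemma pure_tensor_closed:
  assumes "cu_semigroup S" "cu_semigroup T" "a \<in> carrier S" "b \<in> carrier T"
  shows "pure_tensor S T a b \<in> carrier (cu_tensor S T)"
  using cu_bimorphism_pure_tensor[OF assms(1,2), unfolded cu_bimorphism_def, THEN conjunct1] assms(3,4)
  by blast

lemma cu_tensor_morphism_eqI:
  assumes cu: "cu_semigroup S" "cu_semigroup T" "cu_semigroup P"
    and m: "cu_morphism (cu_tensor S T) P \<alpha>" "cu_morphism (cu_tensor S T) P \<beta>"
    and eq: "\<And>a b. a \<in> carrier S \<Longrightarrow> b \<in> carrier T \<Longrightarrow>
      \<alpha> (pure_tensor S T a b) = \<beta> (pure_tensor S T a b)"
    and I: "I \<in> carrier (cu_tensor S T)"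
  shows "\<alpha> I = \<beta> I"
proof -
  interpret P: cu_semigroup P by fact
  have c: "\<beta> (pure_tensor S T a b) \<in> carrier P" if "a \<in> carrier S" "b \<in> carrier T" for a b
    using cu_morphismD(1)[OF m(2) pure_tensor_closed[OF cu(1,2) that]] .
  have "\<forall>I\<in>carrier (cu_tensor S T). \<alpha> I \<preceq>\<^bsub>P\<^esub> \<beta> I" "\<forall>I\<in>carrier (cu_tensor S T). \<beta> I \<preceq>\<^bsub>P\<^esub> \<alpha> I"
    using cu_tensor_morphism_le_iff[OF cu m] cu_tensor_morphism_le_iff[OF cu m(2,1)] eq c by auto
  then show ?thesis using I cu_morphismD(1)[OF m(1) I] cu_morphismD(1)[OF m(2) I] P.le_antisym by blast
qed


section \<open>The embedding of a Cu-semiring into its internal hom\<close>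

text \<open>The analogue for elements of a path with endpoint r: left multiplication by its members
  is a path of morphisms. Stating cofinality through way-below avoids suprema over the
  rationals.\<close>

definition approximates :: "('a, 'm) cu_scheme \<Rightarrow> (rat \<Rightarrow> 'a) \<Rightarrow> 'a \<Rightarrow> bool" where
  "approximates S f r \<longleftrightarrow> (\<forall>l'\<in>unit_rats. \<forall>l\<in>unit_rats. l' < l \<longrightarrow> f l' \<lless>\<^bsub>S\<^esub> f l) \<and>
     (\<forall>l\<in>unit_rats. f l \<lless>\<^bsub>S\<^esub> r) \<and> (\<forall>s. s \<lless>\<^bsub>S\<^esub> r \<longrightarrow> (\<exists>l\<in>unit_rats. s \<lless>\<^bsub>S\<^esub> f l))"

lemma (in cu_semigroup) way_below_trans: "a \<lless> b \<Longrightarrow> b \<lless> c \<Longrightarrow> a \<lless> c"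
  using le_way_below[OF _ way_below_imp_le] way_belowD[of S a b] by blast

lemma (in cu_semigroup) approximates_exists:
  assumes "r \<in> carrier S" shows "\<exists>f. approximates S f r"
proof -
  obtain c where c: "\<forall>n. c n \<lless> c (Suc n)" "is_sup S (range c) r" using O2[OF assms] by blast
  have inc: "increasing S c" by (rule way_below_increasing[OF c(1)])
  have cc: "c n \<in> carrier S" for n using inc by (auto simp: increasing_def)
  have dir: "\<exists>z\<in>range c. x \<lless> z \<and> y \<lless> z" if xy: "x \<in> range c" "y \<in> range c" for x y
  proof -
    obtain i j where ij: "x = c i" "y = c j" using xy by blast
    have "c i \<preceq> c (max i j)" "c j \<preceq> c (max i j)" by (auto intro: increasing_le[OF inc])
    then have "x \<lless> c (Suc (max i j))" "y \<lless> c (Suc (max i j))"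
      unfolding ij using le_way_below[OF cc _ c(1)[rule_format]] by blast+
    then show ?thesis by blast
  qed
  obtain f where f: "\<And>l' l. \<lbrakk>l' \<in> unit_rats; l \<in> unit_rats; l' < l\<rbrakk> \<Longrightarrow> f l' \<lless> f l"
    "\<And>x. x \<in> range c \<Longrightarrow> \<exists>l\<in>unit_rats. x \<lless> f l" "\<And>l. l \<in> unit_rats \<Longrightarrow> \<exists>x\<in>range c. f l \<lless> x"
    by (rule rational_path[of "(\<lless>)" "range c"])
      (use dir in \<open>auto intro: way_below_trans elim: way_below_interpolate\<close>)
  have "f l \<lless> r" if "l \<in> unit_rats" for l
    using f(3)[OF that] is_sup_below[OF c] way_below_trans by blast
  moreover have "\<exists>l\<in>unit_rats. s \<lless> f l" if s: "s \<lless> r" for s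
  proof -
    obtain k where k: "s \<preceq> c k" using s inc c(2) le_refl[OF assms] unfolding way_below_def by blast
    obtain l where "l \<in> unit_rats" "c k \<lless> f l" using f(2)[of "c k"] by blast
    then show ?thesis using le_way_below[OF _ k] way_belowD[OF s] by blast
  qed
  ultimately show ?thesis using f(1) unfolding approximates_def by blast
qed

lemma approximatesD:
  assumes "approximates S f r"
  shows "\<lbrakk>l' \<in> unit_rats; l \<in> unit_rats; l' < l\<rbrakk> \<Longrightarrow> f l' \<lless>\<^bsub>S\<^esub> f l"
    and "l \<in> unit_rats \<Longrightarrow> f l \<lless>\<^bsub>S\<^esub> r"
    and "s \<lless>\<^bsub>S\<^esub> r \<Longrightarrow> \<exists>l\<in>unit_rats. s \<lless>\<^bsub>S\<^esub> f l"
  using assms unfolding approximates_def by blast+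

lemma (in cu_semigroup) approximates_le:
  assumes "approximates S f r" "l' \<in> unit_rats" "l \<in> unit_rats" "l' \<le> l"
  shows "f l' \<preceq> f l"
proof (cases "l' = l")
  case True
  then show ?thesis using way_belowD[OF approximatesD(2)[OF assms(1,3)]] by simp
next
  case False
  then show ?thesis using approximatesD(1)[OF assms(1-3)] assms(4) way_below_imp_le by simp
qed

lemma (in cu_semigroup) approximates_add:
  assumes f: "approximates S f r" and g: "approximates S g s"
  shows "approximates S (\<lambda>l. f l \<oplus> g l) (r \<oplus> s)"
  unfolding approximates_def
proof (intro conjI ballI allI impI)
  fix t assume t: "t \<lless> r \<oplus> s"
  have u: "1/2 \<in> (unit_rats :: rat set)" by (simp add: unit_rats_def)
  have rs: "r \<in> carrier S" "s \<in> carrier S"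
    using way_belowD[OF approximatesD(2)[OF f u]] way_belowD[OF approximatesD(2)[OF g u]] by simp_all
  obtain a b where ab: "a \<lless> r" "b \<lless> s" "t \<preceq> a \<oplus> b" using way_below_add[OF t rs] .
  obtain l where l: "l \<in> unit_rats" "a \<lless> f l" using approximatesD(3)[OF f ab(1)] by blast
  obtain m where m: "m \<in> unit_rats" "b \<lless> g m" using approximatesD(3)[OF g ab(2)] by blast
  have u: "max l m \<in> unit_rats" using l(1) m(1) by (simp add: max_def)
  have "f l \<preceq> f (max l m)" "g m \<preceq> g (max l m)"
    using approximates_le[OF f l(1) u] approximates_le[OF g m(1) u] by auto
  then have "a \<lless> f (max l m)" "b \<lless> g (max l m)"
    using way_below_le[OF _ l(2)] way_below_le[OF _ m(2)]
      way_belowD[OF approximatesD(2)[OF f u]] way_belowD[OF approximatesD(2)[OF g u]] by blast+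
  then have "a \<oplus> b \<lless> f (max l m) \<oplus> g (max l m)" by (rule O3)
  then show "\<exists>l\<in>unit_rats. t \<lless> f l \<oplus> g l" using le_way_below[OF _ ab(3)] way_belowD[OF t] u by blast
qed (use f g in \<open>auto simp: approximates_def intro: O3\<close>)

context cu_semiring
begin

sublocale RR: cu_pair R R by unfold_locales

sublocale M: cu_bimorphism_pair R R R "(\<otimes>)"
  by unfold_locales (rule mult_bimorphism)

abbreviation hom_R where "hom_R \<equiv> cu_hom R R"

sublocale H: cu_semigroup hom_R
  by (rule RR.cu_semigroup_cu_hom)

lemma mult_mono:
  assumes "a \<in> carrier R" "a' \<in> carrier R" "b \<in> carrier R" "b' \<in> carrier R" "a \<preceq> a'" "b \<preceq> b'"
  shows "a \<otimes> b \<preceq> a' \<otimes> b'"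
  using assms le_trans[OF _ _ _ M.bim_mono_left M.bim_mono_right] by (meson m_closed)

lemma sup_const: "a \<in> carrier R \<Longrightarrow> increasing R (\<lambda>_. a) \<and> is_sup R (range (\<lambda>_::nat. a)) a"
  by (auto simp: increasing_def is_sup_def)

lemma gen_cu_morphism_mult: "a \<in> carrier R \<Longrightarrow> gen_cu_morphism R R ((\<otimes>) a)"
  unfolding gen_cu_morphism_def
  by (auto simp: M.bim_add_right M.bim_zero_right intro: M.bim_mono_right M.bim_sup sup_const[THEN conjunct1]
      sup_const[THEN conjunct2])

lemma morph_below_mult: "a \<lless> b \<Longrightarrow> morph_below R R ((\<otimes>) a) ((\<otimes>) b)"
  unfolding morph_below_def using M.bim_way_below by blast

lemma morph_below_mult_left:
  assumes "morph_below R R ((\<otimes>) b) g" "a \<preceq> b" "a \<in> carrier R" "b \<in> carrier R"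
  shows "morph_below R R ((\<otimes>) a) g"
  unfolding morph_below_def
proof (intro allI impI)
  fix x' x assume x: "x' \<lless> x"
  then have c: "x' \<in> carrier R" by (auto dest: way_belowD)
  have "b \<otimes> x' \<lless> g x" using assms(1) x unfolding morph_below_def by blast
  then show "a \<otimes> x' \<lless> g x" using le_way_below[of "a \<otimes> x'" "b \<otimes> x'"] M.bim_mono_left assms c by auto
qed

lemma mult_path:
  assumes "approximates R f r" shows "(\<lambda>l. (\<otimes>) (f l)) \<in> paths R R"
proof -
  have "gen_cu_morphism R R ((\<otimes>) (f l))" if "l \<in> unit_rats" for l
    using gen_cu_morphism_mult way_belowD[OF approximatesD(2)[OF assms that]] by simp
  then show ?thesis unfolding paths_def using morph_below_mult[OF approximatesD(1)[OF assms]] by simp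
qed

text \<open>Multiplication by r itself need not give a constant path, because
  \<open>a' \<lless> a\<close> does not imply that r a' is way below r a; hence the detour through
  elements way below r. The class does not depend on the choice, by
  \<open>mult_hom_class\<close>.\<close>

definition mult_hom :: "'a \<Rightarrow> (rat \<Rightarrow> 'a \<Rightarrow> 'a) set" where
  "mult_hom r = RR.hom_class (\<lambda>l. (\<otimes>) ((SOME f. approximates R f r) l))"

lemma mult_hom_le_class:
  assumes f: "approximates R f r" and g: "g \<in> paths R R"
  shows "RR.hom_class (\<lambda>l. (\<otimes>) (f l)) \<preceq>\<^bsub>hom_R\<^esub> RR.hom_class g \<longleftrightarrow>
    (\<forall>s. s \<lless> r \<longrightarrow> (\<exists>m\<in>unit_rats. morph_below R R ((\<otimes>) s) (g m)))"
  unfolding RR.cu_hom_leq[OF mult_path[OF f] g] path_le_def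
proof (intro iffI allI impI ballI)
  fix s assume le: "\<forall>l\<in>unit_rats. \<exists>m\<in>unit_rats. morph_below R R ((\<otimes>) (f l)) (g m)" and s: "s \<lless> r"
  obtain l where l: "l \<in> unit_rats" "s \<lless> f l" using approximatesD(3)[OF f s] by blast
  obtain m where m: "m \<in> unit_rats" "morph_below R R ((\<otimes>) (f l)) (g m)" using le l(1) by blast
  show "\<exists>m\<in>unit_rats. morph_below R R ((\<otimes>) s) (g m)"
    using morph_below_mult_left[OF m(2) way_below_imp_le[OF l(2)]] m(1) way_belowD[OF l(2)] by blast
qed (use approximatesD(2)[OF f] in blast)

lemma mult_hom_class:
  assumes "approximates R f r" shows "mult_hom r = RR.hom_class (\<lambda>l. (\<otimes>) (f l))"
proof -
  define g where "g = (SOME f. approximates R f r)"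
  have g: "approximates R g r" unfolding g_def using assms by (rule someI[of "\<lambda>f. approximates R f r"])
  have "RR.hom_class (\<lambda>l. (\<otimes>) (f l)) \<preceq>\<^bsub>hom_R\<^esub> RR.hom_class (\<lambda>l. (\<otimes>) (g l))"
    if f: "approximates R f r" and g: "approximates R g r" for f g
    unfolding mult_hom_le_class[OF f mult_path[OF g]]
    using approximatesD(3)[OF g] morph_below_mult by blast
  from this[OF assms g] this[OF g assms] show ?thesis
    unfolding mult_hom_def g_def[symmetric]
    using RR.hom_class_closed mult_path[OF assms] mult_path[OF g] H.le_antisym by blast
qed

lemma mult_hom_closed: "r \<in> carrier R \<Longrightarrow> mult_hom r \<in> carrier hom_R"
  using approximates_exists mult_hom_class mult_path RR.hom_class_closed by metis

lemma mult_hom_le_iff: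
  assumes "r \<in> carrier R" "g \<in> paths R R"
  shows "mult_hom r \<preceq>\<^bsub>hom_R\<^esub> RR.hom_class g \<longleftrightarrow>
    (\<forall>s. s \<lless> r \<longrightarrow> (\<exists>m\<in>unit_rats. morph_below R R ((\<otimes>) s) (g m)))"
proof -
  obtain f where f: "approximates R f r" using approximates_exists[OF assms(1)] by blast
  show ?thesis using mult_hom_le_class[OF f assms(2)] unfolding mult_hom_class[OF f] .
qed

lemma mult_hom_mono:
  assumes "a \<in> carrier R" "b \<in> carrier R" "a \<preceq> b" shows "mult_hom a \<preceq>\<^bsub>hom_R\<^esub> mult_hom b"
proof -
  obtain g where g: "approximates R g b" using approximates_exists[OF assms(2)] by blast
  show ?thesis
    unfolding mult_hom_class[OF g] mult_hom_le_iff[OF assms(1) mult_path[OF g]]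
    using approximatesD(3)[OF g] way_below_le[OF assms(2) _ assms(3)] morph_below_mult by blast
qed

theorem mult_hom_morphism: "cu_morphism R hom_R mult_hom"
  unfolding cu_morphism_def gen_cu_morphism_def
proof (intro conjI ballI allI impI)
  show "mult_hom \<in> carrier R \<rightarrow> carrier hom_R" using mult_hom_closed by blast
  fix a b assume ab: "a \<in> carrier R" "b \<in> carrier R"
  obtain f where f: "approximates R f a" using approximates_exists[OF ab(1)] by blast
  obtain g where g: "approximates R g b" using approximates_exists[OF ab(2)] by blast
  have "f l \<in> carrier R" "g l \<in> carrier R" if "l \<in> unit_rats" for l
    using way_belowD[OF approximatesD(2)[OF f that]] way_belowD[OF approximatesD(2)[OF g that]] by simp_all
  then show "mult_hom (a \<oplus> b) = mult_hom a \<oplus>\<^bsub>hom_R\<^esub> mult_hom b"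
    unfolding mult_hom_class[OF f] mult_hom_class[OF g] mult_hom_class[OF approximates_add[OF f g]]
      RR.cu_hom_add[OF mult_path[OF f] mult_path[OF g]]
    using mult_path[OF approximates_add[OF f g]] RR.paths_add[OF mult_path[OF f] mult_path[OF g]]
    by (intro RR.hom_class_cong) (auto simp: M.bim_add_left)
  show "mult_hom a \<preceq>\<^bsub>hom_R\<^esub> mult_hom b" if "a \<preceq> b" using mult_hom_mono ab that .
next
  have z: "approximates R (\<lambda>_. \<zero>) \<zero>"
    using zero_way_below[of "\<zero>"] unfolding approximates_def unit_rats_def by (auto intro: exI[of _ "1/2"])
  show "mult_hom \<zero> = \<zero>\<^bsub>hom_R\<^esub>"
    unfolding mult_hom_class[OF z] RR.hom_zero
    by (rule RR.hom_class_cong[OF mult_path[OF z] RR.paths_zero]) (simp add: M.bim_zero_left)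
next
  fix c s assume c: "increasing R c" and s: "is_sup R (range c) s"
  have cc: "c n \<in> carrier R" for n using c by (auto simp: increasing_def)
  have sc: "s \<in> carrier R" using s by (rule is_sup_carrier)
  show "is_sup hom_R (range (\<lambda>n. mult_hom (c n))) (mult_hom s)"
    unfolding is_sup_def
  proof (intro conjI ballI impI)
    show "mult_hom s \<in> carrier hom_R" using mult_hom_closed[OF sc] .
    show "F \<preceq>\<^bsub>hom_R\<^esub> mult_hom s" if "F \<in> range (\<lambda>n. mult_hom (c n))" for F
      using that s mult_hom_mono[OF cc sc] by (auto simp: is_sup_def)
    fix U assume U: "U \<in> carrier hom_R" "\<forall>F\<in>range (\<lambda>n. mult_hom (c n)). F \<preceq>\<^bsub>hom_R\<^esub> U"
    obtain u where u: "u \<in> paths R R" "U = RR.hom_class u" using RR.hom_classE[OF U(1)] .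
    have "\<exists>m\<in>unit_rats. morph_below R R ((\<otimes>) t) (u m)" if t: "t \<lless> s" for t
    proof -
      obtain t' where t': "t \<lless> t'" "t' \<lless> s" using way_below_interpolate[OF t] .
      obtain n where "t' \<preceq> c n" using t'(2) c s le_refl[OF sc] unfolding way_below_def by blast
      then have "t \<lless> c n" using way_below_le[OF cc t'(1)] by blast
      moreover have "mult_hom (c n) \<preceq>\<^bsub>hom_R\<^esub> RR.hom_class u" using U(2) u(2) by blast
      ultimately show ?thesis using mult_hom_le_iff[OF cc u(1)] by blast
    qed
    then show "mult_hom s \<preceq>\<^bsub>hom_R\<^esub> U" unfolding u(2) mult_hom_le_iff[OF sc u(1)] by blast
  qed
next
  fix a b assume wb: "a \<lless> b"
  then have ab: "a \<in> carrier R" "b \<in> carrier R" by (auto dest: way_belowD)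
  obtain f where f: "approximates R f a" using approximates_exists[OF ab(1)] by blast
  obtain g where g: "approximates R g b" using approximates_exists[OF ab(2)] by blast
  obtain m where m: "m \<in> unit_rats" "a \<lless> g m" using approximatesD(3)[OF g wb] by blast
  show "mult_hom a \<lless>\<^bsub>hom_R\<^esub> mult_hom b"
    unfolding mult_hom_class[OF f] mult_hom_class[OF g] RR.hom_way_below[OF mult_path[OF f] mult_path[OF g]]
    using m approximatesD(2)[OF f] way_below_trans morph_below_mult by meson
qed

lemma endpoint_mult_hom:
  assumes r: "r \<in> carrier R" and s: "s \<in> carrier R"
  shows "endpoint R R (mult_hom r) s = r \<otimes> s"
proof -
  obtain f where f: "approximates R f r" using approximates_exists[OF r] by blast
  note p = mult_path[OF f]
  have fc: "f l \<in> carrier R" if "l \<in> unit_rats" for l using way_belowD[OF approximatesD(2)[OF f that]] by simp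
  obtain c where c: "\<forall>n. c n \<lless> c (Suc n)" "is_sup R (range c) r" using O2[OF r] by blast
  have cc: "c n \<in> carrier R" for n using way_belowD[OF c(1)[rule_format]] by simp
  have cl: "endpoint R R (RR.hom_class (\<lambda>l. (\<otimes>) (f l))) s \<in> carrier R" using RR.endpoint_class_closed[OF p s] .
  have "c n \<otimes> s \<preceq> endpoint R R (RR.hom_class (\<lambda>l. (\<otimes>) (f l))) s" for n
  proof -
    obtain l where l: "l \<in> unit_rats" "c n \<lless> f l" using approximatesD(3)[OF f is_sup_below[OF c]] by blast
    have "c n \<otimes> s \<preceq> f l \<otimes> s" using M.bim_mono_left[OF cc fc[OF l(1)] s way_below_imp_le[OF l(2)]] .
    then show ?thesis
      using le_trans[OF _ _ cl _ RR.endpoint_upper[OF p l(1) s]] cc fc[OF l(1)] s by simp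
  qed
  moreover have "is_sup R (range (\<lambda>n. c n \<otimes> s)) (r \<otimes> s)"
    using M.bim_sup[OF way_below_increasing[OF c(1)] _ c(2)] sup_const[OF s] by blast
  ultimately have "r \<otimes> s \<preceq> endpoint R R (RR.hom_class (\<lambda>l. (\<otimes>) (f l))) s"
    using cl unfolding is_sup_def by blast
  moreover have "endpoint R R (RR.hom_class (\<lambda>l. (\<otimes>) (f l))) s \<preceq> r \<otimes> s"
    using r s fc M.bim_mono_left approximatesD(2)[OF f] way_below_imp_le
    by (intro RR.endpoint_least[OF p s]) auto
  ultimately show ?thesis unfolding mult_hom_class[OF f] using le_antisym cl r s by simp
qed

section \<open>Evaluation compared with multiplication\<close>

definition mult_hom_tensor :: "('a \<times> 'a) multiset set \<Rightarrow> ((rat \<Rightarrow> 'a \<Rightarrow> 'a) set \<times> 'a) multiset set" where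
  "mult_hom_tensor = tensor_lift R R (cu_tensor hom_R R) (\<lambda>r s. pure_tensor hom_R R (mult_hom r) s)"

lemma cu_R: "cu_semigroup R"
  by unfold_locales

lemmas cu_hom_R = RR.cu_semigroup_cu_hom
lemmas cu_RR = cu_semigroup_cu_tensor[OF cu_R cu_R]
lemmas cu_HR = cu_semigroup_cu_tensor[OF cu_hom_R cu_R]

lemma mult_hom_tensor:
  shows "cu_morphism (cu_tensor R R) (cu_tensor hom_R R) mult_hom_tensor"
    and "\<lbrakk>r \<in> carrier R; s \<in> carrier R\<rbrakk> \<Longrightarrow>
      mult_hom_tensor (pure_tensor R R r s) = pure_tensor hom_R R (mult_hom r) s"
  unfolding mult_hom_tensor_def
  by (rule tensor_lift[OF cu_R cu_R cu_HR cu_bimorphism_comp_left[OF mult_hom_morphism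
        cu_bimorphism_pure_tensor[OF cu_hom_R cu_R]]]; assumption)+

lemmas mult_map_morphism = tensor_lift(1)[OF cu_R cu_R cu_R mult_bimorphism, folded mult_map_def]
  and mult_map_pure = tensor_lift(2)[OF cu_R cu_R cu_R mult_bimorphism, folded mult_map_def]
  and evaluation_morphism = tensor_lift(1)[OF cu_hom_R cu_R cu_R RR.endpoint_bimorphism, folded evaluation_def]
  and evaluation_pure = tensor_lift(2)[OF cu_hom_R cu_R cu_R RR.endpoint_bimorphism, folded evaluation_def]

lemma evaluation_mult_hom_tensor:
  assumes "Z \<in> carrier (cu_tensor R R)"
  shows "evaluation R R (mult_hom_tensor Z) = mult_map R Z"
  by (rule cu_tensor_morphism_eqI[OF cu_R cu_R cu_R
        cu_morphism_comp[OF mult_hom_tensor(1) evaluation_morphism] mult_map_morphism _ assms])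
    (simp add: mult_hom_tensor(2) evaluation_pure mult_map_pure mult_hom_closed endpoint_mult_hom)

text \<open>The inverse is h = (\<tau> \<otimes> id) \<circ> \<mu>^(-1). It is always a right
  inverse of evaluation. By \<open>end1\<close> the preimage of F(t) = F(1) t under \<mu> is F(1)
  \<otimes> t, so \<open>pure\<close> says that h is a left inverse on pure tensors, and these
  determine morphisms.\<close>

lemma evaluation_iso_if_pure_tensors:
  assumes "solid R"
    and end1: "\<And>F t. F \<in> carrier hom_R \<Longrightarrow> t \<in> carrier R \<Longrightarrow> endpoint R R F t = endpoint R R F \<one> \<otimes> t"
    and pure: "\<And>F t. F \<in> carrier hom_R \<Longrightarrow> t \<in> carrier R \<Longrightarrow>
      pure_tensor hom_R R F t = pure_tensor hom_R R (mult_hom (endpoint R R F \<one>)) t"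
  shows "cu_iso (cu_tensor hom_R R) R (evaluation R R)"
proof -
  have iso: "cu_iso (cu_tensor R R) R (mult_map R)" using assms(1) by (simp add: solid_def)
  define \<nu> where "\<nu> = inv_into (carrier (cu_tensor R R)) (mult_map R)"
  have \<nu>: "cu_morphism R (cu_tensor R R) \<nu>" unfolding \<nu>_def by (rule cu_iso_inverse[OF cu_RR cu_R iso])
  define h where "h r = mult_hom_tensor (\<nu> r)" for r
  have h: "cu_morphism R (cu_tensor hom_R R) h"
    unfolding h_def by (rule cu_morphism_comp[OF \<nu> mult_hom_tensor(1)])
  have bij: "bij_betw (mult_map R) (carrier (cu_tensor R R)) (carrier R)" using iso by (simp add: cu_iso_def)
  have \<mu>\<nu>: "mult_map R (\<nu> r) = r" if "r \<in> carrier R" for r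
    using that bij unfolding \<nu>_def by (simp add: bij_betw_def f_inv_into_f)
  have \<nu>\<mu>: "\<nu> (mult_map R Z) = Z" if "Z \<in> carrier (cu_tensor R R)" for Z
    using that bij unfolding \<nu>_def by (simp add: bij_betw_def)
  have eh: "evaluation R R (h r) = r" if "r \<in> carrier R" for r
    unfolding h_def using evaluation_mult_hom_tensor[OF cu_morphismD(1)[OF \<nu> that]] \<mu>\<nu>[OF that] by simp
  have id: "cu_morphism (cu_tensor hom_R R) (cu_tensor hom_R R) (\<lambda>Z. Z)"
    unfolding cu_morphism_def gen_cu_morphism_def by simp
  have he: "h (evaluation R R Z) = Z" if Z: "Z \<in> carrier (cu_tensor hom_R R)" for Z
  proof (rule cu_tensor_morphism_eqI[OF cu_hom_R cu_R cu_HR cu_morphism_comp[OF evaluation_morphism h] id _ Z])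
    fix F t assume F: "F \<in> carrier hom_R" and t: "t \<in> carrier R"
    have v: "endpoint R R F \<one> \<in> carrier R" using RR.endpoint_closed[OF F] by simp
    have "\<nu> (endpoint R R F \<one> \<otimes> t) = pure_tensor R R (endpoint R R F \<one>) t"
      using \<nu>\<mu>[OF pure_tensor_closed[OF cu_R cu_R v t]] mult_map_pure[OF v t] by simp
    then show "h (evaluation R R (pure_tensor hom_R R F t)) = pure_tensor hom_R R F t"
      unfolding h_def evaluation_pure[OF F t] end1[OF F t] using mult_hom_tensor(2)[OF v t] pure[OF F t] by simp
  qed
  show ?thesis
    unfolding cu_iso_def
  proof (intro conjI ballI)
    show "bij_betw (evaluation R R) (carrier (cu_tensor hom_R R)) (carrier R)"
      by (rule bij_betwI[where g = h])
        (use eh he cu_morphismD(1)[OF h] cu_morphismD(1)[OF evaluation_morphism] in auto)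
    fix Y Z assume YZ: "Y \<in> carrier (cu_tensor hom_R R)" "Z \<in> carrier (cu_tensor hom_R R)"
    show "evaluation R R (Y \<oplus>\<^bsub>cu_tensor hom_R R\<^esub> Z) = evaluation R R Y \<oplus> evaluation R R Z"
      using cu_morphismD(2)[OF evaluation_morphism YZ] .
    show "Y \<preceq>\<^bsub>cu_tensor hom_R R\<^esub> Z \<longleftrightarrow> evaluation R R Y \<preceq> evaluation R R Z"
      using cu_morphismD(4)[OF evaluation_morphism YZ] cu_morphismD(4)[OF h, of "evaluation R R Y" "evaluation R R Z"]
        cu_morphismD(1)[OF evaluation_morphism] YZ he by metis
  qed
qed

lemma endpoint_unit_morphism:
  assumes "cu_compact R \<one>" shows "cu_morphism hom_R R (\<lambda>F. endpoint R R F \<one>)"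
proof -
  interpret E: cu_bimorphism_pair hom_R R R "endpoint R R"
    by unfold_locales (rule RR.endpoint_bimorphism)
  show ?thesis
    unfolding cu_morphism_def gen_cu_morphism_def
    using assms unfolding cu_compact_def
    by (auto simp: E.bim_add_left E.bim_zero_left intro: E.bim_closed E.bim_mono_left E.bim_way_below
        E.bim_sup[OF _ conjunct1[OF sup_const[OF one_closed]] _ conjunct2[OF sup_const[OF one_closed]]])
qed

text \<open>Evaluation at 1, tensored with the identity, is a retraction \<kappa> of \<tau>
  \<otimes> id. Since evaluation reflects the order, so does its composite \<mu> with \<tau>
  \<otimes> id; surjectivity is \<mu>(r \<otimes> 1) = r.\<close>

lemma solid_if_evaluation_iso:
  assumes compact: "cu_compact R \<one>" and iso: "cu_iso (cu_tensor hom_R R) R (evaluation R R)"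
  shows "solid R"
proof -
  define \<kappa> where "\<kappa> = tensor_lift hom_R R (cu_tensor R R) (\<lambda>F s. pure_tensor R R (endpoint R R F \<one>) s)"
  note \<kappa> = tensor_lift[OF cu_hom_R cu_R cu_RR cu_bimorphism_comp_left[OF endpoint_unit_morphism[OF compact]
        cu_bimorphism_pure_tensor[OF cu_R cu_R]], folded \<kappa>_def]
  have id: "cu_morphism (cu_tensor R R) (cu_tensor R R) (\<lambda>Z. Z)"
    unfolding cu_morphism_def gen_cu_morphism_def by simp
  have retract: "\<kappa> (mult_hom_tensor Z) = Z" if Z: "Z \<in> carrier (cu_tensor R R)" for Z
    by (rule cu_tensor_morphism_eqI[OF cu_R cu_R cu_RR cu_morphism_comp[OF mult_hom_tensor(1) \<kappa>(1)] id _ Z])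
      (simp add: mult_hom_tensor(2) \<kappa>(2) mult_hom_closed endpoint_mult_hom)
  have le: "Y \<preceq>\<^bsub>cu_tensor R R\<^esub> Z"
    if YZ: "Y \<in> carrier (cu_tensor R R)" "Z \<in> carrier (cu_tensor R R)" "mult_map R Y \<preceq> mult_map R Z" for Y Z
  proof -
    note c = cu_morphismD(1)[OF mult_hom_tensor(1) YZ(1)] cu_morphismD(1)[OF mult_hom_tensor(1) YZ(2)]
    have "evaluation R R (mult_hom_tensor Y) \<preceq> evaluation R R (mult_hom_tensor Z)"
      using YZ(3) evaluation_mult_hom_tensor[OF YZ(1)] evaluation_mult_hom_tensor[OF YZ(2)] by simp
    then have "mult_hom_tensor Y \<preceq>\<^bsub>cu_tensor hom_R R\<^esub> mult_hom_tensor Z"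
      using iso c unfolding cu_iso_def by blast
    from cu_morphismD(4)[OF \<kappa>(1) c this] show ?thesis unfolding retract[OF YZ(1)] retract[OF YZ(2)] .
  qed
  have "bij_betw (mult_map R) (carrier (cu_tensor R R)) (carrier R)"
    unfolding bij_betw_def
  proof
    interpret T: cu_semigroup "cu_tensor R R" by (rule cu_RR)
    show "inj_on (mult_map R) (carrier (cu_tensor R R))"
    proof (rule inj_onI)
      fix Y Z assume YZ: "Y \<in> carrier (cu_tensor R R)" "Z \<in> carrier (cu_tensor R R)" "mult_map R Y = mult_map R Z"
      then have "mult_map R Y \<in> carrier R" using cu_morphismD(1)[OF mult_map_morphism] by blast
      then show "Y = Z" using T.le_antisym[OF YZ(1,2) le[OF YZ(1,2)] le[OF YZ(2,1)]] YZ(3) by simp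
    qed
    show "mult_map R ` carrier (cu_tensor R R) = carrier R"
    proof
      show "mult_map R ` carrier (cu_tensor R R) \<subseteq> carrier R"
        using cu_morphismD(1)[OF mult_map_morphism] by blast
      show "carrier R \<subseteq> mult_map R ` carrier (cu_tensor R R)"
      proof
        fix r assume r: "r \<in> carrier R"
        show "r \<in> mult_map R ` carrier (cu_tensor R R)"
          using mult_map_pure[OF r one_closed] pure_tensor_closed[OF cu_R cu_R r one_closed] r
          by (intro image_eqI[of _ _ "pure_tensor R R r \<one>"]) simp_all
      qed
    qed
  qed
  then have "cu_iso (cu_tensor R R) R (mult_map R)"
    unfolding cu_iso_def
    using le cu_morphismD(2,4)[OF mult_map_morphism] by blast
  then show ?thesis unfolding solid_def using cu_semiring_axioms by blast
qed

end


section \<open>Additive functionals on ordered semigroups\<close>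

context positively_ordered_semigroup
begin

lemma add_mono':
  assumes "a \<in> carrier S" "a' \<in> carrier S" "b \<in> carrier S" "b' \<in> carrier S" "a \<preceq> a'" "b \<preceq> b'"
  shows "a \<oplus> b \<preceq> a' \<oplus> b'"
  using assms add_right_mono[of a a' b] add_right_mono[of b b' a'] le_trans[of "a \<oplus> b" "a' \<oplus> b" "a' \<oplus> b'"]
  by (simp add: a_comm)

lemma le_add_left: "\<lbrakk>a \<in> carrier S; b \<in> carrier S\<rbrakk> \<Longrightarrow> a \<preceq> a \<oplus> b"
  using add_mono'[of a a "\<zero>" b] by simp

lemma le_add_right: "\<lbrakk>a \<in> carrier S; b \<in> carrier S\<rbrakk> \<Longrightarrow> a \<preceq> b \<oplus> a"
  using le_add_left[of a b] by (simp add: a_comm)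

lemma add_pow_mono: "\<lbrakk>a \<in> carrier S; b \<in> carrier S; a \<preceq> b\<rbrakk> \<Longrightarrow> [(n::nat)] \<cdot> a \<preceq> [n] \<cdot> b"
  by (induction n) (auto intro: add_mono')

lemma add_pow_mono_left:
  assumes "a \<in> carrier S" "(m::nat) \<le> n" shows "[m] \<cdot> a \<preceq> [n] \<cdot> a"
proof -
  have "[n] \<cdot> a = [m] \<cdot> a \<oplus> [(n - m)] \<cdot> a" using assms by (simp add: add.nat_pow_mult)
  then show ?thesis using assms le_add_left by simp
qed

definition bounded_by :: "'a \<Rightarrow> 'a set" where
  "bounded_by u = {x \<in> carrier S. \<exists>m::nat. x \<preceq> [m] \<cdot> u}"

lemma bounded_by_carrier: "x \<in> bounded_by u \<Longrightarrow> x \<in> carrier S"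
  by (simp add: bounded_by_def)

lemma bounded_by_down:
  assumes "x \<in> bounded_by u" "u \<in> carrier S" "y \<in> carrier S" "y \<preceq> x" shows "y \<in> bounded_by u"
  using assms le_trans[of y x] unfolding bounded_by_def by auto

lemma bounded_by_zero: "u \<in> carrier S \<Longrightarrow> \<zero> \<in> bounded_by u"
  by (auto simp: bounded_by_def)

lemma bounded_by_add_iff:
  assumes "u \<in> carrier S" "x \<in> carrier S" "y \<in> carrier S"
  shows "x \<oplus> y \<in> bounded_by u \<longleftrightarrow> x \<in> bounded_by u \<and> y \<in> bounded_by u"
proof
  assume "x \<oplus> y \<in> bounded_by u"
  then show "x \<in> bounded_by u \<and> y \<in> bounded_by u"
    using bounded_by_down[OF _ assms(1)] le_add_left le_add_right assms by blast
next
  assume "x \<in> bounded_by u \<and> y \<in> bounded_by u"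
  then obtain m n :: nat where "x \<preceq> [m] \<cdot> u" "y \<preceq> [n] \<cdot> u" by (auto simp: bounded_by_def)
  then have "x \<oplus> y \<preceq> [(m + n)] \<cdot> u"
    using add_mono'[of x "[m] \<cdot> u" y "[n] \<cdot> u"] assms by (simp add: add.nat_pow_mult)
  then show "x \<oplus> y \<in> bounded_by u" using assms unfolding bounded_by_def by blast
qed

lemma bounded_by_add_pow: "\<lbrakk>u \<in> carrier S; x \<in> bounded_by u\<rbrakk> \<Longrightarrow> [(n::nat)] \<cdot> x \<in> bounded_by u"
  by (induction n) (auto simp: bounded_by_zero bounded_by_add_iff bounded_by_carrier)

lemma bounded_by_self: "u \<in> carrier S \<Longrightarrow> u \<in> bounded_by u"
  unfolding bounded_by_def by (auto intro!: exI[of _ 1])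

section \<open>Order cones and a Hahn-Banach extension\<close>

text \<open>By maximality a maximal cone that omits a given pair is a total preorder. The functional of
  \<open>additive_functional_exists\<close> is the Dedekind cut \<open>x \<mapsto> inf {k/n | n x \<le> k u}\<close> in such a preorder;
  it takes the value \<open>\<infinity>\<close> at the elements that are not bounded by a multiple of \<open>u\<close>.\<close>

definition order_cone :: "'a \<Rightarrow> ('a \<times> 'a) set \<Rightarrow> bool" where
  "order_cone u G \<longleftrightarrow> G \<subseteq> bounded_by u \<times> bounded_by u \<and>
     (\<forall>x\<in>bounded_by u. \<forall>y\<in>bounded_by u. x \<preceq> y \<longrightarrow> (x, y) \<in> G) \<and>
     (\<forall>x y x' y'. (x, y) \<in> G \<longrightarrow> (x', y') \<in> G \<longrightarrow> (x \<oplus> x', y \<oplus> y') \<in> G) \<and>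
     (\<forall>x\<in>bounded_by u. \<forall>y\<in>bounded_by u. \<forall>z\<in>bounded_by u. (x \<oplus> z, y \<oplus> z) \<in> G \<longrightarrow> (x, y) \<in> G) \<and>
     (\<forall>x\<in>bounded_by u. \<forall>y\<in>bounded_by u. \<forall>n>0. ([(n::nat)] \<cdot> x, [n] \<cdot> y) \<in> G \<longrightarrow> (x, y) \<in> G)"

lemma order_coneD:
  assumes "order_cone u G"
  shows "(x, y) \<in> G \<Longrightarrow> x \<in> bounded_by u" "(x, y) \<in> G \<Longrightarrow> y \<in> bounded_by u"
    and "\<lbrakk>x \<in> bounded_by u; y \<in> bounded_by u; x \<preceq> y\<rbrakk> \<Longrightarrow> (x, y) \<in> G"
    and "\<lbrakk>(x, y) \<in> G; (x', y') \<in> G\<rbrakk> \<Longrightarrow> (x \<oplus> x', y \<oplus> y') \<in> G"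
    and "\<lbrakk>x \<in> bounded_by u; y \<in> bounded_by u; z \<in> bounded_by u; (x \<oplus> z, y \<oplus> z) \<in> G\<rbrakk> \<Longrightarrow> (x, y) \<in> G"
    and "\<lbrakk>x \<in> bounded_by u; y \<in> bounded_by u; 0 < n; ([(n::nat)] \<cdot> x, [n] \<cdot> y) \<in> G\<rbrakk> \<Longrightarrow> (x, y) \<in> G"
proof -
  have 1: "G \<subseteq> bounded_by u \<times> bounded_by u"
    and 2: "\<forall>x\<in>bounded_by u. \<forall>y\<in>bounded_by u. x \<preceq> y \<longrightarrow> (x, y) \<in> G"
    and 3: "\<forall>x y x' y'. (x, y) \<in> G \<longrightarrow> (x', y') \<in> G \<longrightarrow> (x \<oplus> x', y \<oplus> y') \<in> G"
    and 4: "\<forall>x\<in>bounded_by u. \<forall>y\<in>bounded_by u. \<forall>z\<in>bounded_by u. (x \<oplus> z, y \<oplus> z) \<in> G \<longrightarrow> (x, y) \<in> G"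
    and 5: "\<forall>x\<in>bounded_by u. \<forall>y\<in>bounded_by u. \<forall>n>0. ([(n::nat)] \<cdot> x, [n] \<cdot> y) \<in> G \<longrightarrow> (x, y) \<in> G"
    using assms unfolding order_cone_def by - (elim conjE, assumption)+
  show "(x, y) \<in> G \<Longrightarrow> x \<in> bounded_by u" "(x, y) \<in> G \<Longrightarrow> y \<in> bounded_by u" using 1 by blast+
  show "\<lbrakk>x \<in> bounded_by u; y \<in> bounded_by u; x \<preceq> y\<rbrakk> \<Longrightarrow> (x, y) \<in> G" using 2 by blast
  show "\<lbrakk>(x, y) \<in> G; (x', y') \<in> G\<rbrakk> \<Longrightarrow> (x \<oplus> x', y \<oplus> y') \<in> G" using 3 by blast
  show "\<lbrakk>x \<in> bounded_by u; y \<in> bounded_by u; z \<in> bounded_by u; (x \<oplus> z, y \<oplus> z) \<in> G\<rbrakk> \<Longrightarrow> (x, y) \<in> G"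
    using 4 by blast
  show "\<lbrakk>x \<in> bounded_by u; y \<in> bounded_by u; 0 < n; ([(n::nat)] \<cdot> x, [n] \<cdot> y) \<in> G\<rbrakk> \<Longrightarrow> (x, y) \<in> G"
    using 5 by blast
qed

text \<open>Add the two relations and cancel y. Transitivity thus follows from additivity and
  cancellation and is no separate closure condition on cones.\<close>

lemma order_cone_trans:
  assumes G: "order_cone u G" and xy: "(x, y) \<in> G" and yz: "(y, z) \<in> G" shows "(x, z) \<in> G"
proof -
  have c: "x \<in> bounded_by u" "y \<in> bounded_by u" "z \<in> bounded_by u"
    using order_coneD(1,2)[OF G] xy yz by blast+
  have "(x \<oplus> y, z \<oplus> y) \<in> G"
    using order_coneD(4)[OF G xy yz] c by (simp add: a_comm bounded_by_carrier)
  then show ?thesis by (rule order_coneD(5)[OF G c(1,3,2)])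
qed

lemma order_cone_add_pow:
  assumes u: "u \<in> carrier S" and G: "order_cone u G" and xy: "(x, y) \<in> G"
  shows "([(n::nat)] \<cdot> x, [n] \<cdot> y) \<in> G"
proof (induction n)
  case 0
  then show ?case using order_coneD(3)[OF G bounded_by_zero[OF u] bounded_by_zero[OF u]] by simp
next
  case (Suc n)
  then show ?case using order_coneD(4)[OF G Suc xy] by simp
qed

text \<open>The least cone: z accounts for cancellation and n for division, so this is the order
  induced by the Grothendieck group of the bounded elements, made unperforated.\<close>

lemma order_cone_initial:
  assumes u: "u \<in> carrier S"
  shows "order_cone u {(x, y). x \<in> bounded_by u \<and> y \<in> bounded_by u \<and>
    (\<exists>n>0. \<exists>z\<in>bounded_by u. [(n::nat)] \<cdot> x \<oplus> z \<preceq> [n] \<cdot> y \<oplus> z)}" (is "order_cone u ?G")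
  unfolding order_cone_def
proof (intro conjI ballI allI impI)
  let ?B = "bounded_by u"
  note B = bounded_by_carrier[of _ u] and add = bounded_by_add_iff[OF u] and pow = bounded_by_add_pow[OF u]
  show "?G \<subseteq> ?B \<times> ?B" by auto
  show "(x, y) \<in> ?G" if "x \<in> ?B" "y \<in> ?B" "x \<preceq> y" for x y
    using that bounded_by_zero[OF u] B by (auto intro!: exI[of _ 1] bexI[of _ "\<zero>"])
  show "(x \<oplus> x', y \<oplus> y') \<in> ?G" if xy: "(x, y) \<in> ?G" "(x', y') \<in> ?G" for x y x' y'
  proof -
    obtain n z n' z' where n: "n > 0" "z \<in> ?B" "[(n::nat)] \<cdot> x \<oplus> z \<preceq> [n] \<cdot> y \<oplus> z"
      and n': "n' > 0" "z' \<in> ?B" "[(n'::nat)] \<cdot> x' \<oplus> z' \<preceq> [n'] \<cdot> y' \<oplus> z'"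
      and b: "x \<in> ?B" "y \<in> ?B" "x' \<in> ?B" "y' \<in> ?B" using xy by auto
    note c = B[OF n(2)] B[OF n'(2)] B[OF b(1)] B[OF b(2)] B[OF b(3)] B[OF b(4)]
    have "[n'] \<cdot> ([n] \<cdot> x \<oplus> z) \<oplus> [n] \<cdot> ([n'] \<cdot> x' \<oplus> z') \<preceq> [n'] \<cdot> ([n] \<cdot> y \<oplus> z) \<oplus> [n] \<cdot> ([n'] \<cdot> y' \<oplus> z')"
      using c by (intro add_mono'[OF _ _ _ _ add_pow_mono[OF _ _ n(3)] add_pow_mono[OF _ _ n'(3)]]) auto
    moreover have "[n'] \<cdot> ([n] \<cdot> v \<oplus> z) \<oplus> [n] \<cdot> ([n'] \<cdot> v' \<oplus> z') =
        [(n * n')] \<cdot> (v \<oplus> v') \<oplus> ([n'] \<cdot> z \<oplus> [n] \<cdot> z')" if "v \<in> carrier S" "v' \<in> carrier S" for v v'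
      using that c by (simp add: add.nat_pow_distrib add.nat_pow_pow a_ac mult.commute)
    ultimately have "[(n * n')] \<cdot> (x \<oplus> x') \<oplus> ([n'] \<cdot> z \<oplus> [n] \<cdot> z') \<preceq> [(n * n')] \<cdot> (y \<oplus> y') \<oplus> ([n'] \<cdot> z \<oplus> [n] \<cdot> z')"
      using c by simp
    moreover have "[n'] \<cdot> z \<oplus> [n] \<cdot> z' \<in> ?B" using n(2) n'(2) c by (simp add: add pow)
    moreover have "0 < n * n'" using n(1) n'(1) by simp
    moreover have "x \<oplus> x' \<in> ?B" "y \<oplus> y' \<in> ?B" using b c by (auto simp: add)
    ultimately show ?thesis by blast
  qed
  show "(x, y) \<in> ?G" if xyz: "x \<in> ?B" "y \<in> ?B" "z \<in> ?B" "(x \<oplus> z, y \<oplus> z) \<in> ?G" for x y z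
  proof -
    obtain n w where n: "n > 0" "w \<in> ?B" "[(n::nat)] \<cdot> (x \<oplus> z) \<oplus> w \<preceq> [n] \<cdot> (y \<oplus> z) \<oplus> w" using xyz by auto
    note c = B[OF xyz(1)] B[OF xyz(2)] B[OF xyz(3)] B[OF n(2)]
    have "[n] \<cdot> x \<oplus> ([n] \<cdot> z \<oplus> w) \<preceq> [n] \<cdot> y \<oplus> ([n] \<cdot> z \<oplus> w)"
      using n(3) c by (simp add: add.nat_pow_distrib a_assoc)
    moreover have "[n] \<cdot> z \<oplus> w \<in> ?B" using n(2) xyz(3) c by (simp add: add pow)
    ultimately show ?thesis using xyz(1,2) n(1) by auto
  qed
  show "(x, y) \<in> ?G" if xy: "x \<in> ?B" "y \<in> ?B" "0 < m" "([(m::nat)] \<cdot> x, [m] \<cdot> y) \<in> ?G" for x y m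
  proof -
    obtain n w where n: "n > 0" "w \<in> ?B" "[(n::nat)] \<cdot> ([m] \<cdot> x) \<oplus> w \<preceq> [n] \<cdot> ([m] \<cdot> y) \<oplus> w" using xy by auto
    have "[(n * m)] \<cdot> x \<oplus> w \<preceq> [(n * m)] \<cdot> y \<oplus> w" "0 < n * m"
      using n(1,3) xy B by (auto simp: add.nat_pow_pow mult.commute)
    then show ?thesis using xy n(2) by blast
  qed
qed

text \<open>In the Grothendieck group the new pair declares c - d to be negative, and membership in
  E says that n (x - y) is at most k (c - d). So E consists of what the new relation forces; n = k =
  1 yields the pair itself.\<close>

lemma order_cone_extend:
  assumes u: "u \<in> carrier S" and G: "order_cone u G" and c: "c \<in> bounded_by u" and d: "d \<in> bounded_by u"
  defines "E \<equiv> {(x, y). x \<in> bounded_by u \<and> y \<in> bounded_by u \<and>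
    (\<exists>n>0. \<exists>k. ([(n::nat)] \<cdot> x \<oplus> [(k::nat)] \<cdot> d, [n] \<cdot> y \<oplus> [k] \<cdot> c) \<in> G)}"
  shows "order_cone u E" "G \<subseteq> E" "(c, d) \<in> E"
proof -
  let ?B = "bounded_by u"
  note B = bounded_by_carrier[of _ u] and add = bounded_by_add_iff[OF u] and pow = bounded_by_add_pow[OF u]
  note cc = B[OF c] B[OF d]
  show sub: "G \<subseteq> E"
  proof (rule subrelI)
    fix x y assume xy: "(x, y) \<in> G"
    then have b: "x \<in> ?B" "y \<in> ?B" using order_coneD(1,2)[OF G] by blast+
    have "([(1::nat)] \<cdot> x \<oplus> [(0::nat)] \<cdot> d, [(1::nat)] \<cdot> y \<oplus> [(0::nat)] \<cdot> c) \<in> G" using xy b B by simp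
    then show "(x, y) \<in> E" unfolding E_def using b zero_less_one by blast
  qed
  have "([(1::nat)] \<cdot> c \<oplus> [(1::nat)] \<cdot> d, [(1::nat)] \<cdot> d \<oplus> [(1::nat)] \<cdot> c) \<in> G"
    using order_coneD(3)[OF G, of "c \<oplus> d" "c \<oplus> d"] c d cc by (simp add: add a_comm)
  then show "(c, d) \<in> E" unfolding E_def using c d zero_less_one by blast
  show "order_cone u E"
    unfolding order_cone_def
  proof (intro conjI ballI allI impI)
    show "E \<subseteq> ?B \<times> ?B" by (auto simp: E_def)
    show "(x, y) \<in> E" if "x \<in> ?B" "y \<in> ?B" "x \<preceq> y" for x y
      using sub order_coneD(3)[OF G that] by blast
    show "(x \<oplus> x', y \<oplus> y') \<in> E" if xy: "(x, y) \<in> E" "(x', y') \<in> E" for x y x' y'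
    proof -
      obtain n k n' k' where n: "n > 0" "([(n::nat)] \<cdot> x \<oplus> [(k::nat)] \<cdot> d, [n] \<cdot> y \<oplus> [k] \<cdot> c) \<in> G"
        and n': "n' > 0" "([(n'::nat)] \<cdot> x' \<oplus> [(k'::nat)] \<cdot> d, [n'] \<cdot> y' \<oplus> [k'] \<cdot> c) \<in> G"
        and b: "x \<in> ?B" "y \<in> ?B" "x' \<in> ?B" "y' \<in> ?B" using xy by (auto simp: E_def)
      note bc = B[OF b(1)] B[OF b(2)] B[OF b(3)] B[OF b(4)]
      have "([n'] \<cdot> ([n] \<cdot> x \<oplus> [k] \<cdot> d) \<oplus> [n] \<cdot> ([n'] \<cdot> x' \<oplus> [k'] \<cdot> d),
          [n'] \<cdot> ([n] \<cdot> y \<oplus> [k] \<cdot> c) \<oplus> [n] \<cdot> ([n'] \<cdot> y' \<oplus> [k'] \<cdot> c)) \<in> G"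
        by (intro order_coneD(4)[OF G] order_cone_add_pow[OF u G] n(2) n'(2))
      moreover have "[n'] \<cdot> ([n] \<cdot> v \<oplus> [k] \<cdot> e) \<oplus> [n] \<cdot> ([n'] \<cdot> v' \<oplus> [k'] \<cdot> e) =
          [(n * n')] \<cdot> (v \<oplus> v') \<oplus> [(n' * k + n * k')] \<cdot> e"
        if "v \<in> carrier S" "v' \<in> carrier S" "e \<in> carrier S" for v v' e
        using that by (simp add: add.nat_pow_distrib add.nat_pow_pow a_ac mult.commute add.nat_pow_mult[symmetric])
      ultimately have "([(n * n')] \<cdot> (x \<oplus> x') \<oplus> [(n' * k + n * k')] \<cdot> d,
          [(n * n')] \<cdot> (y \<oplus> y') \<oplus> [(n' * k + n * k')] \<cdot> c) \<in> G" using bc cc by simp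
      moreover have "0 < n * n'" using n(1) n'(1) by simp
      moreover have "x \<oplus> x' \<in> ?B" "y \<oplus> y' \<in> ?B" using b bc by (auto simp: add)
      ultimately show ?thesis unfolding E_def by blast
    qed
    show "(x, y) \<in> E" if xyz: "x \<in> ?B" "y \<in> ?B" "z \<in> ?B" "(x \<oplus> z, y \<oplus> z) \<in> E" for x y z
    proof -
      obtain n k where n: "n > 0" "([(n::nat)] \<cdot> (x \<oplus> z) \<oplus> [(k::nat)] \<cdot> d, [n] \<cdot> (y \<oplus> z) \<oplus> [k] \<cdot> c) \<in> G"
        using xyz by (auto simp: E_def)
      note bc = B[OF xyz(1)] B[OF xyz(2)] B[OF xyz(3)]
      have "(([n] \<cdot> x \<oplus> [k] \<cdot> d) \<oplus> [n] \<cdot> z, ([n] \<cdot> y \<oplus> [k] \<cdot> c) \<oplus> [n] \<cdot> z) \<in> G"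
        using n(2) bc cc by (simp add: add.nat_pow_distrib a_ac)
      from order_coneD(5)[OF G _ _ _ this] have "([n] \<cdot> x \<oplus> [k] \<cdot> d, [n] \<cdot> y \<oplus> [k] \<cdot> c) \<in> G"
        using xyz(1-3) c d bc cc by (simp add: add pow)
      then show ?thesis unfolding E_def using xyz n(1) by blast
    qed
    show "(x, y) \<in> E" if xy: "x \<in> ?B" "y \<in> ?B" "0 < m" "([(m::nat)] \<cdot> x, [m] \<cdot> y) \<in> E" for x y m
    proof -
      obtain n k where n: "n > 0" "([(n::nat)] \<cdot> ([m] \<cdot> x) \<oplus> [(k::nat)] \<cdot> d, [n] \<cdot> ([m] \<cdot> y) \<oplus> [k] \<cdot> c) \<in> G"
        using xy by (auto simp: E_def)
      have "([(n * m)] \<cdot> x \<oplus> [k] \<cdot> d, [(n * m)] \<cdot> y \<oplus> [k] \<cdot> c) \<in> G" "0 < n * m"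
        using n xy B by (auto simp: add.nat_pow_pow mult.commute)
      then show ?thesis unfolding E_def using xy by blast
    qed
  qed
qed

lemma maximal_order_cone:
  assumes u: "u \<in> carrier S" and pq: "p \<in> bounded_by u" "q \<in> bounded_by u"
    and G0: "order_cone u G0" "(p, q) \<notin> G0"
  obtains G where "order_cone u G" "(p, q) \<notin> G"
    "\<And>x y. \<lbrakk>x \<in> bounded_by u; y \<in> bounded_by u\<rbrakk> \<Longrightarrow> (x, y) \<in> G \<or> (y, x) \<in> G"
proof -
  let ?B = "bounded_by u"
  note B = bounded_by_carrier[of _ u] and add = bounded_by_add_iff[OF u] and pow = bounded_by_add_pow[OF u]
  let ?A = "{G. order_cone u G \<and> (p, q) \<notin> G}"
  have "\<exists>M\<in>?A. \<forall>Y\<in>?A. M \<subseteq> Y \<longrightarrow> Y = M"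
  proof (rule subset_Zorn_nonempty)
    show "?A \<noteq> {}" using G0 by blast
    fix \<C> assume C: "\<C> \<noteq> {}" "subset.chain ?A \<C>"
    have G: "order_cone u G" "(p, q) \<notin> G" if "G \<in> \<C>" for G
      using C(2) that unfolding subset.chain_def by auto
    have dir: "\<exists>K\<in>\<C>. e \<in> K \<and> e' \<in> K" if "e \<in> \<Union>\<C>" "e' \<in> \<Union>\<C>" for e e'
      using C(2) that unfolding subset_chain_def by (meson UnionE subsetD)
    have "order_cone u (\<Union>\<C>)"
      unfolding order_cone_def
    proof (intro conjI ballI allI impI)
      show "\<Union>\<C> \<subseteq> ?B \<times> ?B" using order_coneD(1,2)[OF G(1)] by auto
      show "(x, y) \<in> \<Union>\<C>" if "x \<in> ?B" "y \<in> ?B" "x \<preceq> y" for x y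
        using C(1) order_coneD(3)[OF G(1) that] by blast
      show "(x \<oplus> x', y \<oplus> y') \<in> \<Union>\<C>" if "(x, y) \<in> \<Union>\<C>" "(x', y') \<in> \<Union>\<C>" for x y x' y'
        using dir[OF that] order_coneD(4)[OF G(1)] by blast
      show "(x, y) \<in> \<Union>\<C>" if "x \<in> ?B" "y \<in> ?B" "z \<in> ?B" "(x \<oplus> z, y \<oplus> z) \<in> \<Union>\<C>" for x y z
        using that(4) order_coneD(5)[OF G(1) that(1-3)] by blast
      show "(x, y) \<in> \<Union>\<C>" if "x \<in> ?B" "y \<in> ?B" "0 < n" "([(n::nat)] \<cdot> x, [n] \<cdot> y) \<in> \<Union>\<C>" for x y n
        using that(4) order_coneD(6)[OF G(1) that(1-3)] by blast
    qed
    then show "\<Union>\<C> \<in> ?A" using G(2) by blast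
  qed
  then obtain G where G: "order_cone u G" "(p, q) \<notin> G" and
    max: "\<And>Y. order_cone u Y \<Longrightarrow> (p, q) \<notin> Y \<Longrightarrow> G \<subseteq> Y \<Longrightarrow> Y = G" by blast
  \<comment> \<open>By maximality, adding a missing pair must bring in (p, q). The multiplicity k of
    the added pair is positive, since otherwise (p, q) would already lie in G.\<close>
  have witness: "\<exists>n>0. \<exists>k>0. ([(n::nat)] \<cdot> p \<oplus> [(k::nat)] \<cdot> d, [n] \<cdot> q \<oplus> [k] \<cdot> c) \<in> G"
    if cd: "c \<in> ?B" "d \<in> ?B" "(c, d) \<notin> G" for c d
  proof -
    note ext = order_cone_extend[OF u G(1) cd(1,2)]
    have "(p, q) \<in> {(x, y). x \<in> ?B \<and> y \<in> ?B \<and> (\<exists>n>0. \<exists>k. ([(n::nat)] \<cdot> x \<oplus> [(k::nat)] \<cdot> d, [n] \<cdot> y \<oplus> [k] \<cdot> c) \<in> G)}"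
      using max[OF ext(1)] ext(2,3) cd(3) by blast
    then obtain n k where n: "n > 0" "([(n::nat)] \<cdot> p \<oplus> [(k::nat)] \<cdot> d, [n] \<cdot> q \<oplus> [k] \<cdot> c) \<in> G" by blast
    moreover have "k > 0"
    proof (rule ccontr)
      assume "\<not> k > 0"
      then have "([n] \<cdot> p, [n] \<cdot> q) \<in> G" using n(2) pq B by simp
      then show False using order_coneD(6)[OF G(1) pq n(1)] G(2) by blast
    qed
    ultimately show ?thesis by blast
  qed
  have "(x, y) \<in> G \<or> (y, x) \<in> G" if xy: "x \<in> ?B" "y \<in> ?B" for x y
  proof (rule ccontr)
    assume no: "\<not> ((x, y) \<in> G \<or> (y, x) \<in> G)"
    obtain n k where n: "n > 0" "k > 0" "([(n::nat)] \<cdot> p \<oplus> [(k::nat)] \<cdot> y, [n] \<cdot> q \<oplus> [k] \<cdot> x) \<in> G"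
      using witness[OF xy] no by blast
    obtain n' k' where n': "n' > 0" "k' > 0" "([(n'::nat)] \<cdot> p \<oplus> [(k'::nat)] \<cdot> x, [n'] \<cdot> q \<oplus> [k'] \<cdot> y) \<in> G"
      using witness[OF xy(2,1)] no by blast
    note c = B[OF xy(1)] B[OF xy(2)] B[OF pq(1)] B[OF pq(2)]
    \<comment> \<open>The weights k' and k turn the contributions of x and y on both sides into the
      same multiple of x + y. Cancelling it leaves a positive multiple of the omitted pair.\<close>
    have "([k'] \<cdot> ([n] \<cdot> p \<oplus> [k] \<cdot> y) \<oplus> [k] \<cdot> ([n'] \<cdot> p \<oplus> [k'] \<cdot> x),
        [k'] \<cdot> ([n] \<cdot> q \<oplus> [k] \<cdot> x) \<oplus> [k] \<cdot> ([n'] \<cdot> q \<oplus> [k'] \<cdot> y)) \<in> G"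
      by (intro order_coneD(4)[OF G(1)] order_cone_add_pow[OF u G(1)] n(3) n'(3))
    moreover have "[k'] \<cdot> ([n] \<cdot> v \<oplus> [k] \<cdot> w) \<oplus> [k] \<cdot> ([n'] \<cdot> v \<oplus> [k'] \<cdot> w') =
        [(k' * n + k * n')] \<cdot> v \<oplus> [(k * k')] \<cdot> (w \<oplus> w')"
      if "v \<in> carrier S" "w \<in> carrier S" "w' \<in> carrier S" for v w w'
      using that by (simp add: add.nat_pow_distrib add.nat_pow_pow a_ac mult.commute add.nat_pow_mult[symmetric])
    ultimately have "([(k' * n + k * n')] \<cdot> p \<oplus> [(k * k')] \<cdot> (x \<oplus> y), [(k' * n + k * n')] \<cdot> q \<oplus> [(k * k')] \<cdot> (x \<oplus> y)) \<in> G"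
      using c by (simp add: a_comm)
    from order_coneD(5)[OF G(1) _ _ _ this]
    have "([(k' * n + k * n')] \<cdot> p, [(k' * n + k * n')] \<cdot> q) \<in> G"
      using pq xy c by (simp add: add pow)
    moreover have "0 < k' * n + k * n'" using n(1) n'(2) by simp
    ultimately have "(p, q) \<in> G" by (rule order_coneD(6)[OF G(1) pq, rotated])
    then show False using G(2) by blast
  qed
  then show ?thesis using that G by blast
qed

text \<open>The cone must omit the relation N b <= K u; totality then gives K u <= N b, which is the
  lower bound on \<open>h b\<close>. The hypotheses say that the slopes k/n of all relations n b <=
  k u are at least K0/N0, in cross-multiplied form. The strict gap to K/N pays for the summand z
  cancelled in the initial cone.\<close>

theorem additive_functional_exists:
  assumes u: "u \<in> carrier S" and b: "b \<in> bounded_by u"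
    and ratio: "K * N0 < K0 * (N::nat)"
    and bound: "\<And>n k :: nat. \<lbrakk>0 < n; [n] \<cdot> b \<preceq> [k] \<cdot> u\<rbrakk> \<Longrightarrow> n * K0 \<le> k * N0"
  obtains h :: "'a \<Rightarrow> ennreal" where
    "h \<zero> = 0" "\<And>x y. \<lbrakk>x \<in> carrier S; y \<in> carrier S\<rbrakk> \<Longrightarrow> h (x \<oplus> y) = h x + h y"
    "\<And>x y. \<lbrakk>x \<in> carrier S; y \<in> carrier S; x \<preceq> y\<rbrakk> \<Longrightarrow> h x \<le> h y"
    "h u = 1" "of_nat K \<le> of_nat N * h b"
proof -
  let ?B = "bounded_by u"
  note B = bounded_by_carrier[of _ u] and add = bounded_by_add_iff[OF u] and pow = bounded_by_add_pow[OF u]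
  have uB: "u \<in> ?B" by (rule bounded_by_self[OF u])
  let ?G0 = "{(x, y). x \<in> ?B \<and> y \<in> ?B \<and> (\<exists>n>0. \<exists>z\<in>?B. [(n::nat)] \<cdot> x \<oplus> z \<preceq> [n] \<cdot> y \<oplus> z)}"
  have "([N] \<cdot> b, [K] \<cdot> u) \<notin> ?G0"
  proof
    assume "([N] \<cdot> b, [K] \<cdot> u) \<in> ?G0"
    then obtain n z where n: "n > 0" "z \<in> ?B" "[(n::nat)] \<cdot> ([N] \<cdot> b) \<oplus> z \<preceq> [n] \<cdot> ([K] \<cdot> u) \<oplus> z" by blast
    obtain m :: nat where m: "z \<preceq> [m] \<cdot> u" using n(2) by (auto simp: bounded_by_def)
    note c = B[OF n(2)] B[OF b] u
    define v where "v = [n] \<cdot> ([N] \<cdot> b)"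
    define w where "w = [n] \<cdot> ([K] \<cdot> u)"
    have vw: "v \<in> carrier S" "w \<in> carrier S" "v \<oplus> z \<preceq> w \<oplus> z" using c n(3) by (auto simp: v_def w_def)
    have iter: "[j] \<cdot> v \<oplus> z \<preceq> [j] \<cdot> w \<oplus> z" for j :: nat
    proof (induction j)
      case (Suc j)
      have "([j] \<cdot> v \<oplus> z) \<oplus> v \<preceq> ([j] \<cdot> w \<oplus> z) \<oplus> v" using vw c Suc by (intro add_right_mono[of "[j] \<cdot> v \<oplus> z"]) auto
      moreover have "(v \<oplus> z) \<oplus> [j] \<cdot> w \<preceq> (w \<oplus> z) \<oplus> [j] \<cdot> w" using vw c by (intro add_right_mono[of "v \<oplus> z"]) auto
      ultimately show ?case
        using vw c le_trans[of "[Suc j] \<cdot> v \<oplus> z" "[j] \<cdot> w \<oplus> (z \<oplus> v)" "[Suc j] \<cdot> w \<oplus> z"] by (simp add: a_ac)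
    qed (use c in simp)
    \<comment> \<open>The summand z costs m copies of u once, independently of j, whereas the
      integer gap \<open>ratio\<close> contributes at least j n. Together they would give j n <= m
      N0, and j is chosen to violate this.\<close>
    define j where "j = m * N0 + 1"
    have "[j] \<cdot> v \<preceq> [j] \<cdot> v \<oplus> z" using vw c by (intro le_add_left) auto
    moreover have "[j] \<cdot> w \<oplus> z \<preceq> [j] \<cdot> w \<oplus> [m] \<cdot> u" using vw c m by (intro add_mono') auto
    ultimately have "[j] \<cdot> v \<preceq> [j] \<cdot> w \<oplus> [m] \<cdot> u"
      using vw c iter[of j] le_trans[of "[j] \<cdot> v" "[j] \<cdot> v \<oplus> z" "[j] \<cdot> w \<oplus> z"]
        le_trans[of "[j] \<cdot> v" "[j] \<cdot> w \<oplus> z" "[j] \<cdot> w \<oplus> [m] \<cdot> u"] by simp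
    then have "[(j * (n * N))] \<cdot> b \<preceq> [(j * (n * K) + m)] \<cdot> u"
      unfolding v_def w_def using c by (simp add: add.nat_pow_pow add.nat_pow_mult mult_ac)
    moreover have "0 < N" using ratio by (cases N) auto
    then have "0 < j * (n * N)" using n(1) by (simp add: j_def)
    ultimately have "j * (n * N) * K0 \<le> (j * (n * K) + m) * N0" using bound by blast
    moreover have "j * n * (K * N0) + j * n \<le> j * n * (K0 * N)"
      using ratio by (metis Suc_leI mult_le_mono2 mult_Suc_right add.commute)
    ultimately have "j * n \<le> m * N0" by (simp add: algebra_simps)
    moreover have "j \<le> j * n" using n(1) by simp
    ultimately show False by (simp add: j_def)
  qed
  then obtain G where G: "order_cone u G" "([N] \<cdot> b, [K] \<cdot> u) \<notin> G"
    and total: "\<And>x y. \<lbrakk>x \<in> ?B; y \<in> ?B\<rbrakk> \<Longrightarrow> (x, y) \<in> G \<or> (y, x) \<in> G"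
    by (rule maximal_order_cone[OF u pow[OF b] pow[OF uB] order_cone_initial[OF u]]) blast
  note le_G = order_coneD(3)[OF G(1)] and add_G = order_coneD(4)[OF G(1)] and trans_G = order_cone_trans[OF G(1)]
    and pow_G = order_cone_add_pow[OF u G(1)]
  have zB: "\<zero> \<in> ?B" by (rule bounded_by_zero[OF u])
  have pu: "[k] \<cdot> u \<in> ?B" for k :: nat by (rule pow[OF uB])
  \<comment> \<open>If a larger multiple of u were below a smaller one, cancellation would put (u,
    0) into G. As b lies below a multiple of u, this gives N b <= 0 <= K u, the omitted
    pair.\<close>
  have nondeg: "j \<ge> i" if "([(i::nat)] \<cdot> u, [(j::nat)] \<cdot> u) \<in> G" for i j
  proof (rule ccontr)
    assume "\<not> j \<ge> i"
    define k where "k = i - j"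
    have k: "i = k + j" "k > 0" using \<open>\<not> j \<ge> i\<close> by (auto simp: k_def)
    have "([k] \<cdot> u \<oplus> [j] \<cdot> u, \<zero> \<oplus> [j] \<cdot> u) \<in> G" using that u by (simp add: k(1) add.nat_pow_mult)
    then have "([k] \<cdot> u, \<zero>) \<in> G" by (rule order_coneD(5)[OF G(1) pu zB pu])
    then have "(u, \<zero>) \<in> G" using order_coneD(6)[OF G(1) uB zB k(2)] by simp
    obtain m :: nat where m: "b \<preceq> [m] \<cdot> u" using b by (auto simp: bounded_by_def)
    have "([N] \<cdot> b, [N] \<cdot> ([m] \<cdot> u)) \<in> G" by (rule pow_G[OF le_G[OF b pu m]])
    moreover have "([N] \<cdot> ([m] \<cdot> u), [N] \<cdot> ([m] \<cdot> \<zero>)) \<in> G" by (intro pow_G \<open>(u, \<zero>) \<in> G\<close>)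
    moreover have "([N] \<cdot> ([m] \<cdot> \<zero>), [K] \<cdot> u) \<in> G" using le_G[OF zB pu] u by simp
    ultimately show False using G(2) trans_G by blast
  qed
  define Q where "Q x = {real k / real n |k n. 0 < n \<and> ([n] \<cdot> x, [k] \<cdot> u) \<in> G}" for x
  define L where "L x = Inf (Q x)" for x
  have Q_ne: "Q x \<noteq> {}" if "x \<in> ?B" for x
  proof -
    obtain m :: nat where "x \<preceq> [m] \<cdot> u" using \<open>x \<in> ?B\<close> by (auto simp: bounded_by_def)
    then have "([(1::nat)] \<cdot> x, [m] \<cdot> u) \<in> G" using le_G[OF that pu] B[OF that] by simp
    then show ?thesis unfolding Q_def using zero_less_one by blast
  qed
  have Q_bdd: "bdd_below (Q x)" for x by (rule bdd_belowI[of _ 0]) (auto simp: Q_def)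
  have upper: "L x \<le> real k / real n" if "0 < n" "([n] \<cdot> x, [k] \<cdot> u) \<in> G" for x n k
    unfolding L_def by (rule cInf_lower[OF _ Q_bdd]) (use that in \<open>auto simp: Q_def\<close>)
  have lower: "real k / real n \<le> L x" if x: "x \<in> ?B" and n: "0 < n" "([k] \<cdot> u, [n] \<cdot> x) \<in> G" for x n k
    unfolding L_def
  proof (rule cInf_greatest[OF Q_ne[OF x]])
    fix t assume "t \<in> Q x"
    then obtain m j where m: "t = real j / real m" "0 < m" "([m] \<cdot> x, [j] \<cdot> u) \<in> G" by (auto simp: Q_def)
    have "([m] \<cdot> ([k] \<cdot> u), [m] \<cdot> ([n] \<cdot> x)) \<in> G" "([n] \<cdot> ([m] \<cdot> x), [n] \<cdot> ([j] \<cdot> u)) \<in> G"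
      by (intro pow_G n(2) m(3))+
    then have "([(m * k)] \<cdot> u, [(n * j)] \<cdot> u) \<in> G"
      using trans_G u B[OF x] by (simp add: add.nat_pow_pow mult.commute)
    then have "real (m * k) \<le> real (n * j)" using nondeg by (simp only: of_nat_le_iff)
    then show "real k / real n \<le> t" unfolding m(1) using m(2) n(1) by (simp add: field_simps)
  qed
  have L_nonneg: "0 \<le> L x" if "x \<in> ?B" for x
    using lower[OF that, of 1 0] le_G[OF zB that] B[OF that] by simp
  have approx: "\<exists>k k'. ([n] \<cdot> x, [k] \<cdot> u) \<in> G \<and> real k \<le> real n * L x + 1 \<and>
      ([k'] \<cdot> u, [n] \<cdot> x) \<in> G \<and> real n * L x - 2 \<le> real k'"
    if x: "x \<in> ?B" and n: "0 < n" for x and n :: nat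
  proof -
    define f where "f = nat \<lfloor>real n * L x\<rfloor>"
    have f: "real f \<le> real n * L x" "real n * L x < real f + 1"
      using L_nonneg[OF x] by (auto simp: f_def)
    have "([Suc f] \<cdot> u, [n] \<cdot> x) \<notin> G"
    proof
      assume "([Suc f] \<cdot> u, [n] \<cdot> x) \<in> G"
      from lower[OF x n this] f(2) n show False by (simp add: field_simps)
    qed
    then have 1: "([n] \<cdot> x, [Suc f] \<cdot> u) \<in> G" using total[OF pow[OF x] pu] by blast
    \<comment> \<open>Comparison at f itself is not settled by the cut, since n L may equal f; one
      step is therefore given up on the lower side. Natural subtraction makes the bound trivial for
      f = 0.\<close>
    have 2: "([(f - 1)] \<cdot> u, [n] \<cdot> x) \<in> G"
    proof (cases "f = 0")
      case True
      then show ?thesis using le_G[OF zB pow[OF x, of n]] B[OF x] by simp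
    next
      case False
      have "([n] \<cdot> x, [(f - 1)] \<cdot> u) \<notin> G"
      proof
        assume "([n] \<cdot> x, [(f - 1)] \<cdot> u) \<in> G"
        from upper[OF n this] f(1) n False show False by (simp add: field_simps)
      qed
      then show ?thesis using total[OF pow[OF x] pu] by blast
    qed
    show ?thesis using 1 2 f by (intro exI[of _ "Suc f"] exI[of _ "f - 1"]) auto
  qed
  have L_add: "L (x \<oplus> y) = L x + L y" if x: "x \<in> ?B" and y: "y \<in> ?B" for x y
  proof -
    note c = B[OF x] B[OF y]
    have xy: "x \<oplus> y \<in> ?B" using x y c by (simp add: add)
    have *: "\<bar>L (x \<oplus> y) - (L x + L y)\<bar> \<le> 4 / real n" if n: "0 < n" for n :: nat
    proof -
      obtain k k' where k: "([n] \<cdot> x, [k] \<cdot> u) \<in> G" "real k \<le> real n * L x + 1"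
        "([k'] \<cdot> u, [n] \<cdot> x) \<in> G" "real n * L x - 2 \<le> real k'" using approx[OF x n] by blast
      obtain l l' where l: "([n] \<cdot> y, [l] \<cdot> u) \<in> G" "real l \<le> real n * L y + 1"
        "([l'] \<cdot> u, [n] \<cdot> y) \<in> G" "real n * L y - 2 \<le> real l'" using approx[OF y n] by blast
      have "([n] \<cdot> (x \<oplus> y), [(k + l)] \<cdot> u) \<in> G" "([(k' + l')] \<cdot> u, [n] \<cdot> (x \<oplus> y)) \<in> G"
        using add_G[OF k(1) l(1)] add_G[OF k(3) l(3)] c u by (simp_all add: add.nat_pow_distrib add.nat_pow_mult)
      from upper[OF n this(1)] lower[OF xy n this(2)]
      have "real n * L (x \<oplus> y) \<le> real k + real l" "real k' + real l' \<le> real n * L (x \<oplus> y)"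
        using n by (simp_all add: field_simps)
      then have "\<bar>real n * (L (x \<oplus> y) - (L x + L y))\<bar> \<le> 4" using k l by (simp add: algebra_simps abs_le_iff)
      then have "real n * \<bar>L (x \<oplus> y) - (L x + L y)\<bar> \<le> 4" by (simp only: abs_mult abs_of_nat)
      then show ?thesis using n by (simp add: pos_le_divide_eq mult.commute)
    qed
    have "\<bar>L (x \<oplus> y) - (L x + L y)\<bar> \<le> 0"
    proof (rule ccontr)
      assume "\<not> \<bar>L (x \<oplus> y) - (L x + L y)\<bar> \<le> 0"
      then have pos: "0 < \<bar>L (x \<oplus> y) - (L x + L y)\<bar>" by simp
      obtain n :: nat where n: "4 / \<bar>L (x \<oplus> y) - (L x + L y)\<bar> < real n" using reals_Archimedean2 by blast
      then have "0 < n" using pos by (metis divide_pos_pos of_nat_0_less_iff order.strict_trans zero_less_numeral)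
      then show False using *[of n] n pos by (simp add: field_simps)
    qed
    then show ?thesis by simp
  qed
  have L_mono: "L x \<le> L y" if x: "x \<in> ?B" and y: "y \<in> ?B" and le: "x \<preceq> y" for x y
    unfolding L_def
  proof (rule cInf_superset_mono[OF Q_ne[OF y] Q_bdd])
    show "Q y \<subseteq> Q x"
      unfolding Q_def using trans_G[OF pow_G[OF le_G[OF x y le]]] by blast
  qed
  \<comment> \<open>Additivity survives the infinite value because a sum is bounded by a multiple of
    u exactly if both summands are.\<close>
  define h where "h x = (if x \<in> ?B then ennreal (L x) else Orderings.top)" for x
  have L_zero: "L \<zero> = 0" using L_add[OF zB zB] by simp
  show ?thesis
  proof (rule that[of h])
    show "h \<zero> = 0" using zB L_zero by (simp add: h_def)
    show "h (x \<oplus> y) = h x + h y" if "x \<in> carrier S" "y \<in> carrier S" for x y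
      using that by (auto simp: h_def add L_add L_nonneg)
    show "h x \<le> h y" if "x \<in> carrier S" "y \<in> carrier S" "x \<preceq> y" for x y
      using bounded_by_down[OF _ u that(1,3)] L_mono[OF _ _ that(3)] by (auto simp: h_def intro: ennreal_leI)
    have "([(1::nat)] \<cdot> u, [(1::nat)] \<cdot> u) \<in> G" using le_G[OF uB uB] u by simp
    then have "L u = 1" using upper[of 1 u 1] lower[OF uB, of 1 1] by simp
    then show "h u = 1" using uB by (simp add: h_def)
    have "([K] \<cdot> u, [N] \<cdot> b) \<in> G" using G(2) total[OF pow[OF b] pu] by blast
    moreover have N: "0 < N" using ratio by (cases N) auto
    ultimately have "real K \<le> real N * L b" using lower[OF b] by (simp add: field_simps)
    then have "ennreal (real K) \<le> ennreal (real N * L b)" by (rule ennreal_leI)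
    then show "of_nat K \<le> of_nat N * h b"
      using b L_nonneg[OF b] by (simp add: h_def ennreal_mult ennreal_of_nat_eq_real_of_nat)
  qed
qed

end


section \<open>Biadditive maps on solid Cu-semirings\<close>

text \<open>The preorder \<open>tensor_le\<close> only involves finite sums, so it is respected by every biadditive
  monotone map, whether or not the map preserves suprema or the way-below relation.\<close>

locale biadditive_pair = cu_pair S T + P: positively_ordered_semigroup P
  for S :: "('a, 'm) cu_scheme" and T :: "('b, 'n) cu_scheme" and P :: "('c, 'k) cu_scheme" +
  fixes \<psi> :: "'a \<Rightarrow> 'b \<Rightarrow> 'c"
  assumes closed: "\<lbrakk>a \<in> carrier S; b \<in> carrier T\<rbrakk> \<Longrightarrow> \<psi> a b \<in> carrier P"
    and add_left: "\<lbrakk>a1 \<in> carrier S; a2 \<in> carrier S; b \<in> carrier T\<rbrakk> \<Longrightarrow>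
      \<psi> (a1 \<oplus>\<^bsub>S\<^esub> a2) b = \<psi> a1 b \<oplus>\<^bsub>P\<^esub> \<psi> a2 b"
    and add_right: "\<lbrakk>a \<in> carrier S; b1 \<in> carrier T; b2 \<in> carrier T\<rbrakk> \<Longrightarrow>
      \<psi> a (b1 \<oplus>\<^bsub>T\<^esub> b2) = \<psi> a b1 \<oplus>\<^bsub>P\<^esub> \<psi> a b2"
    and zero_left: "b \<in> carrier T \<Longrightarrow> \<psi> \<zero>\<^bsub>S\<^esub> b = \<zero>\<^bsub>P\<^esub>"
    and zero_right: "a \<in> carrier S \<Longrightarrow> \<psi> a \<zero>\<^bsub>T\<^esub> = \<zero>\<^bsub>P\<^esub>"
    and mono_left: "\<lbrakk>a1 \<in> carrier S; a2 \<in> carrier S; b \<in> carrier T; a1 \<preceq>\<^bsub>S\<^esub> a2\<rbrakk> \<Longrightarrow>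
      \<psi> a1 b \<preceq>\<^bsub>P\<^esub> \<psi> a2 b"
    and mono_right: "\<lbrakk>a \<in> carrier S; b1 \<in> carrier T; b2 \<in> carrier T; b1 \<preceq>\<^bsub>T\<^esub> b2\<rbrakk> \<Longrightarrow>
      \<psi> a b1 \<preceq>\<^bsub>P\<^esub> \<psi> a b2"
begin

lemma mono_both:
  assumes "a1 \<in> carrier S" "a2 \<in> carrier S" "b1 \<in> carrier T" "b2 \<in> carrier T" "a1 \<preceq>\<^bsub>S\<^esub> a2" "b1 \<preceq>\<^bsub>T\<^esub> b2"
  shows "\<psi> a1 b1 \<preceq>\<^bsub>P\<^esub> \<psi> a2 b2"
  using P.le_trans[OF _ _ _ mono_left[OF assms(1-3,5)] mono_right[OF assms(2-4,6)]] assms closed by simp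

definition msum :: "('a \<times> 'b) multiset \<Rightarrow> 'c" where
  "msum = fold_mset (\<lambda>p s. if p \<in> C \<and> s \<in> carrier P then \<psi> (fst p) (snd p) \<oplus>\<^bsub>P\<^esub> s else s) \<zero>\<^bsub>P\<^esub>"

lemma msum_empty [simp]: "msum {#} = \<zero>\<^bsub>P\<^esub>"
  by (simp add: msum_def)

lemma msum_step: "msum (add_mset p x) =
   (if p \<in> C \<and> msum x \<in> carrier P then \<psi> (fst p) (snd p) \<oplus>\<^bsub>P\<^esub> msum x else msum x)"
proof -
  interpret comp_fun_commute
    "\<lambda>p s. if p \<in> C \<and> s \<in> carrier P then \<psi> (fst p) (snd p) \<oplus>\<^bsub>P\<^esub> s else s"
    by standard (auto simp: fun_eq_iff closed P.a_lcomm)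
  show ?thesis unfolding msum_def by simp
qed

lemma msum_closed [simp]: "msum x \<in> carrier P"
  by (induction x) (auto simp: msum_step closed)

lemma msum_add_mset [simp]:
  "\<lbrakk>a \<in> carrier S; b \<in> carrier T\<rbrakk> \<Longrightarrow> msum (add_mset (a, b) x) = \<psi> a b \<oplus>\<^bsub>P\<^esub> msum x"
  by (simp add: msum_step)

lemma msum_add: "set_mset x \<subseteq> C \<Longrightarrow> msum (x + y) = msum x \<oplus>\<^bsub>P\<^esub> msum y"
  by (induction x) (auto simp: closed P.a_assoc)

lemma msum_mono: "x \<lesssim> y \<Longrightarrow> msum x \<preceq>\<^bsub>P\<^esub> msum y"
proof (induction rule: tensor_le.induct)
  case (trans x y z)
  then show ?case using P.le_trans[of "msum x" "msum y" "msum z"] by simp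
next
  case (add x y z)
  then show ?case using tle_carrier[OF add.hyps(1)] by (simp add: msum_add P.add_right_mono)
next
  case (mono a' a b' b)
  then show ?case using mono_both[of a' a b' b] by (simp add: closed)
qed (auto simp: closed add_left add_right zero_left zero_right P.a_ac)

lemma tensor_le_singleD:
  assumes "{#(a', b')#} \<lesssim> {#(a, b)#}" shows "\<psi> a' b' \<preceq>\<^bsub>P\<^esub> \<psi> a b"
  using msum_mono[OF assms] tle_carrier[OF assms] by (simp add: closed)

end

definition ennreal_semigroup :: "ennreal cu" where
  "ennreal_semigroup = \<lparr>carrier = UNIV, mult = (*), one = 1, zero = 0, add = (+), leq = (\<le>)\<rparr>"

lemma positively_ordered_ennreal: "positively_ordered_semigroup ennreal_semigroup"
  by unfold_locales (auto simp: ennreal_semigroup_def add_ac intro: add_mono)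

context cu_semigroup
begin

lemma le_if_way_below:
  assumes "a \<in> carrier S" "b \<in> carrier S" "\<And>a'. a' \<lless> a \<Longrightarrow> a' \<preceq> b" shows "a \<preceq> b"
proof -
  obtain c where c: "\<forall>n. c n \<lless> c (Suc n)" "is_sup S (range c) a" using O2[OF assms(1)] by blast
  then show ?thesis using assms(2,3) is_sup_below[OF c] unfolding is_sup_def by blast
qed

lemma le_zero_iff: "a \<in> carrier S \<Longrightarrow> a \<preceq> \<zero> \<longleftrightarrow> a = \<zero>"
  using le_antisym[of a "\<zero>"] by auto

lemma add_eq_zero_iff: "\<lbrakk>a \<in> carrier S; b \<in> carrier S\<rbrakk> \<Longrightarrow> a \<oplus> b = \<zero> \<longleftrightarrow> a = \<zero> \<and> b = \<zero>"
  using le_add_left[of a b] le_add_right[of b a] le_zero_iff by auto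

lemma nonzero_way_below:
  assumes "a \<in> carrier S" "a \<noteq> \<zero>" obtains a' where "a' \<lless> a" "a' \<noteq> \<zero>"
proof -
  have "\<not> a \<preceq> \<zero>" using assms le_zero_iff by blast
  then obtain a' where "a' \<lless> a" "\<not> a' \<preceq> \<zero>" using le_if_way_below[OF assms(1), of "\<zero>"] by blast
  then show ?thesis using that way_belowD[of S a' a] le_refl[of a'] by metis
qed

lemma add_pow_way_below: "a \<lless> b \<Longrightarrow> [(n::nat)] \<cdot> a \<lless> [n] \<cdot> b"
  by (induction n) (auto intro: O3)

end

context cu_bimorphism_pair
begin

lemma bim_add_pow_left:
  "\<lbrakk>a \<in> carrier S; b \<in> carrier T\<rbrakk> \<Longrightarrow> \<phi> ([(n::nat)] \<cdot>\<^bsub>S\<^esub> a) b = [n] \<cdot>\<^bsub>P\<^esub> \<phi> a b"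
  by (induction n) (auto simp: bim_zero_left bim_add_left)

lemma bim_add_pow_right:
  "\<lbrakk>a \<in> carrier S; b \<in> carrier T\<rbrakk> \<Longrightarrow> \<phi> a ([(n::nat)] \<cdot>\<^bsub>T\<^esub> b) = [n] \<cdot>\<^bsub>P\<^esub> \<phi> a b"
  by (induction n) (auto simp: bim_zero_right bim_add_right)

end

sublocale cu_semiring \<subseteq> semiring R
  by unfold_locales (auto simp: M.bim_add_left M.bim_add_right M.bim_zero_left M.bim_zero_right)

section \<open>Consequences of solidity: commutativity, linearity, simplicity\<close>

locale solid_cu_semiring = cu_semiring +
  assumes solid: "solid R"
begin

text \<open>Injectivity of \<mu> identifies the two pure tensors as ideals of formal sums. A tensor
  of way-below elements belongs to the first ideal, hence to the second, and unfolding this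
  membership gives a finite statement about \<open>tensor_le\<close>.\<close>

lemma solid_tensor_le:
  assumes "r \<in> carrier R" "s \<in> carrier R" "a \<in> carrier R" "b \<in> carrier R" "r \<otimes> s = a \<otimes> b"
    and rs: "r' \<lless> r" "s' \<lless> s"
  obtains a' b' where "a' \<lless> a" "b' \<lless> b" "tensor_le R R {#(r', s')#} {#(a', b')#}"
proof -
  have "inj_on (mult_map R) (carrier (cu_tensor R R))"
    using solid unfolding solid_def cu_iso_def bij_betw_def by blast
  then have eq: "pure_tensor R R r s = pure_tensor R R a b"
    using assms(1-5) pure_tensor_closed[OF cu_R cu_R] mult_map_pure by (simp add: inj_on_def)
  have "tensor_below R R {#(r', s')#} {#(r, s)#}" using rs by (intro RR.mwb_imp_twb) simp
  then have "tensor_below R R {#(r', s')#} {#(a, b)#}" using eq unfolding pure_tensor_def by blast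
  then obtain x where x: "tensor_le R R {#(r', s')#} x"
    "rel_mset (rel_prod (way_below R) (way_below R)) x {#(a, b)#}" unfolding tensor_below_def by blast
  from x(2) obtain a' b' where "x = {#(a', b')#}" "a' \<lless> a" "b' \<lless> b" by (rule RR.mwb_single_invR)
  then show ?thesis using that x(1) by blast
qed

lemma solid_biadditive_le:
  assumes "biadditive_pair R R P \<psi>"
    and "r \<in> carrier R" "s \<in> carrier R" "a \<in> carrier R" "b \<in> carrier R" "r \<otimes> s = a \<otimes> b"
    and "r' \<lless> r" "s' \<lless> s"
  obtains a' b' where "a' \<lless> a" "b' \<lless> b" "\<psi> r' s' \<preceq>\<^bsub>P\<^esub> \<psi> a' b'"
  using solid_tensor_le[OF assms(2-8)] biadditive_pair.tensor_le_singleD[OF assms(1)] by metis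

text \<open>Insert a between the factors: the biadditive map (x, y) \<mapsto> x a y takes r
  \<otimes> 1 to r a and 1 \<otimes> r to a r. The approximants u n and e n are then removed by
  continuity.\<close>

lemma m_comm_le:
  assumes a: "a \<in> carrier R" and r: "r \<in> carrier R" shows "r \<otimes> a \<preceq> a \<otimes> r"
proof -
  have bi: "biadditive_pair R R R (\<lambda>x y. x \<otimes> (a \<otimes> y))"
    by unfold_locales (use a in \<open>auto simp: l_distr r_distr intro: mult_mono\<close>)
  obtain u where u: "\<forall>n. u n \<lless> u (Suc n)" "is_sup R (range u) r" using O2[OF r] by blast
  obtain e where e: "\<forall>n. e n \<lless> e (Suc n)" "is_sup R (range e) \<one>" using O2[OF one_closed] by blast
  have cl: "u n \<in> carrier R" "e n \<in> carrier R" for n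
    using way_belowD[OF u(1)[rule_format]] way_belowD[OF e(1)[rule_format]] by simp_all
  have inc: "increasing R u" "increasing R e" using u(1) e(1) by (auto intro: way_below_increasing)
  have ae: "increasing R (\<lambda>n. a \<otimes> e n)" "is_sup R (range (\<lambda>n. a \<otimes> e n)) (a \<otimes> \<one>)"
    using M.bim_sup[OF conjunct1[OF sup_const[OF a]] inc(2) conjunct2[OF sup_const[OF a]] e(2)]
      inc(2) cl a by (auto simp: increasing_def intro: mult_mono)
  have swap: "r \<otimes> \<one> = \<one> \<otimes> r" using r by simp
  have "u n \<otimes> (a \<otimes> e n) \<preceq> a \<otimes> r" for n
  proof -
    obtain a' b' where ab: "a' \<lless> \<one>" "b' \<lless> r" "u n \<otimes> (a \<otimes> e n) \<preceq> a' \<otimes> (a \<otimes> b')"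
      using solid_biadditive_le[OF bi r one_closed one_closed r swap is_sup_below[OF u] is_sup_below[OF e]] .
    have c: "a' \<in> carrier R" "b' \<in> carrier R" using way_belowD[OF ab(1)] way_belowD[OF ab(2)] by simp_all
    have "a' \<otimes> (a \<otimes> b') \<preceq> \<one> \<otimes> (a \<otimes> r)"
      using c a r ab(1,2) by (intro mult_mono) (auto intro: way_below_imp_le)
    then show ?thesis
      using le_trans[OF _ _ _ ab(3)] c cl a r by simp
  qed
  moreover have "is_sup R (range (\<lambda>n. u n \<otimes> (a \<otimes> e n))) (r \<otimes> (a \<otimes> \<one>))"
    by (rule M.bim_sup[OF inc(1) ae(1) u(2) ae(2)])
  ultimately show ?thesis using a r unfolding is_sup_def by auto
qed

sublocale comm_monoid R
  by (rule comm_monoidI) (use m_comm_le le_antisym in \<open>auto simp: m_assoc\<close>)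

text \<open>The map (x, y) \<mapsto> \<alpha>(x) y takes r \<otimes> 1 to \<alpha>(r) and 1
  \<otimes> r to \<alpha>(1) r. As \<alpha> need not preserve way-below, it is treated as a
  biadditive map, and the equality of tensors is used in both directions.\<close>

theorem gen_cu_morphism_eq_mult:
  assumes \<alpha>: "gen_cu_morphism R R \<alpha>" and r: "r \<in> carrier R" shows "\<alpha> r = \<alpha> \<one> \<otimes> r"
proof -
  note A = gen_cu_morphismD[OF \<alpha>]
  have bi: "biadditive_pair R R R (\<lambda>x y. \<alpha> x \<otimes> y)"
    by unfold_locales (auto simp: A l_distr r_distr intro: mult_mono A)
  obtain u where u: "\<forall>n. u n \<lless> u (Suc n)" "is_sup R (range u) r" using O2[OF r] by blast
  obtain e where e: "\<forall>n. e n \<lless> e (Suc n)" "is_sup R (range e) \<one>" using O2[OF one_closed] by blast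
  have cl: "u n \<in> carrier R" "e n \<in> carrier R" for n
    using way_belowD[OF u(1)[rule_format]] way_belowD[OF e(1)[rule_format]] by simp_all
  have inc: "increasing R u" "increasing R e" using u(1) e(1) by (auto intro: way_below_increasing)
  have le: "\<alpha> p \<otimes> q \<preceq> \<alpha> a \<otimes> b"
    if hh: "p \<lless> x" "q \<lless> y" "x \<in> carrier R" "y \<in> carrier R" "x \<otimes> y = a \<otimes> b" "a \<in> carrier R" "b \<in> carrier R" for p q x y a b
  proof -
    obtain a' b' where ab: "a' \<lless> a" "b' \<lless> b" "\<alpha> p \<otimes> q \<preceq> \<alpha> a' \<otimes> b'"
      using solid_biadditive_le[OF bi hh(3,4,6,7,5,1,2)] .
    have c: "a' \<in> carrier R" "b' \<in> carrier R" "p \<in> carrier R" "q \<in> carrier R"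
      using way_belowD[OF ab(1)] way_belowD[OF ab(2)] way_belowD[OF hh(1)] way_belowD[OF hh(2)] by simp_all
    have "\<alpha> a' \<otimes> b' \<preceq> \<alpha> a \<otimes> b"
      using c hh(6,7) ab(1,2) by (intro mult_mono A) (auto intro: way_below_imp_le)
    then show ?thesis using le_trans[OF _ _ _ ab(3)] c hh(6,7) A(1) by simp
  qed
  have "is_sup R (range (\<lambda>n. \<alpha> (u n) \<otimes> e n)) (\<alpha> r \<otimes> \<one>)"
    by (rule M.bim_sup[OF gen_cu_morphism_increasing[OF \<alpha> inc(1)] inc(2) A(5)[OF inc(1) u(2)] e(2)])
  moreover have "\<alpha> (u n) \<otimes> e n \<preceq> \<alpha> \<one> \<otimes> r" for n
    by (rule le[OF is_sup_below[OF u] is_sup_below[OF e]]) (use r in auto)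
  ultimately have 1: "\<alpha> r \<preceq> \<alpha> \<one> \<otimes> r" using r A(1) unfolding is_sup_def by auto
  have "is_sup R (range (\<lambda>n. \<alpha> (e n) \<otimes> u n)) (\<alpha> \<one> \<otimes> r)"
    by (rule M.bim_sup[OF gen_cu_morphism_increasing[OF \<alpha> inc(2)] inc(1) A(5)[OF inc(2) e(2)] u(2)])
  moreover have "\<alpha> (e n) \<otimes> u n \<preceq> \<alpha> r \<otimes> \<one>" for n
    by (rule le[OF is_sup_below[OF e] is_sup_below[OF u]]) (use r in auto)
  ultimately have "\<alpha> \<one> \<otimes> r \<preceq> \<alpha> r" using r A(1) unfolding is_sup_def by auto
  then show ?thesis using 1 le_antisym r A(1) by simp
qed

text \<open>Simplicity: for an ideal \<open>I\<close>, the map that is \<open>0\<close> on \<open>I\<close> and \<open>\<infinity>\<close> elsewhere is additive.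
  Multiplied with the corresponding map for the zero ideal and evaluated on \<open>1 \<otimes> r = r \<otimes> 1\<close>, it shows
  first that \<open>1 \<in> I\<close> as soon as \<open>I \<noteq> 0\<close>, and then that \<open>I\<close> is everything.\<close>

theorem simple:
  assumes r: "r \<in> carrier R" "r \<noteq> \<zero>" and s: "s' \<lless> s"
  shows "\<exists>n::nat. s' \<preceq> [n] \<cdot> r"
proof -
  \<comment> \<open>The order ideal generated by r is closed under suprema here, so that a
    non-member always has a non-member way below it. The elements bounded by multiples of r alone
    lack this property.\<close>
  define I where "I = {t \<in> carrier R. \<forall>t'. t' \<lless> t \<longrightarrow> t' \<in> bounded_by r}"
  have I_down: "t \<in> I" if "t \<preceq> t2" "t2 \<in> I" "t \<in> carrier R" for t t2
    using that way_below_le[of t2 _ t] by (auto simp: I_def)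
  have bounded_I: "t \<in> I" if "t \<in> bounded_by r" for t
    using that bounded_by_down[OF that r(1)] way_below_imp_le way_belowD[of R] by (auto simp: I_def bounded_by_carrier)
  have I_add: "x \<oplus> y \<in> I \<longleftrightarrow> x \<in> I \<and> y \<in> I" if xy: "x \<in> carrier R" "y \<in> carrier R" for x y
  proof
    assume "x \<oplus> y \<in> I"
    then show "x \<in> I \<and> y \<in> I" using I_down le_add_left le_add_right xy by blast
  next
    assume I: "x \<in> I \<and> y \<in> I"
    have "t \<in> bounded_by r" if t: "t \<lless> x \<oplus> y" for t
    proof -
      obtain x' y' where x': "x' \<lless> x" "y' \<lless> y" "t \<preceq> x' \<oplus> y'" using way_below_add[OF t xy] .
      have "x' \<in> bounded_by r" "y' \<in> bounded_by r" using I x' by (auto simp: I_def)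
      then have "x' \<oplus> y' \<in> bounded_by r" using bounded_by_add_iff[OF r(1)] bounded_by_carrier by blast
      then show ?thesis using bounded_by_down[OF _ r(1) _ x'(3)] way_belowD[OF t] by blast
    qed
    then show "x \<oplus> y \<in> I" using xy by (simp add: I_def)
  qed
  have zero_I: "\<zero> \<in> I" by (rule bounded_I[OF bounded_by_zero[OF r(1)]])
  define \<psi> :: "'a \<Rightarrow> 'a \<Rightarrow> ennreal" where "\<psi> x y = (if x \<in> I \<or> y = \<zero> then 0 else Orderings.top)" for x y
  interpret E: positively_ordered_semigroup ennreal_semigroup by (rule positively_ordered_ennreal)
  have bi: "biadditive_pair R R ennreal_semigroup \<psi>"
    by unfold_locales
      (auto simp: ennreal_semigroup_def \<psi>_def I_add zero_I add_eq_zero_iff le_zero_iff intro: I_down)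
  have top: "p \<in> I \<or> q = \<zero> \<or> (\<exists>a' b'. a' \<lless> a \<and> b' \<lless> b \<and> a' \<notin> I)"
    if h: "x \<in> carrier R" "y \<in> carrier R" "a \<in> carrier R" "b \<in> carrier R" "x \<otimes> y = a \<otimes> b" "p \<lless> x" "q \<lless> y"
    for p q x y a b
  proof -
    obtain a' b' where ab: "a' \<lless> a" "b' \<lless> b" "\<psi> p q \<preceq>\<^bsub>ennreal_semigroup\<^esub> \<psi> a' b'"
      using solid_biadditive_le[OF bi h] .
    then show ?thesis by (auto simp: ennreal_semigroup_def \<psi>_def split: if_splits)
  qed
  have approx: "\<exists>t'. t' \<lless> t \<and> t' \<notin> I" if t: "t \<in> carrier R" "t \<notin> I" for t
  proof -
    obtain w where w: "w \<lless> t" "w \<notin> bounded_by r" using t by (auto simp: I_def)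
    obtain t' where t': "w \<lless> t'" "t' \<lless> t" using way_below_interpolate[OF w(1)] .
    then show ?thesis using w(2) by (auto simp: I_def)
  qed
  have below_I: "t' \<in> I" if "t' \<lless> t" "t \<in> I" for t t'
    using I_down[OF way_below_imp_le[OF that(1)] that(2)] way_belowD[OF that(1)] by blast
  have one: "\<one> \<in> I"
  proof (rule ccontr)
    assume "\<one> \<notin> I"
    then obtain p where p: "p \<lless> \<one>" "p \<notin> I" using approx by blast
    obtain q where q: "q \<lless> r" "q \<noteq> \<zero>" using nonzero_way_below[OF r] .
    obtain a' where "a' \<lless> r" "a' \<notin> I" using top[OF one_closed r(1) r(1) one_closed _ p(1) q(1)] p(2) q(2) r(1) by auto
    moreover have "r \<in> I" by (rule bounded_I[OF bounded_by_self[OF r(1)]])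
    ultimately show False using below_I by blast
  qed
  have sc: "s \<in> carrier R" using way_belowD[OF s] by blast
  have "s \<in> I"
  proof (rule ccontr)
    assume no: "s \<notin> I"
    then obtain p where p: "p \<lless> s" "p \<notin> I" using approx[OF sc] by blast
    have "\<one> \<noteq> \<zero>"
    proof
      assume "\<one> = \<zero>"
      then have "s = \<zero>" using sc by (metis r_one r_null)
      then show False using no zero_I by blast
    qed
    then obtain q where q: "q \<lless> \<one>" "q \<noteq> \<zero>" using nonzero_way_below[OF one_closed] by blast
    obtain a' where "a' \<lless> \<one>" "a' \<notin> I" using top[OF sc one_closed one_closed sc _ p(1) q(1)] p(2) q(2) sc by auto
    then show False using below_I one by blast
  qed
  then show ?thesis using s by (auto simp: I_def bounded_by_def)
qed

lemma sup_unit_mult: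
  assumes e: "\<forall>n. e n \<lless> e (Suc n)" "is_sup R (range e) \<one>" and s: "s \<in> carrier R"
  shows "increasing R (\<lambda>n. e n \<otimes> s)" "is_sup R (range (\<lambda>n. e n \<otimes> s)) s"
proof -
  have inc: "increasing R e" by (rule way_below_increasing[OF e(1)])
  then show "increasing R (\<lambda>n. e n \<otimes> s)" using s by (auto simp: increasing_def intro: mult_mono)
  show "is_sup R (range (\<lambda>n. e n \<otimes> s)) s"
    using M.bim_sup[OF inc conjunct1[OF sup_const[OF s]] e(2) conjunct2[OF sup_const[OF s]]] s by simp
qed

lemma le_if_unit_mult_le:
  assumes "s \<in> carrier R" "t \<in> carrier R" "\<And>e. e \<lless> \<one> \<Longrightarrow> e \<otimes> s \<preceq> t" shows "s \<preceq> t"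
proof -
  obtain e where e: "\<forall>n. e n \<lless> e (Suc n)" "is_sup R (range e) \<one>" using O2[OF one_closed] by blast
  show ?thesis using sup_unit_mult(2)[OF e assms(1)] assms(2,3) is_sup_below[OF e] unfolding is_sup_def by blast
qed

lemma no_zero_divisors:
  assumes r: "r \<in> carrier R" and s: "s \<in> carrier R" and rs: "r \<otimes> s = \<zero>" "r \<noteq> \<zero>" shows "s = \<zero>"
proof -
  have "e \<otimes> s \<preceq> \<zero>" if e: "e \<lless> \<one>" for e
  proof -
    obtain n :: nat where n: "e \<preceq> [n] \<cdot> r" using simple[OF r rs(2) e] by blast
    have "e \<otimes> s \<preceq> [n] \<cdot> r \<otimes> s" using n r s way_belowD[OF e] by (intro mult_mono) auto
    also have "[n] \<cdot> r \<otimes> s = \<zero>" using r s rs(1) by (simp add: add_pow_ldistr)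
    finally show ?thesis .
  qed
  then have "s \<preceq> \<zero>" using le_if_unit_mult_le s by simp
  then show ?thesis using le_zero_iff[OF s] by blast
qed


section \<open>Elements of the internal hom of a solid Cu-semiring\<close>

sublocale E: cu_bimorphism_pair hom_R R R "endpoint R R"
  by unfold_locales (rule RR.endpoint_bimorphism)

sublocale PT: cu_bimorphism_pair hom_R R "cu_tensor hom_R R" "pure_tensor hom_R R"
  by (intro cu_bimorphism_pair.intro cu_pair.intro cu_bimorphism_pair_axioms.intro cu_hom_R cu_R cu_HR
      cu_bimorphism_pure_tensor)

lemma endpoint_eq_mult:
  assumes F: "F \<in> carrier hom_R" and t: "t \<in> carrier R"
  shows "endpoint R R F t = endpoint R R F \<one> \<otimes> t"
proof (rule gen_cu_morphism_eq_mult[OF _ t])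
  have F': "increasing hom_R (\<lambda>_. F)" "is_sup hom_R (range (\<lambda>_::nat. F)) F"
    using F by (auto simp: increasing_def is_sup_def)
  show "gen_cu_morphism R R (endpoint R R F)"
    unfolding gen_cu_morphism_def
    using F E.bim_sup[OF F'(1) _ F'(2)]
    by (auto simp: E.bim_add_right E.bim_zero_right intro: E.bim_closed E.bim_mono_right)
qed

lemma path_eq_mult:
  assumes "f \<in> paths R R" "l \<in> unit_rats" "a \<in> carrier R" shows "f l a = f l \<one> \<otimes> a"
  using gen_cu_morphism_eq_mult[OF RR.pathsD(1)[OF assms(1,2)] assms(3)] .

text \<open>An element s way below F(1) is already below some member of the path at 1. Linearity
  spreads this to all arguments, and the next member supplies the way-below relation.\<close>

lemma mult_hom_endpoint_le:
  assumes F: "F \<in> carrier hom_R" shows "mult_hom (endpoint R R F \<one>) \<preceq>\<^bsub>hom_R\<^esub> F"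
proof -
  obtain f where f: "f \<in> paths R R" "F = RR.hom_class f" using RR.hom_classE[OF F] .
  have v: "endpoint R R F \<one> \<in> carrier R" using E.bim_closed[OF F one_closed] .
  have q: "1 - 1 / of_nat (n + 2) \<in> (unit_rats :: rat set)" for n by (auto simp: unit_rats_def field_simps)
  have "\<exists>m\<in>unit_rats. morph_below R R ((\<otimes>) s) (f m)" if s: "s \<lless> endpoint R R F \<one>" for s
  proof -
    obtain n where n: "s \<preceq> f (1 - 1 / of_nat (n + 2)) \<one>"
      using s RR.endpoint_sequence[OF f(1) one_closed] le_refl[OF v] unfolding way_below_def f(2) by blast
    obtain m where m: "m \<in> unit_rats" "1 - 1 / of_nat (n + 2) < m" using RR.unit_rats_above[OF q] .
    have "morph_below R R ((\<otimes>) s) (f m)"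
      unfolding morph_below_def
    proof (intro allI impI)
      fix a' a assume a: "a' \<lless> a"
      have c: "a' \<in> carrier R" "s \<in> carrier R" using way_belowD[OF a] way_belowD[OF s] by simp_all
      note fc = RR.path_value[OF f(1) q one_closed, of n]
      have "s \<otimes> a' \<preceq> f (1 - 1 / of_nat (n + 2)) a'"
        unfolding path_eq_mult[OF f(1) q c(1)] using n c fc by (intro mult_mono) auto
      moreover have "f (1 - 1 / of_nat (n + 2)) a' \<lless> f m a"
        using RR.pathsD(2)[OF f(1) q m] a unfolding morph_below_def by blast
      ultimately show "s \<otimes> a' \<lless> f m a" using le_way_below c by blast
    qed
    then show ?thesis using m(1) by blast
  qed
  then show ?thesis using mult_hom_le_iff[OF v f(1)] unfolding f(2) by blast
qed

lemma class_le_mult_hom: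
  assumes f: "f \<in> paths R R" and r: "r \<in> carrier R"
    and le: "\<And>l. l \<in> unit_rats \<Longrightarrow> \<exists>s. s \<lless> r \<and> (\<forall>a\<in>carrier R. f l a \<preceq> s \<otimes> a)"
  shows "RR.hom_class f \<preceq>\<^bsub>hom_R\<^esub> mult_hom r"
proof -
  obtain g where g: "approximates R g r" using approximates_exists[OF r] by blast
  have "path_le R R f (\<lambda>l. (\<otimes>) (g l))"
    unfolding path_le_def
  proof
    fix l assume l: "l \<in> unit_rats"
    obtain s where s: "s \<lless> r" "\<And>a. a \<in> carrier R \<Longrightarrow> f l a \<preceq> s \<otimes> a" using le[OF l] by blast
    obtain m where m: "m \<in> unit_rats" "s \<lless> g m" using approximatesD(3)[OF g s(1)] by blast
    have "morph_below R R (f l) ((\<otimes>) (g m))"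
      unfolding morph_below_def
    proof (intro allI impI)
      fix a' a assume a: "a' \<lless> a"
      have "a' \<in> carrier R" using way_belowD[OF a] by blast
      then show "f l a' \<lless> g m \<otimes> a"
        using le_way_below[OF _ s(2) M.bim_way_below[OF m(2) a]] RR.path_value[OF f l] by blast
    qed
    then show "\<exists>m\<in>unit_rats. morph_below R R (f l) ((\<otimes>) (g m))" using m(1) by blast
  qed
  then show ?thesis unfolding mult_hom_class[OF g] RR.cu_hom_leq[OF f mult_path[OF g]] .
qed

text \<open>Compactness lets 1 stand on both sides of the path condition, so
  \<open>f l \<one>\<close> is itself a multiplier way below F(1).\<close>

lemma hom_class_eq_mult_hom_if_compact:
  assumes compact: "cu_compact R \<one>" and F: "F \<in> carrier hom_R"
  shows "F = mult_hom (endpoint R R F \<one>)"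
proof -
  obtain f where f: "f \<in> paths R R" "F = RR.hom_class f" using RR.hom_classE[OF F] .
  have v: "endpoint R R F \<one> \<in> carrier R" using E.bim_closed[OF F one_closed] .
  have "F \<preceq>\<^bsub>hom_R\<^esub> mult_hom (endpoint R R F \<one>)"
    unfolding f(2)
  proof (rule class_le_mult_hom[OF f(1) v[unfolded f(2)]])
    fix l assume l: "l \<in> unit_rats"
    obtain m where m: "m \<in> unit_rats" "l < m" using RR.unit_rats_above[OF l] .
    have "f l \<one> \<lless> f m \<one>"
      using RR.pathsD(2)[OF f(1) l m] compact unfolding morph_below_def cu_compact_def by blast
    then have "f l \<one> \<lless> endpoint R R (RR.hom_class f) \<one>"
      using way_below_le[OF v[unfolded f(2)] _ RR.endpoint_upper[OF f(1) m(1) one_closed]] by blast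
    moreover have "\<forall>a\<in>carrier R. f l a \<preceq> f l \<one> \<otimes> a"
      using path_eq_mult[OF f(1) l] RR.path_value[OF f(1) l] by (metis le_refl)
    ultimately show "\<exists>s. s \<lless> endpoint R R (RR.hom_class f) \<one> \<and> (\<forall>a\<in>carrier R. f l a \<preceq> s \<otimes> a)" by blast
  qed
  then show ?thesis using mult_hom_endpoint_le[OF F] H.le_antisym[OF F mult_hom_closed[OF v]] by blast
qed

lemma mult_hom_add_pow: "r \<in> carrier R \<Longrightarrow> mult_hom ([(n::nat)] \<cdot> r) = [n] \<cdot>\<^bsub>hom_R\<^esub> mult_hom r"
  using cu_morphismD(2,3)[OF mult_hom_morphism] by (induction n) auto

lemma hom_class_add_pow:
  assumes f: "f \<in> paths R R"
  shows "\<exists>g\<in>paths R R. [(n::nat)] \<cdot>\<^bsub>hom_R\<^esub> RR.hom_class f = RR.hom_class g \<and>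
    (\<forall>l\<in>unit_rats. \<forall>a\<in>carrier R. g l a = [n] \<cdot> f l a)"
proof (induction n)
  case 0
  show ?case by (rule bexI[OF _ RR.paths_zero]) (simp add: RR.hom_zero)
next
  case (Suc n)
  then obtain g where g: "g \<in> paths R R" "[n] \<cdot>\<^bsub>hom_R\<^esub> RR.hom_class f = RR.hom_class g"
    "\<forall>l\<in>unit_rats. \<forall>a\<in>carrier R. g l a = [n] \<cdot> f l a" by blast
  show ?case
    by (rule bexI[OF _ RR.paths_add[OF g(1) f]]) (simp add: g RR.cu_hom_add[OF g(1) f])
qed

text \<open>In place of f(1), which need not be way below F(1) for a member f of the path, the
  element f(e) = f(1) e is used. The price is the factor k: n f(a) = f(1) (n 1) a <= k f(e)
  a.\<close>

lemma add_pow_le_mult_hom: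
  assumes F: "F \<in> carrier hom_R" and e: "e \<lless> \<one>" "[(n::nat)] \<cdot> \<one> \<preceq> [(k::nat)] \<cdot> e"
  shows "[n] \<cdot>\<^bsub>hom_R\<^esub> F \<preceq>\<^bsub>hom_R\<^esub> [k] \<cdot>\<^bsub>hom_R\<^esub> mult_hom (endpoint R R F \<one>)"
proof -
  obtain f where f: "f \<in> paths R R" "F = RR.hom_class f" using RR.hom_classE[OF F] .
  define v where "v = endpoint R R F \<one>"
  have v: "v \<in> carrier R" using E.bim_closed[OF F one_closed] by (simp add: v_def)
  have ec: "e \<in> carrier R" using way_belowD[OF e(1)] by blast
  obtain g where g: "g \<in> paths R R" "[n] \<cdot>\<^bsub>hom_R\<^esub> F = RR.hom_class g"
    "\<And>l a. l \<in> unit_rats \<Longrightarrow> a \<in> carrier R \<Longrightarrow> g l a = [n] \<cdot> f l a" using hom_class_add_pow[OF f(1)] f(2) by blast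
  show ?thesis
    unfolding g(2) v_def[symmetric] mult_hom_add_pow[OF v, symmetric]
  proof (rule class_le_mult_hom[OF g(1)])
    show "[k] \<cdot> v \<in> carrier R" using v by simp
    fix l assume l: "l \<in> unit_rats"
    obtain m where m: "m \<in> unit_rats" "l < m" using RR.unit_rats_above[OF l] .
    note fl = RR.path_value[OF f(1) l one_closed]
    have "f l e \<lless> f m \<one>" using RR.pathsD(2)[OF f(1) l m] e(1) unfolding morph_below_def by blast
    then have "f l e \<lless> v"
      using way_below_le[OF v _ RR.endpoint_upper[OF f(1) m(1) one_closed, folded f(2) v_def]] by blast
    then have s: "[k] \<cdot> (f l \<one> \<otimes> e) \<lless> [k] \<cdot> v"
      using path_eq_mult[OF f(1) l ec] by (intro add_pow_way_below) simp
    moreover have "g l a \<preceq> [k] \<cdot> (f l \<one> \<otimes> e) \<otimes> a" if a: "a \<in> carrier R" for a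
    proof -
      have "g l a = f l \<one> \<otimes> [n] \<cdot> \<one> \<otimes> a"
        unfolding g(3)[OF l a] path_eq_mult[OF f(1) l a] using fl a by (simp add: add_pow_ldistr add_pow_rdistr)
      also have "\<dots> \<preceq> f l \<one> \<otimes> [k] \<cdot> e \<otimes> a" using e(2) ec fl a by (intro mult_mono) auto
      also have "\<dots> = [k] \<cdot> (f l \<one> \<otimes> e) \<otimes> a" using fl ec by (simp add: add_pow_rdistr)
      finally show ?thesis .
    qed
    ultimately show "\<exists>s. s \<lless> [k] \<cdot> v \<and> (\<forall>a\<in>carrier R. g l a \<preceq> s \<otimes> a)" by blast
  qed
qed

lemma pure_tensor_eq_if_divisible:
  assumes div: "\<And>e. e \<lless> \<one> \<Longrightarrow> \<exists>(n::nat) (k::nat) s e'. s \<in> carrier R \<and> e \<preceq> [n] \<cdot> s \<and> [k] \<cdot> s \<preceq> \<one> \<and>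
      e' \<lless> \<one> \<and> [n] \<cdot> \<one> \<preceq> [k] \<cdot> e'"
    and F: "F \<in> carrier hom_R" and t: "t \<in> carrier R"
  shows "pure_tensor hom_R R F t = pure_tensor hom_R R (mult_hom (endpoint R R F \<one>)) t"
proof -
  define G where "G = mult_hom (endpoint R R F \<one>)"
  have G: "G \<in> carrier hom_R" "G \<preceq>\<^bsub>hom_R\<^esub> F"
    using mult_hom_closed[OF E.bim_closed[OF F one_closed]] mult_hom_endpoint_le[OF F] by (simp_all add: G_def)
  obtain e where e: "\<forall>n. e n \<lless> e (Suc n)" "is_sup R (range e) \<one>" using O2[OF one_closed] by blast
  have F': "increasing hom_R (\<lambda>_. F)" "is_sup hom_R (range (\<lambda>_::nat. F)) F"
    using F by (auto simp: increasing_def is_sup_def)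
  have "pure_tensor hom_R R F (e i \<otimes> t) \<preceq>\<^bsub>cu_tensor hom_R R\<^esub> pure_tensor hom_R R G t" for i
  proof -
    have ei: "e i \<in> carrier R" using way_belowD[OF is_sup_below[OF e]] by blast
    obtain n k :: nat and s e' where s: "s \<in> carrier R" "e i \<preceq> [n] \<cdot> s" "[k] \<cdot> s \<preceq> \<one>"
      "e' \<lless> \<one>" "[n] \<cdot> \<one> \<preceq> [k] \<cdot> e'" using div[OF is_sup_below[OF e]] by blast
    have st: "s \<otimes> t \<in> carrier R" using s(1) t by simp
    have "e i \<otimes> t \<preceq> [n] \<cdot> s \<otimes> t" using s ei t by (intro mult_mono) auto
    then have "e i \<otimes> t \<preceq> [n] \<cdot> (s \<otimes> t)" using s t by (simp add: add_pow_ldistr)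
    then have 1: "pure_tensor hom_R R F (e i \<otimes> t) \<preceq>\<^bsub>cu_tensor hom_R R\<^esub> pure_tensor hom_R R ([n] \<cdot>\<^bsub>hom_R\<^esub> F) (s \<otimes> t)"
      using PT.bim_mono_right[OF F, of "e i \<otimes> t" "[n] \<cdot> (s \<otimes> t)"] F ei t st
      by (simp only: PT.bim_add_pow_left PT.bim_add_pow_right m_closed add.nat_pow_closed)
    have 2: "pure_tensor hom_R R ([n] \<cdot>\<^bsub>hom_R\<^esub> F) (s \<otimes> t) \<preceq>\<^bsub>cu_tensor hom_R R\<^esub>
        pure_tensor hom_R R ([k] \<cdot>\<^bsub>hom_R\<^esub> G) (s \<otimes> t)"
      using PT.bim_mono_left[OF _ _ st add_pow_le_mult_hom[OF F s(4,5)]] F G by (simp only: G_def H.add.nat_pow_closed)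
    have "[k] \<cdot> s \<otimes> t \<preceq> \<one> \<otimes> t" using s t by (intro mult_mono) auto
    then have "[k] \<cdot> (s \<otimes> t) \<preceq> t" using s t by (simp add: add_pow_ldistr)
    then have 3: "pure_tensor hom_R R ([k] \<cdot>\<^bsub>hom_R\<^esub> G) (s \<otimes> t) \<preceq>\<^bsub>cu_tensor hom_R R\<^esub> pure_tensor hom_R R G t"
      using PT.bim_mono_right[OF G(1), of "[k] \<cdot> (s \<otimes> t)" t] G t st
      by (simp only: PT.bim_add_pow_left PT.bim_add_pow_right add.nat_pow_closed)
    have cl: "pure_tensor hom_R R F (e i \<otimes> t) \<in> carrier (cu_tensor hom_R R)"
      "pure_tensor hom_R R ([n] \<cdot>\<^bsub>hom_R\<^esub> F) (s \<otimes> t) \<in> carrier (cu_tensor hom_R R)"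
      "pure_tensor hom_R R ([k] \<cdot>\<^bsub>hom_R\<^esub> G) (s \<otimes> t) \<in> carrier (cu_tensor hom_R R)"
      "pure_tensor hom_R R G t \<in> carrier (cu_tensor hom_R R)"
      using F G(1) st t ei by (auto intro!: PT.bim_closed simp del: tensor_simps)
    show ?thesis using PT.P.le_trans[OF cl(1,2,4) 1 PT.P.le_trans[OF cl(2,3,4) 2 3]] .
  qed
  moreover have "is_sup (cu_tensor hom_R R) (range (\<lambda>i. pure_tensor hom_R R F (e i \<otimes> t))) (pure_tensor hom_R R F t)"
    by (rule PT.bim_sup[OF F'(1) sup_unit_mult(1)[OF e t] F'(2) sup_unit_mult(2)[OF e t]])
  ultimately have "pure_tensor hom_R R F t \<preceq>\<^bsub>cu_tensor hom_R R\<^esub> pure_tensor hom_R R G t"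
    using PT.bim_closed[OF G(1) t] unfolding is_sup_def by blast
  moreover have "pure_tensor hom_R R G t \<preceq>\<^bsub>cu_tensor hom_R R\<^esub> pure_tensor hom_R R F t"
    using PT.bim_mono_left[OF G(1) F t G(2)] .
  ultimately show ?thesis
    using PT.P.le_antisym PT.bim_closed[OF G(1) t] PT.bim_closed[OF F t] unfolding G_def by blast
qed

end


section \<open>Solid Cu-semirings with non-compact unit\<close>

locale noncompact_solid_cu_semiring = solid_cu_semiring +
  assumes O5: "cu_O5 R" and noncompact: "\<not> cu_compact R \<one>"
begin

section \<open>Room below the unit and geometric sums\<close>

lemma almost_complement:
  assumes "a' \<lless> a" "a \<preceq> \<one>"
  obtains x where "x \<in> carrier R" "a' \<oplus> x \<preceq> \<one>" "\<one> \<preceq> a \<oplus> x"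
proof -
  have c: "a' \<in> carrier R" "a \<in> carrier R" using way_belowD[OF assms(1)] by simp_all
  have "a \<oplus> \<zero> \<preceq> \<one> \<and> a' \<lless> a \<and> \<zero> \<lless> \<zero>" using c assms by simp
  then have "\<exists>x\<in>carrier R. a' \<oplus> x \<preceq> \<one> \<and> \<one> \<preceq> a \<oplus> x \<and> \<zero> \<preceq> x"
    using O5[unfolded cu_O5_def, rule_format, of a' a "\<zero>" "\<zero>" "\<one>"] c by simp
  then show ?thesis using that by blast
qed

text \<open>The complement of e inside some e' with \<open>e \<lless> e'\<close> and
  \<open>e' \<lless> \<one>\<close> cannot vanish, for then 1 would lie below e' and be
  compact.\<close>

lemma gap:
  assumes "e \<lless> \<one>" obtains c where "c \<in> carrier R" "c \<noteq> \<zero>" "e \<oplus> c \<preceq> \<one>"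
proof -
  obtain e' where e': "e \<lless> e'" "e' \<lless> \<one>" using way_below_interpolate[OF assms] .
  obtain x where x: "x \<in> carrier R" "e \<oplus> x \<preceq> \<one>" "\<one> \<preceq> e' \<oplus> x"
    using almost_complement[OF e'(1) way_below_imp_le[OF e'(2)]] .
  have "x \<noteq> \<zero>"
  proof
    assume "x = \<zero>"
    then have "\<one> \<preceq> e'" using x(3) way_belowD[OF e'(2)] by simp
    then have "\<one> \<lless> \<one>" using le_way_below[OF one_closed _ e'(2)] by blast
    then show False using noncompact by (simp add: cu_compact_def)
  qed
  then show ?thesis using that x by blast
qed

lemma one_nonzero: "\<one> \<noteq> \<zero>"
  using noncompact zero_way_below[of "\<zero>"] unfolding cu_compact_def by auto

lemma pow_nonzero: "\<lbrakk>b \<in> carrier R; b \<noteq> \<zero>\<rbrakk> \<Longrightarrow> b [^] (k::nat) \<noteq> \<zero>"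
proof (induction k)
  case (Suc k)
  then show ?case using no_zero_divisors[of "b [^] k" b] by auto
qed (simp add: one_nonzero)

lemma mult_le_left: "\<lbrakk>a \<in> carrier R; b \<in> carrier R; b \<preceq> \<one>\<rbrakk> \<Longrightarrow> a \<otimes> b \<preceq> a"
  using mult_mono[of a a b "\<one>"] by simp

lemma pow_le_one: "\<lbrakk>b \<in> carrier R; b \<preceq> \<one>\<rbrakk> \<Longrightarrow> b [^] (k::nat) \<preceq> \<one>"
proof (induction k)
  case (Suc k)
  then show ?case using mult_mono[of "b [^] k" "\<one>" b "\<one>"] by simp
qed simp

lemma pow_mono: "\<lbrakk>a \<in> carrier R; b \<in> carrier R; a \<preceq> b\<rbrakk> \<Longrightarrow> a [^] (k::nat) \<preceq> b [^] k"
  by (induction k) (auto intro: mult_mono)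

text \<open>Horner form of c (1 + b + ... + b^(k-1)).\<close>

primrec geometric :: "'a \<Rightarrow> 'a \<Rightarrow> nat \<Rightarrow> 'a" where
  "geometric b c 0 = \<zero>"
| "geometric b c (Suc k) = c \<oplus> b \<otimes> geometric b c k"

lemma geometric_closed [simp]: "\<lbrakk>b \<in> carrier R; c \<in> carrier R\<rbrakk> \<Longrightarrow> geometric b c k \<in> carrier R"
  by (induction k) auto

text \<open>The total n c (1 + ... + b^(k-1)) + b^k reproduces itself: its last summand 1 has been
  replaced by n c + b times the previous total. Hence both \<open>n c + b <= 1\<close> and the
  reverse inequality pass to every k by induction.\<close>

lemma geometric_step:
  assumes "b \<in> carrier R" "c \<in> carrier R"
  shows "[(n::nat)] \<cdot> geometric b c (Suc k) \<oplus> b [^] Suc k =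
    [n] \<cdot> c \<oplus> b \<otimes> ([n] \<cdot> geometric b c k \<oplus> b [^] k)"
  using assms by (simp add: add.nat_pow_distrib r_distr add_pow_rdistr a_ac m_comm)

lemma geometric_le:
  assumes b: "b \<in> carrier R" "c \<in> carrier R" and le: "[(n::nat)] \<cdot> c \<oplus> b \<preceq> \<one>"
  shows "[n] \<cdot> geometric b c k \<oplus> b [^] k \<preceq> \<one>"
proof (induction k)
  case (Suc k)
  have "b \<otimes> ([n] \<cdot> geometric b c k \<oplus> b [^] k) \<preceq> b" using b Suc by (intro mult_le_left) auto
  then have "[n] \<cdot> c \<oplus> b \<otimes> ([n] \<cdot> geometric b c k \<oplus> b [^] k) \<preceq> [n] \<cdot> c \<oplus> b"
    using b by (intro add_mono) auto
  then show ?case unfolding geometric_step[OF b] using le_trans[OF _ _ one_closed _ le] b by simp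
qed simp

lemma le_geometric:
  assumes b: "b \<in> carrier R" "c \<in> carrier R" and le: "\<one> \<preceq> [(n::nat)] \<cdot> c \<oplus> b"
  shows "\<one> \<preceq> [n] \<cdot> geometric b c k \<oplus> b [^] k"
proof (induction k)
  case (Suc k)
  have "b \<otimes> \<one> \<preceq> b \<otimes> ([n] \<cdot> geometric b c k \<oplus> b [^] k)" using b Suc by (intro mult_mono) auto
  then have "[n] \<cdot> c \<oplus> b \<preceq> [n] \<cdot> c \<oplus> b \<otimes> ([n] \<cdot> geometric b c k \<oplus> b [^] k)"
    using b by (intro add_mono) auto
  then show ?case unfolding geometric_step[OF b] using le_trans[OF one_closed _ _ le] b by simp
qed simp

text \<open>As b <= 1, each of the k summands c b^j is at least c b^k.\<close>

lemma pow_le_geometric: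
  assumes b: "b \<in> carrier R" "c \<in> carrier R" and le: "b \<preceq> \<one>"
  shows "[k] \<cdot> (c \<otimes> b [^] k) \<preceq> geometric b c k"
proof (induction k)
  case (Suc k)
  have "[k] \<cdot> (c \<otimes> b [^] Suc k) = b \<otimes> [k] \<cdot> (c \<otimes> b [^] k)"
    using b by (simp add: add_pow_rdistr m_ac)
  moreover have "b \<otimes> [k] \<cdot> (c \<otimes> b [^] k) \<preceq> b \<otimes> geometric b c k" using b Suc by (intro mult_mono) auto
  moreover have "c \<otimes> b [^] Suc k \<preceq> c" using mult_le_left[OF b(2) _ pow_le_one[OF b(1) le, of "Suc k"]] b by simp
  ultimately have "[k] \<cdot> (c \<otimes> b [^] Suc k) \<oplus> c \<otimes> b [^] Suc k \<preceq> b \<otimes> geometric b c k \<oplus> c"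
    using b by (intro add_mono) auto
  then show ?case using b by (simp add: a_comm)
qed simp

text \<open>Powers of \<open>b\<close> are absolutely small as soon as there is some room between \<open>b\<close> and \<open>1\<close>:
  \<open>k\<close> copies of \<open>c b\<^sup>k\<close> fit below \<open>c + c b + \<dots> + c b\<^sup>k\<^sup>-\<^sup>1 \<le> 1\<close>.\<close>

lemma pow_small:
  assumes b: "b \<in> carrier R" and c: "c \<in> carrier R" "c \<noteq> \<zero>" "b \<oplus> c \<preceq> \<one>"
    and a: "a \<in> carrier R" "a \<noteq> \<zero>" and e: "e \<lless> \<one>"
  obtains k where "[(m::nat)] \<cdot> (b [^] (k::nat) \<otimes> e) \<preceq> a"
proof -
  have ec: "e \<in> carrier R" using way_belowD[OF e] by blast
  have b1: "b \<preceq> \<one>" using le_trans[OF b _ one_closed le_add_left[OF b c(1)] c(3)] b c by simp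
  have "c \<otimes> a \<noteq> \<zero>" using no_zero_divisors[OF c(1) a(1)] c(2) a(2) by blast
  then obtain C :: nat where C: "e \<preceq> [C] \<cdot> (c \<otimes> a)" using simple[OF _ _ e, of "c \<otimes> a"] c a by auto
  \<comment> \<open>C copies of c a cover e, so m copies of b^k e are covered by m C = k copies of a
    c b^k; these lie below a because k copies of c b^k lie below 1.\<close>
  define k where "k = C * m"
  have "[(1::nat)] \<cdot> c \<oplus> b \<preceq> \<one>" using b c by (simp add: a_comm)
  from geometric_le[OF b c(1) this, of k] have "geometric b c k \<oplus> b [^] k \<preceq> \<one>" using b c by simp
  then have "geometric b c k \<preceq> \<one>"
    using le_trans[OF _ _ one_closed le_add_left[of "geometric b c k" "b [^] k"]] b c by simp
  then have k: "[k] \<cdot> (c \<otimes> b [^] k) \<preceq> \<one>"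
    using le_trans[OF _ _ one_closed pow_le_geometric[OF b c(1) b1, of k]] b c by simp
  have "[m] \<cdot> (b [^] k \<otimes> e) \<preceq> [m] \<cdot> (b [^] k \<otimes> [C] \<cdot> (c \<otimes> a))"
    using C b c a ec by (intro add_pow_mono mult_mono) auto
  also have "[m] \<cdot> (b [^] k \<otimes> [C] \<cdot> (c \<otimes> a)) = a \<otimes> [k] \<cdot> (c \<otimes> b [^] k)"
    using b c a by (simp add: k_def add_pow_rdistr add.nat_pow_pow m_ac)
  finally have 1: "[m] \<cdot> (b [^] k \<otimes> e) \<preceq> a \<otimes> [k] \<cdot> (c \<otimes> b [^] k)" .
  have 2: "a \<otimes> [k] \<cdot> (c \<otimes> b [^] k) \<preceq> a" using k a b c by (intro mult_le_left) auto
  have "[m] \<cdot> (b [^] k \<otimes> e) \<preceq> a" using le_trans[OF _ _ a(1) 1 2] a b c ec by simp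
  then show ?thesis using that by blast
qed

section \<open>Small way-below pairs and almost divisibility of the unit\<close>

text \<open>The two products telescope: along a chain \<open>b\<^sub>0 \<lless> \<beta>\<^sub>1 \<lless> \<dots> \<lless> \<beta>\<^sub>L = b\<^sub>1\<close> take
  \<open>s\<^sub>0 = b\<^sub>0 \<beta>\<^sub>1 \<cdots> \<beta>\<^sub>L\<^sub>-\<^sub>1\<close> and \<open>s\<^sub>1 = \<beta>\<^sub>1 \<cdots> \<beta>\<^sub>L\<close>.\<close>

lemma chain_product:
  assumes "b0 \<lless> b1" "b0 \<noteq> \<zero>"
  shows "\<exists>s0 s1. s0 \<lless> s1 \<and> s0 \<noteq> \<zero> \<and> s1 \<preceq> b1 [^] Suc L \<and> b0 \<otimes> s1 \<preceq> s0 \<otimes> b1"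
  using assms(1)
proof (induction L arbitrary: b1)
  case 0
  have "b0 \<in> carrier R" "b1 \<in> carrier R" using way_belowD[OF 0] by simp_all
  then show ?case using 0 assms(2) by (intro exI[of _ b0] exI[of _ b1]) simp
next
  case (Suc L)
  obtain \<beta> where \<beta>: "b0 \<lless> \<beta>" "\<beta> \<lless> b1" using way_below_interpolate[OF Suc.prems] .
  obtain s0 s1 where s: "s0 \<lless> s1" "s0 \<noteq> \<zero>" "s1 \<preceq> \<beta> [^] Suc L" "b0 \<otimes> s1 \<preceq> s0 \<otimes> \<beta>" using Suc.IH[OF \<beta>(1)] by blast
  have c: "b0 \<in> carrier R" "\<beta> \<in> carrier R" "b1 \<in> carrier R" "s0 \<in> carrier R" "s1 \<in> carrier R"
    using way_belowD[OF \<beta>(1)] way_belowD[OF \<beta>(2)] way_belowD[OF s(1)] by simp_all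
  have "\<beta> \<noteq> \<zero>" using way_below_imp_le[OF \<beta>(1)] assms(2) le_zero_iff[OF c(1)] by auto
  then have "s0 \<otimes> \<beta> \<noteq> \<zero>" using no_zero_divisors[OF c(4,2)] s(2) by blast
  moreover have "s0 \<otimes> \<beta> \<lless> s1 \<otimes> b1" by (rule M.bim_way_below[OF s(1) \<beta>(2)])
  moreover have "s1 \<otimes> b1 \<preceq> b1 [^] Suc (Suc L)"
  proof -
    have "s1 \<preceq> b1 [^] Suc L"
      using le_trans[OF c(5) _ _ s(3) pow_mono[OF c(2,3) way_below_imp_le[OF \<beta>(2)]]] c by simp
    then show ?thesis using mult_mono[of s1 "b1 [^] Suc L" b1 b1] c by simp
  qed
  moreover have "b0 \<otimes> (s1 \<otimes> b1) \<preceq> s0 \<otimes> \<beta> \<otimes> b1"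
    using mult_mono[of "b0 \<otimes> s1" "s0 \<otimes> \<beta>" b1 b1] s(4) c by (simp add: m_assoc)
  ultimately show ?case by blast
qed

text \<open>Take b1^l <= b0 and e <= C b1^l. Then e s1 <= C b0 s1 <= C s0 b1 <= C s0, where C
  depends on e, b0 and b1 only. The number N influences just the length of the product s1, which
  makes s1 small.\<close>

lemma small_pair:
  assumes e: "e \<lless> \<one>"
  obtains C :: nat where
    "\<And>N::nat. \<exists>s0 s1. s0 \<lless> s1 \<and> s0 \<noteq> \<zero> \<and> [N] \<cdot> s1 \<preceq> \<one> \<and> e \<otimes> s1 \<preceq> [C] \<cdot> s0"
proof -
  have ec: "e \<in> carrier R" using way_belowD[OF e] by blast
  obtain b1 where b1: "b1 \<lless> \<one>" "b1 \<noteq> \<zero>" using nonzero_way_below[OF one_closed one_nonzero] .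
  have b1c: "b1 \<in> carrier R" using way_belowD[OF b1(1)] by blast
  obtain b0 where b0: "b0 \<lless> b1" "b0 \<noteq> \<zero>" using nonzero_way_below[OF b1c b1(2)] .
  have b0c: "b0 \<in> carrier R" using way_belowD[OF b0(1)] by blast
  obtain c where c: "c \<in> carrier R" "c \<noteq> \<zero>" "b1 \<oplus> c \<preceq> \<one>" using gap[OF b1(1)] .
  obtain k where k: "[(1::nat)] \<cdot> (b1 [^] (k::nat) \<otimes> b1) \<preceq> b0" using pow_small[OF b1c c b0c b0(2) b1(1)] .
  define l where "l = Suc k"
  have l: "b1 [^] l \<preceq> b0" using k b1c by (simp add: l_def)
  obtain C :: nat where C: "e \<preceq> [C] \<cdot> (b1 [^] l)" using simple[OF _ pow_nonzero[OF b1c b1(2)] e] b1c by auto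
  have "\<exists>s0 s1. s0 \<lless> s1 \<and> s0 \<noteq> \<zero> \<and> [N] \<cdot> s1 \<preceq> \<one> \<and> e \<otimes> s1 \<preceq> [C] \<cdot> s0" for N :: nat
  proof -
    obtain L where L: "[N] \<cdot> (b1 [^] (L::nat) \<otimes> b1) \<preceq> \<one>" using pow_small[OF b1c c one_closed one_nonzero b1(1)] .
    obtain s0 s1 where s: "s0 \<lless> s1" "s0 \<noteq> \<zero>" "s1 \<preceq> b1 [^] Suc L" "b0 \<otimes> s1 \<preceq> s0 \<otimes> b1"
      using chain_product[OF b0, of L] by blast
    have sc: "s0 \<in> carrier R" "s1 \<in> carrier R" using way_belowD[OF s(1)] by simp_all
    have "[N] \<cdot> s1 \<preceq> [N] \<cdot> (b1 [^] L \<otimes> b1)" using s(3) sc b1c by (intro add_pow_mono) auto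
    then have 1: "[N] \<cdot> s1 \<preceq> \<one>" using le_trans[OF _ _ one_closed _ L] sc b1c by simp
    have "b1 [^] l \<otimes> s1 \<preceq> b0 \<otimes> s1" using l sc b0c b1c by (intro mult_mono) auto
    moreover have "s0 \<otimes> b1 \<preceq> s0" using mult_le_left[OF sc(1) b1c way_below_imp_le[OF b1(1)]] .
    ultimately have "b1 [^] l \<otimes> s1 \<preceq> s0"
      using le_trans[of "b1 [^] l \<otimes> s1" "b0 \<otimes> s1" "s0 \<otimes> b1"] le_trans[of "b1 [^] l \<otimes> s1" "s0 \<otimes> b1" s0] s(4) sc b0c b1c
      by simp
    then have 2: "[C] \<cdot> (b1 [^] l \<otimes> s1) \<preceq> [C] \<cdot> s0" using sc b1c by (intro add_pow_mono) auto
    have "e \<otimes> s1 \<preceq> [C] \<cdot> (b1 [^] l) \<otimes> s1" using C ec sc b1c by (intro mult_mono) auto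
    then have "e \<otimes> s1 \<preceq> [C] \<cdot> (b1 [^] l \<otimes> s1)" using sc b1c by (simp add: add_pow_ldistr)
    then have "e \<otimes> s1 \<preceq> [C] \<cdot> s0" using le_trans[OF _ _ _ _ 2] ec sc b1c by simp
    then show ?thesis using s 1 by blast
  qed
  then show ?thesis using that by blast
qed

text \<open>Along a way-below chain from s0 to s1, z adds up all terms but the last and z' all terms
  but the first. The two sums then differ only in the end terms s0 and s1.\<close>

lemma chain_sum:
  assumes "s0 \<lless> s1"
  shows "\<exists>z z'. z \<lless> z' \<and> z' \<preceq> [Suc L] \<cdot> s1 \<and> z' \<oplus> s0 \<preceq> z \<oplus> s1 \<and> [Suc L] \<cdot> s0 \<preceq> z"
  using assms
proof (induction L arbitrary: s1)
  case 0
  have "s0 \<in> carrier R" "s1 \<in> carrier R" using way_belowD[OF 0] by simp_all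
  then show ?case using 0 by (intro exI[of _ s0] exI[of _ s1]) (simp add: a_comm)
next
  case (Suc L)
  obtain \<sigma> where \<sigma>: "s0 \<lless> \<sigma>" "\<sigma> \<lless> s1" using way_below_interpolate[OF Suc.prems] .
  obtain z z' where z: "z \<lless> z'" "z' \<preceq> [Suc L] \<cdot> \<sigma>" "z' \<oplus> s0 \<preceq> z \<oplus> \<sigma>" "[Suc L] \<cdot> s0 \<preceq> z"
    using Suc.IH[OF \<sigma>(1)] by blast
  have c: "s0 \<in> carrier R" "\<sigma> \<in> carrier R" "s1 \<in> carrier R" "z \<in> carrier R" "z' \<in> carrier R"
    using way_belowD[OF \<sigma>(1)] way_belowD[OF \<sigma>(2)] way_belowD[OF z(1)] by simp_all
  have "z' \<preceq> [Suc L] \<cdot> s1"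
    using le_trans[OF _ _ _ z(2) add_pow_mono[OF c(2,3) way_below_imp_le[OF \<sigma>(2)]]] c by simp
  then have "z' \<oplus> s1 \<preceq> [Suc (Suc L)] \<cdot> s1" using add_mono[of z' "[Suc L] \<cdot> s1" s1 s1] c by simp
  moreover have "(z' \<oplus> s1) \<oplus> s0 \<preceq> (z \<oplus> \<sigma>) \<oplus> s1"
    using add_mono[of "z' \<oplus> s0" "z \<oplus> \<sigma>" s1 s1] z(3) c by (simp add: a_ac)
  moreover have "[Suc (Suc L)] \<cdot> s0 \<preceq> z \<oplus> \<sigma>"
    using add_mono[of "[Suc L] \<cdot> s0" z s0 \<sigma>] z(4) way_below_imp_le[OF \<sigma>(1)] c by simp
  moreover have "z \<oplus> \<sigma> \<lless> z' \<oplus> s1" by (rule O3[OF z(1) \<sigma>(2)])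
  ultimately show ?case by blast
qed

text \<open>A way-below pair whose ratio is close to \<open>1\<close>, as small as one likes. The constant \<open>C\<close> does not depend
  on the size of the pair \<open>s\<^sub>0 \<lless> s\<^sub>1\<close>, so a sufficiently long sum along a chain between \<open>s\<^sub>0\<close> and \<open>s\<^sub>1\<close> works.\<close>

lemma small_pair_ratio:
  assumes e: "e \<lless> \<one>"
  obtains z z' where "z \<lless> z'" "z \<noteq> \<zero>" "[(n::nat)] \<cdot> z' \<preceq> \<one>" "e \<otimes> [n] \<cdot> z' \<preceq> [Suc n] \<cdot> z"
proof -
  obtain C :: nat where C: "\<And>N::nat. \<exists>s0 s1. s0 \<lless> s1 \<and> s0 \<noteq> \<zero> \<and> [N] \<cdot> s1 \<preceq> \<one> \<and> e \<otimes> s1 \<preceq> [C] \<cdot> s0"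
    using small_pair[OF e] by blast
  \<comment> \<open>Multiplying e z' <= z + C s0 by n leaves a surplus of n C = L copies of s0,
    which fit into one further copy of z.\<close>
  define L where "L = n * C"
  obtain s0 s1 where s: "s0 \<lless> s1" "s0 \<noteq> \<zero>" "[(Suc L * n)] \<cdot> s1 \<preceq> \<one>" "e \<otimes> s1 \<preceq> [C] \<cdot> s0" using C by blast
  obtain z z' where z: "z \<lless> z'" "z' \<preceq> [Suc L] \<cdot> s1" "z' \<oplus> s0 \<preceq> z \<oplus> s1" "[Suc L] \<cdot> s0 \<preceq> z"
    using chain_sum[OF s(1)] by blast
  have c: "e \<in> carrier R" "s0 \<in> carrier R" "s1 \<in> carrier R" "z \<in> carrier R" "z' \<in> carrier R"
    using way_belowD[OF e] way_belowD[OF s(1)] way_belowD[OF z(1)] by simp_all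
  have "s0 \<preceq> [Suc L] \<cdot> s0" using add_pow_mono_left[OF c(2), of 1 "Suc L"] c by simp
  then have "z \<noteq> \<zero>" using le_trans[OF c(2) _ c(4) _ z(4)] le_zero_iff[OF c(2)] s(2) c by auto
  moreover have "[n] \<cdot> z' \<preceq> [n] \<cdot> ([Suc L] \<cdot> s1)" using c z(2) by (intro add_pow_mono) auto
  then have "[n] \<cdot> z' \<preceq> \<one>"
    using le_trans[OF _ _ one_closed _ s(3)] c by (simp add: add.nat_pow_pow del: add.nat_pow_Suc)
  moreover have "e \<otimes> [n] \<cdot> z' \<preceq> [Suc n] \<cdot> z"
  proof -
    have e1: "e \<preceq> \<one>" by (rule way_below_imp_le[OF e])
    have "z' \<preceq> z \<oplus> s1" using le_trans[OF _ _ _ le_add_left z(3)] c by simp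
    then have "e \<otimes> z' \<preceq> e \<otimes> (z \<oplus> s1)" using c by (intro mult_mono) auto
    moreover have "e \<otimes> z \<oplus> e \<otimes> s1 \<preceq> z \<oplus> [C] \<cdot> s0"
      using mult_le_left[OF c(4,1) e1] s(4) c by (intro add_mono) (auto simp: m_comm)
    ultimately have "e \<otimes> z' \<preceq> z \<oplus> [C] \<cdot> s0"
      using le_trans[of "e \<otimes> z'" "e \<otimes> z \<oplus> e \<otimes> s1" "z \<oplus> [C] \<cdot> s0"] c by (simp add: r_distr)
    then have "[n] \<cdot> (e \<otimes> z') \<preceq> [n] \<cdot> (z \<oplus> [C] \<cdot> s0)" using c by (intro add_pow_mono) auto
    then have 1: "e \<otimes> [n] \<cdot> z' \<preceq> [n] \<cdot> z \<oplus> [L] \<cdot> s0"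
      using c by (simp add: add_pow_rdistr add.nat_pow_distrib add.nat_pow_pow L_def mult.commute)
    have "[L] \<cdot> s0 \<preceq> z"
      using le_trans[OF _ _ c(4) add_pow_mono_left[OF c(2), of L "Suc L"] z(4)] c by simp
    then have "[n] \<cdot> z \<oplus> [L] \<cdot> s0 \<preceq> [n] \<cdot> z \<oplus> z" using c by (intro add_mono) auto
    then show ?thesis using le_trans[OF _ _ _ 1] c by simp
  qed
  ultimately show ?thesis using that z(1) by blast
qed

text \<open>(O5) complements way-below pairs only, so the upper estimate n z + x <= 1 and the lower
  one 1 <= n z' + x involve different elements. The ratio of z' to z costs one additional copy of y;
  the remainder costs another, since e <= k z gives e x^k <= k z x^k <= y.\<close>

theorem almost_divisible_unit:
  assumes e: "e \<lless> \<one>"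
  obtains y where "y \<in> carrier R" "[(n::nat)] \<cdot> y \<preceq> \<one>" "e \<preceq> [(n + 2)] \<cdot> y"
proof -
  obtain z z' where z: "z \<lless> z'" "z \<noteq> \<zero>" "[n] \<cdot> z' \<preceq> \<one>" "e \<otimes> [n] \<cdot> z' \<preceq> [Suc n] \<cdot> z"
    using small_pair_ratio[OF e] .
  have c: "e \<in> carrier R" "z \<in> carrier R" "z' \<in> carrier R"
    using way_belowD[OF e] way_belowD[OF z(1)] by simp_all
  obtain x where x: "x \<in> carrier R" "[n] \<cdot> z \<oplus> x \<preceq> \<one>" "\<one> \<preceq> [n] \<cdot> z' \<oplus> x"
    using almost_complement[OF add_pow_way_below[OF z(1)] z(3)] .
  have x1: "x \<preceq> \<one>" using le_trans[OF x(1) _ one_closed le_add_right x(2)] x(1) c by simp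
  obtain k :: nat where k: "e \<preceq> [k] \<cdot> z" using simple[OF c(2) z(2) e] by blast
  define y where "y = geometric x z k"
  define y' where "y' = geometric x z' k"
  have yc: "y \<in> carrier R" "y' \<in> carrier R" using x c by (simp_all add: y_def y'_def)
  have "[n] \<cdot> y \<oplus> x [^] k \<preceq> \<one>" unfolding y_def by (rule geometric_le[OF x(1) c(2) x(2)])
  then have ny: "[n] \<cdot> y \<preceq> \<one>" using le_trans[OF _ _ one_closed le_add_left[of _ "x [^] k"]] x(1) yc by simp
  have "e \<otimes> [n] \<cdot> geometric x z' j \<preceq> [Suc n] \<cdot> geometric x z j" for j
  proof (induction j)
    case (Suc j)
    have "e \<otimes> [n] \<cdot> geometric x z' (Suc j) = e \<otimes> [n] \<cdot> z' \<oplus> x \<otimes> (e \<otimes> [n] \<cdot> geometric x z' j)"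
      using x c by (simp add: add.nat_pow_distrib r_distr add_pow_rdistr m_ac)
    also have "\<dots> \<preceq> [Suc n] \<cdot> z \<oplus> x \<otimes> [Suc n] \<cdot> geometric x z j"
      using x c Suc z(4) by (intro add_mono mult_mono) (auto simp del: add.nat_pow_Suc)
    also have "\<dots> = [Suc n] \<cdot> geometric x z (Suc j)"
      using x c by (simp add: add.nat_pow_distrib add_pow_rdistr del: add.nat_pow_Suc)
    finally show ?case .
  qed (use c in simp)
  then have 1: "e \<otimes> [n] \<cdot> y' \<preceq> [Suc n] \<cdot> y" unfolding y_def y'_def .
  have "e \<otimes> x [^] k \<preceq> [k] \<cdot> z \<otimes> x [^] k" using k c x by (intro mult_mono) auto
  also have "[k] \<cdot> z \<otimes> x [^] k = [k] \<cdot> (z \<otimes> x [^] k)" using c x by (simp add: add_pow_ldistr)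
  finally have "e \<otimes> x [^] k \<preceq> [k] \<cdot> (z \<otimes> x [^] k)" .
  then have 2: "e \<otimes> x [^] k \<preceq> y"
    unfolding y_def using le_trans[OF _ _ _ _ pow_le_geometric[OF x(1) c(2) x1]] c x(1) by simp
  have "e \<otimes> \<one> \<preceq> e \<otimes> ([n] \<cdot> y' \<oplus> x [^] k)"
    using le_geometric[OF x(1) c(3) x(3), of k] c x yc by (intro mult_mono) (auto simp: y'_def)
  then have "e \<preceq> e \<otimes> [n] \<cdot> y' \<oplus> e \<otimes> x [^] k" using c x yc by (simp add: r_distr)
  moreover have "e \<otimes> [n] \<cdot> y' \<oplus> e \<otimes> x [^] k \<preceq> [Suc n] \<cdot> y \<oplus> y"
    using 1 2 c x yc by (intro add_mono) (auto simp del: add.nat_pow_Suc)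
  ultimately have "e \<preceq> [Suc n] \<cdot> y \<oplus> y"
    using le_trans[of e "e \<otimes> [n] \<cdot> y' \<oplus> e \<otimes> x [^] k" "[Suc n] \<cdot> y \<oplus> y"] c x yc by (simp del: add.nat_pow_Suc)
  then have "e \<preceq> [(n + 2)] \<cdot> y" using yc by simp
  then show ?thesis using that yc(1) ny by blast
qed

text \<open>Multiples move between the factors: e r <= (n + 2) y r = y ((n + 2) r) <= y (n s) = (n
  y) s <= s.\<close>

lemma almost_unperforated:
  assumes c: "r \<in> carrier R" "s \<in> carrier R" and le: "[(n + 2)] \<cdot> r \<preceq> [(n::nat)] \<cdot> s"
  shows "r \<preceq> s"
proof (rule le_if_unit_mult_le[OF c])
  fix e assume e: "e \<lless> \<one>"
  have ec: "e \<in> carrier R" using way_belowD[OF e] by blast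
  obtain y where y: "y \<in> carrier R" "[n] \<cdot> y \<preceq> \<one>" "e \<preceq> [(n + 2)] \<cdot> y" using almost_divisible_unit[OF e] .
  have "e \<otimes> r \<preceq> [(n + 2)] \<cdot> y \<otimes> r" using y c ec by (intro mult_mono) auto
  also have "[(n + 2)] \<cdot> y \<otimes> r = y \<otimes> [(n + 2)] \<cdot> r"
    using y c by (simp add: add_pow_ldistr add_pow_rdistr del: add.nat_pow_Suc add_2_eq_Suc')
  finally have 1: "e \<otimes> r \<preceq> y \<otimes> [(n + 2)] \<cdot> r" .
  have "y \<otimes> [(n + 2)] \<cdot> r \<preceq> y \<otimes> [n] \<cdot> s" using y c le by (intro mult_mono) auto
  then have 2: "e \<otimes> r \<preceq> y \<otimes> [n] \<cdot> s" using le_trans[OF _ _ _ 1] ec y c by simp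
  have "y \<otimes> [n] \<cdot> s = [n] \<cdot> y \<otimes> s" using y c by (simp add: add_pow_ldistr add_pow_rdistr)
  moreover have "[n] \<cdot> y \<otimes> s \<preceq> \<one> \<otimes> s" using y c by (intro mult_mono) auto
  ultimately show "e \<otimes> r \<preceq> s" using le_trans[OF _ _ c(2) 2] ec y c by simp
qed

lemma unperforated_ratio:
  assumes c: "b \<in> carrier R" "u \<in> carrier R" and le: "[(n'::nat)] \<cdot> b \<preceq> [(k'::nat)] \<cdot> u" and ratio: "k' * n < n' * (k::nat)"
  shows "[(n::nat)] \<cdot> b \<preceq> [k] \<cdot> u"
proof -
  \<comment> \<open>Multiplication by t widens the integer gap \<open>ratio\<close> to t. Lowering
    the factor n' t to n' t - 2 on the right costs 2 k of it, and t >= 2 keeps the subtraction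
    exact.\<close>
  define t where "t = 2 * k + 2"
  have n': "1 \<le> n'" "1 \<le> k" using ratio by (cases n'; cases k; auto)+
  then have "t \<le> n' * t" by simp
  then have tn: "(n' * t - 2) + 2 = n' * t" by (simp add: t_def)
  show ?thesis
  proof (rule almost_unperforated[where n = "n' * t - 2"])
    have "[(n' * t * n)] \<cdot> b = [(n * t)] \<cdot> ([n'] \<cdot> b)" using c by (simp add: add.nat_pow_pow mult_ac)
    also have "\<dots> \<preceq> [(n * t)] \<cdot> ([k'] \<cdot> u)" using c le by (intro add_pow_mono) auto
    also have "\<dots> = [(k' * n * t)] \<cdot> u" using c by (simp add: add.nat_pow_pow mult_ac)
    finally have 1: "[(n' * t * n)] \<cdot> b \<preceq> [(k' * n * t)] \<cdot> u" .
    have "(k' * n + 1) * t \<le> n' * k * t" using ratio by (intro mult_le_mono1) simp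
    then have "k' * n * t + 2 * k \<le> n' * t * k" by (simp add: t_def algebra_simps)
    then have "k' * n * t \<le> k * (n' * t - 2)" by (simp add: diff_mult_distrib2 mult_ac)
    then have "[(k' * n * t)] \<cdot> u \<preceq> [(k * (n' * t - 2))] \<cdot> u" by (rule add_pow_mono_left[OF c(2)])
    then have "[(n' * t * n)] \<cdot> b \<preceq> [(k * (n' * t - 2))] \<cdot> u" using le_trans[OF _ _ _ 1] c by simp
    then show "[((n' * t - 2) + 2)] \<cdot> ([n] \<cdot> b) \<preceq> [(n' * t - 2)] \<cdot> ([k] \<cdot> u)"
      unfolding tn using c by (simp add: add.nat_pow_pow mult_ac)
  qed (use c in auto)
qed

text \<open>\<open>almost_divisible_unit\<close> has the numbers the wrong way round: fewer copies
  of y fit below 1 than are needed to cover e. With s = y e, however, n copies of s lie below e, and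
  the non-zero gap c above e takes further ones. The second factor e is harmless because e0 <= e
  e.\<close>

lemma divisor_with_room:
  assumes e0: "e0 \<lless> \<one>"
  obtains s and n :: nat where "s \<in> carrier R" "0 < n" "e0 \<preceq> [n] \<cdot> s" "[(n + 2)] \<cdot> s \<preceq> \<one>"
proof -
  obtain d where d: "\<forall>i. d i \<lless> d (Suc i)" "is_sup R (range d) \<one>" using O2[OF one_closed] by blast
  have inc: "increasing R d" by (rule way_below_increasing[OF d(1)])
  have "is_sup R (range (\<lambda>i. d i \<otimes> d i)) (\<one> \<otimes> \<one>)" by (rule M.bim_sup[OF inc inc d(2) d(2)])
  moreover have "increasing R (\<lambda>i. d i \<otimes> d i)" using inc by (auto simp: increasing_def intro: mult_mono)
  ultimately obtain i where i: "e0 \<preceq> d i \<otimes> d i" using e0 unfolding way_below_def by fastforce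
  define e where "e = d i"
  have e: "e \<lless> \<one>" "e0 \<preceq> e \<otimes> e" using is_sup_below[OF d] i by (simp_all add: e_def)
  have ec: "e \<in> carrier R" "e0 \<in> carrier R" using way_belowD[OF e(1)] way_belowD[OF e0] by simp_all
  obtain c where c: "c \<in> carrier R" "c \<noteq> \<zero>" "e \<oplus> c \<preceq> \<one>" using gap[OF e(1)] .
  obtain p :: nat where p: "e \<preceq> [p] \<cdot> c" using simple[OF c(1,2) e(1)] by blast
  \<comment> \<open>From e <= p c follows 4 s <= 4 p y c = n y c <= c, so four additional copies
    fit. Two make up for the n + 2 copies in the cover, and two remain as room.\<close>
  define n where "n = 4 * p"
  obtain y where y: "y \<in> carrier R" "[n] \<cdot> y \<preceq> \<one>" "e \<preceq> [(n + 2)] \<cdot> y" using almost_divisible_unit[OF e(1)] .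
  define s where "s = y \<otimes> e"
  have sc: "s \<in> carrier R" using y ec by (simp add: s_def)
  have "e \<otimes> e \<preceq> [(n + 2)] \<cdot> y \<otimes> e" using y ec by (intro mult_mono) auto
  moreover have "[(n + 2)] \<cdot> y \<otimes> e = [(n + 2)] \<cdot> s"
    using y ec by (simp add: add_pow_ldistr s_def del: add.nat_pow_Suc add_2_eq_Suc')
  ultimately have 1: "e0 \<preceq> [(n + 2)] \<cdot> s" using le_trans[OF ec(2) _ _ e(2)] ec sc by simp
  have "[n] \<cdot> s = [n] \<cdot> y \<otimes> e" using y ec by (simp add: add_pow_ldistr s_def)
  moreover have "[n] \<cdot> y \<otimes> e \<preceq> \<one> \<otimes> e" using y ec by (intro mult_mono) auto
  ultimately have 2: "[n] \<cdot> s \<preceq> e" using ec by simp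
  have "y \<otimes> e \<preceq> y \<otimes> [p] \<cdot> c" using y ec c p by (intro mult_mono) auto
  then have "[(4::nat)] \<cdot> s \<preceq> [(4::nat)] \<cdot> (y \<otimes> [p] \<cdot> c)" unfolding s_def using y ec c by (intro add_pow_mono) auto
  also have "[(4::nat)] \<cdot> (y \<otimes> [p] \<cdot> c) = [n] \<cdot> y \<otimes> c"
    using y c by (simp only: add_pow_ldistr add_pow_rdistr add.nat_pow_pow m_closed add.nat_pow_closed n_def mult.commute)
  finally have 3: "[(4::nat)] \<cdot> s \<preceq> [n] \<cdot> y \<otimes> c" .
  have "[n] \<cdot> y \<otimes> c \<preceq> \<one> \<otimes> c" using y c by (intro mult_mono) auto
  then have "[(4::nat)] \<cdot> s \<preceq> c" using le_trans[OF _ _ c(1) 3] y sc c by simp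
  then have "[n] \<cdot> s \<oplus> [(4::nat)] \<cdot> s \<preceq> e \<oplus> c" using 2 sc ec c by (intro add_mono) auto
  then have "[n] \<cdot> s \<oplus> [(4::nat)] \<cdot> s \<preceq> \<one>" using le_trans[OF _ _ one_closed _ c(3)] sc ec c by simp
  then have "[(n + 4)] \<cdot> s \<preceq> \<one>" using sc by (simp add: add.nat_pow_mult)
  moreover have "n + 4 = n + 2 + 2" by simp
  ultimately have "[(n + 2 + 2)] \<cdot> s \<preceq> \<one>" by (simp only:)
  then show ?thesis using that[OF sc _ 1] by simp
qed

text \<open>Preservation of suprema is not demanded, as the cuts obtained by extension need not have
  it. The comparison of two functionals therefore shifts its arguments along way-below.\<close>

definition functional :: "('a \<Rightarrow> ennreal) \<Rightarrow> bool" where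
  "functional h \<longleftrightarrow> h \<zero> = 0 \<and> (\<forall>x\<in>carrier R. \<forall>y\<in>carrier R. h (x \<oplus> y) = h x + h y) \<and>
     (\<forall>x\<in>carrier R. \<forall>y\<in>carrier R. x \<preceq> y \<longrightarrow> h x \<le> h y)"

lemma functional_add_pow: "\<lbrakk>functional h; x \<in> carrier R\<rbrakk> \<Longrightarrow> h ([(n::nat)] \<cdot> x) = of_nat n * h x"
  by (induction n) (auto simp: functional_def distrib_right add.commute)

lemma functional_mono: "\<lbrakk>functional h; x \<in> carrier R; y \<in> carrier R; x \<preceq> y\<rbrakk> \<Longrightarrow> h x \<le> h y"
  by (simp add: functional_def)

text \<open>Up to scaling there is at most one functional, because \<open>r \<otimes> s = s \<otimes> r\<close> in \<open>R \<otimes> R\<close>.\<close>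

lemma functional_unique:
  assumes g: "functional g" and h: "functional h" and wb: "r' \<lless> r" "s' \<lless> s"
  shows "g r' * h s' \<le> g s * h r"
proof -
  have c: "r \<in> carrier R" "s \<in> carrier R" using way_belowD[OF wb(1)] way_belowD[OF wb(2)] by simp_all
  interpret E: positively_ordered_semigroup ennreal_semigroup by (rule positively_ordered_ennreal)
  have bi: "biadditive_pair R R ennreal_semigroup (\<lambda>x y. g x * h y)"
    using g h by unfold_locales
      (auto simp: ennreal_semigroup_def functional_def distrib_left distrib_right intro: mult_left_mono mult_right_mono)
  obtain a b where ab: "a \<lless> s" "b \<lless> r" "g r' * h s' \<preceq>\<^bsub>ennreal_semigroup\<^esub> g a * h b"
    using solid_biadditive_le[OF bi c c(2,1) m_comm[OF c] wb] .
  have "g a \<le> g s" "h b \<le> h r"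
    using functional_mono[OF g _ _ way_below_imp_le[OF ab(1)]] functional_mono[OF h _ _ way_below_imp_le[OF ab(2)]]
      way_belowD[OF ab(1)] way_belowD[OF ab(2)] by simp_all
  then have "g a * h b \<le> g s * h r" by (rule mult_mono') auto
  then show ?thesis using ab(3) by (simp add: ennreal_semigroup_def)
qed

text \<open>If this fails, every non-zero f way below 1 admits g way below 1 and a functional k with
  k(f) = 1 and k(g) >= (n + 1)/n. By uniqueness a fixed functional h shows the same excess, so
  \<Lambda>, the supremum of h over the elements way below 1, satisfies (n + 1) \<Lambda> <= n
  \<Lambda>. Being finite, it vanishes, against h(u) = 1.\<close>

lemma unit_bounded:
  assumes n: "0 < n"
  shows "\<exists>e. e \<lless> \<one> \<and> [(n::nat)] \<cdot> \<one> \<preceq> [(n + 2)] \<cdot> e"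
proof (rule ccontr)
  assume no: "\<nexists>e. e \<lless> \<one> \<and> [n] \<cdot> \<one> \<preceq> [(n + 2)] \<cdot> e"
  have ex: "\<exists>h g. functional h \<and> h f = 1 \<and> g \<lless> \<one> \<and> of_nat (n + 1) \<le> of_nat n * h g"
    if f: "f \<lless> \<one>" "f \<noteq> \<zero>" for f
  proof -
    have fc: "f \<in> carrier R" using way_belowD[OF f(1)] by blast
    have "\<not> [n] \<cdot> \<one> \<preceq> [(n + 2)] \<cdot> f" using no f(1) by blast
    then obtain g where g: "g \<lless> \<one>" "\<not> g \<otimes> [n] \<cdot> \<one> \<preceq> [(n + 2)] \<cdot> f"
      using le_if_unit_mult_le[of "[n] \<cdot> \<one>" "[(n + 2)] \<cdot> f"] fc by auto
    have gc: "g \<in> carrier R" using way_belowD[OF g(1)] by blast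
    have ng: "\<not> [n] \<cdot> g \<preceq> [(n + 2)] \<cdot> f" using g(2) gc by (simp add: add_pow_rdistr del: add.nat_pow_Suc add_2_eq_Suc')
    have gb: "g \<in> bounded_by f" using simple[OF fc f(2) g(1)] gc by (simp add: bounded_by_def)
    have bound: "n' * (n + 2) \<le> k' * n" if "0 < n'" "[n'] \<cdot> g \<preceq> [k'] \<cdot> f" for n' k' :: nat
      using unperforated_ratio[OF gc fc that(2), of n "n + 2"] ng by linarith
    \<comment> \<open>The value n + 1 leaves the strict gap below n + 2 that the extension needs and
      still exceeds n.\<close>
    have ratio: "(n + 1) * n < (n + 2) * n" using n by simp
    have "\<exists>h. functional h \<and> h f = 1 \<and> of_nat (n + 1) \<le> of_nat n * h g"
    proof (rule additive_functional_exists[OF fc gb ratio bound])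
      fix h :: "'a \<Rightarrow> ennreal"
      assume "h \<zero> = 0" "\<And>x y. \<lbrakk>x \<in> carrier R; y \<in> carrier R\<rbrakk> \<Longrightarrow> h (x \<oplus> y) = h x + h y"
        "\<And>x y. \<lbrakk>x \<in> carrier R; y \<in> carrier R; x \<preceq> y\<rbrakk> \<Longrightarrow> h x \<le> h y"
        "h f = 1" "of_nat (n + 1) \<le> of_nat n * h g"
      then show ?thesis unfolding functional_def by (intro exI[of _ h] conjI ballI impI)
    qed
    then show ?thesis using g(1) by blast
  qed
  obtain u where u: "u \<lless> \<one>" "u \<noteq> \<zero>" using nonzero_way_below[OF one_closed one_nonzero] .
  obtain u1 where u1: "u \<lless> u1" "u1 \<lless> \<one>" using way_below_interpolate[OF u(1)] .
  have uc: "u \<in> carrier R" "u1 \<in> carrier R" using way_belowD[OF u1(1)] by simp_all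
  obtain h where h: "functional h" "h u = 1" using ex[OF u] by blast
  obtain m :: nat where m: "u1 \<preceq> [m] \<cdot> u" using simple[OF uc(1) u(2) u1(2)] by blast
  have "u \<otimes> u \<noteq> \<zero>" using no_zero_divisors[OF uc(1) uc(1)] u(2) by blast
  then obtain m' :: nat where m': "u \<preceq> [m'] \<cdot> (u \<otimes> u)" using simple[OF _ _ u(1), of "u \<otimes> u"] uc by auto
  \<comment> \<open>Comparing h with its translate by u shows that h is bounded on the elements way
    below 1: h(u u) h(e) <= h(e' u) h(u1) <= m, and h(u u) is positive because u lies below a
    multiple of u u.\<close>
  have "functional (\<lambda>x. h (x \<otimes> u))"
    using h(1) uc(1) M.bim_mono_left unfolding functional_def by (simp add: l_distr)
  then have bound: "h e \<le> of_nat (m' * m)" if e: "e \<lless> \<one>" for e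
  proof -
    obtain e' where e': "e \<lless> e'" "e' \<lless> \<one>" using way_below_interpolate[OF e] .
    have ec: "e \<in> carrier R" "e' \<in> carrier R" using way_belowD[OF e'(1)] by simp_all
    have "h (u \<otimes> u) * h e \<le> h (e' \<otimes> u) * h u1"
      by (rule functional_unique[OF \<open>functional (\<lambda>x. h (x \<otimes> u))\<close> h(1) u1(1) e'(1)])
    also have "h (e' \<otimes> u) \<le> h u"
      using functional_mono[OF h(1), of "e' \<otimes> u" u] mult_le_left[OF uc(1) ec(2) way_below_imp_le[OF e'(2)]] ec uc
      by (simp add: m_comm)
    also have "h u = 1" by (rule h(2))
    also have "h u1 \<le> of_nat m"
      using functional_mono[OF h(1) uc(2) _ m] functional_add_pow[OF h(1) uc(1), of m] h(2) uc by simp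
    finally have 1: "h (u \<otimes> u) * h e \<le> of_nat m" by (simp add: mult_left_mono mult_right_mono)
    have "1 \<le> of_nat m' * h (u \<otimes> u)"
      using functional_mono[OF h(1) uc(1) _ m'] functional_add_pow[OF h(1), of "u \<otimes> u" m'] h(2) uc by simp
    then have "1 * h e \<le> of_nat m' * h (u \<otimes> u) * h e" by (rule mult_right_mono) simp
    also have "\<dots> = of_nat m' * (h (u \<otimes> u) * h e)" by (simp add: mult.assoc)
    also have "\<dots> \<le> of_nat m' * of_nat m" using 1 by (rule mult_left_mono) simp
    finally show ?thesis by simp
  qed
  define \<Lambda> where "\<Lambda> = (SUP e\<in>{e. e \<lless> \<one>}. h e)"
  have upper: "h e \<le> \<Lambda>" if "e \<lless> \<one>" for e unfolding \<Lambda>_def using that by (intro SUP_upper) simp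
  have fin: "\<Lambda> \<le> of_nat (m' * m)" unfolding \<Lambda>_def using bound by (intro SUP_least) simp
  have step: "of_nat (n + 1) * h e \<le> of_nat n * \<Lambda>" if e: "e \<lless> \<one>" for e
  proof (cases "e = \<zero>")
    case True
    then show ?thesis using h(1) by (simp add: functional_def)
  next
    case False
    \<comment> \<open>The functional k is normalised at f strictly above e, which leaves the room
      needed for comparing k(g) h(e) with k(f) h(g').\<close>
    obtain f where f: "e \<lless> f" "f \<lless> \<one>" using way_below_interpolate[OF e] .
    have "f \<noteq> \<zero>" using way_below_imp_le[OF f(1)] False way_belowD[OF f(1)] le_zero_iff[of e] by auto
    then obtain k g where k: "functional k" "k f = 1" "g \<lless> \<one>" "of_nat (n + 1) \<le> of_nat n * k g" using ex[OF f(2)] by blast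
    obtain g' where g': "g \<lless> g'" "g' \<lless> \<one>" using way_below_interpolate[OF k(3)] .
    have "k g * h e \<le> k f * h g'" by (rule functional_unique[OF k(1) h(1) g'(1) f(1)])
    then have 1: "k g * h e \<le> \<Lambda>" using k(2) upper[OF g'(2)] by simp
    have "of_nat (n + 1) * h e \<le> of_nat n * k g * h e" using k(4) by (rule mult_right_mono) simp
    also have "\<dots> = of_nat n * (k g * h e)" by (simp add: mult.assoc)
    also have "\<dots> \<le> of_nat n * \<Lambda>" using 1 by (rule mult_left_mono) simp
    finally show ?thesis .
  qed
  have "of_nat (n + 1) * \<Lambda> \<le> of_nat n * \<Lambda>"
    unfolding \<Lambda>_def SUP_mult_left_ennreal using step[unfolded \<Lambda>_def SUP_mult_left_ennreal]
    by (intro SUP_least) simp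
  then have "\<Lambda> + of_nat n * \<Lambda> \<le> 0 + of_nat n * \<Lambda>" by (simp add: distrib_right)
  moreover have "of_nat n * \<Lambda> \<noteq> Orderings.top"
    using fin by (auto simp: ennreal_mult_eq_top_iff top_unique)
  ultimately have "\<Lambda> \<le> 0" by (simp add: ennreal_add_left_cancel_le add.commute)
  then show False using upper[OF u(1)] h(2) by simp
qed

theorem unit_divisible:
  assumes "e \<lless> \<one>"
  shows "\<exists>(n::nat) (k::nat) s e'. s \<in> carrier R \<and> e \<preceq> [n] \<cdot> s \<and> [k] \<cdot> s \<preceq> \<one> \<and> e' \<lless> \<one> \<and> [n] \<cdot> \<one> \<preceq> [k] \<cdot> e'"
proof -
  obtain s and n :: nat where s: "s \<in> carrier R" "0 < n" "e \<preceq> [n] \<cdot> s" "[(n + 2)] \<cdot> s \<preceq> \<one>"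
    using divisor_with_room[OF assms] .
  then show ?thesis using unit_bounded[OF s(2)] by blast
qed

end

section \<open>The evaluation map of a solid Cu-semiring\<close>

theorem mainTheorem2:
  fixes R :: "('a, 'm) cu_scheme" (structure)
  assumes "cu_semiring R"
  shows "(solid R \<and> (cu_compact R \<one> \<or> cu_O5 R \<and> cu_O6 R) \<longrightarrow>
            cu_iso (cu_tensor (cu_hom R R) R) R (evaluation R R)) \<and>
         (cu_compact R \<one> \<longrightarrow>
            (solid R \<longleftrightarrow> cu_iso (cu_tensor (cu_hom R R) R) R (evaluation R R)))"
proof -
  interpret cu_semiring R by fact
  have iso: "cu_iso (cu_tensor (cu_hom R R) R) R (evaluation R R)"
    if solid: "solid R" and cases: "cu_compact R \<one> \<or> cu_O5 R"
  proof -
    interpret S: solid_cu_semiring R by unfold_locales (rule solid)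
    show ?thesis
    proof (rule evaluation_iso_if_pure_tensors[OF solid S.endpoint_eq_mult])
      fix F t assume F: "F \<in> carrier hom_R" and t: "t \<in> carrier R"
      show "pure_tensor hom_R R F t = pure_tensor hom_R R (mult_hom (endpoint R R F \<one>)) t"
      proof (cases "cu_compact R \<one>")
        case True
        then show ?thesis using S.hom_class_eq_mult_hom_if_compact[OF _ F] by simp
      next
        case False
        then interpret N: noncompact_solid_cu_semiring R
          using cases by unfold_locales auto
        show ?thesis by (rule S.pure_tensor_eq_if_divisible[OF N.unit_divisible F t])
      qed
    qed
  qed
  then show ?thesis using solid_if_evaluation_iso by blast
qed

end
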